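(* Let $A$ and $B$ be groups, $H\leqslant A$ and $K\leqslant B$ subgroups, $\varphi: H\to K$ an isomorphism, and let $G=(A*B;\,H=K,\varphi)$ be the free product of $A$ and $B$ with $H$ and $K$ amalgamated according to $\varphi$. Suppose that $A$ and $B$ are residually finite, that $H$ is finitely separable in $A$ and $K$ is finitely separable in $B$, and that for any normal subgroups of finite index $M\leqslant A$ and $N\leqslant B$ there exists a pair $(R,S)\in\Omega$ such that $R\leqslant M$ and $S\leqslant N$. Then every cyclic subgroup of $G$ that is not conjugate in $G$ to any subgroup of the family $\Delta_A\cup\Delta_B$ is finitely separable in $G$. In particular, if $A$ and $B$ are $\pi_c$-groups, then $G$ is also a $\pi_c$-group.
   Context: A subgroup $F$ of a group $X$ is finitely separable in $X$ if for every $g\in X\setminus F$ there is a homomorphism $\psi$ of $X$ onto a finite group with $g\psi\notin F\psi$. $X$ is residually finite if its trivial subgroup is finitely separable. A $\pi_c$-group is a group all of whose cyclic subgroups are finitely separable. Subgroups $R\leqslant A$ and $S\leqslant B$ are $(H,K,\varphi)$-compatible if $(R\cap H)\varphi=S\cap K$. $\Omega$ is the set of all pairs $(R,S)$ where $R$ is a normal subgroup of finite index of $A$, $S$ is a normal subgroup of finite index of $B$, and $R,S$ are $(H,K,\varphi)$-compatible. $\Delta_A$ (resp. $\Delta_B$) is the family of all cyclic subgroups of $A$ (resp. $B$) that are not finitely separable in $A$ (resp. $B$). *)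

theory Defs
  imports "HOL-Algebra.Generated_Groups"
begin

section \<open>Finite separability\<close>

(* Up to isomorphism every finite group has a carrier of type nat set, so quantifying over
   nat monoid below covers all finite images; see finitely_separableI. *)
definition finitely_separable :: "('a, 'm) monoid_scheme \<Rightarrow> 'a set \<Rightarrow> bool" where
  "finitely_separable X F \<longleftrightarrow>
     subgroup F X \<and>
     (\<forall>g \<in> carrier X - F. \<exists>(Q :: nat monoid) \<psi>.
        group Q \<and> finite (carrier Q) \<and> \<psi> \<in> epi X Q \<and> \<psi> g \<notin> \<psi> ` F)"

lemma finitely_separableI:
  fixes X :: "('a, 'm) monoid_scheme" and Q :: "'a \<Rightarrow> ('c, 'n) monoid_scheme"
  assumes F: "subgroup F X"
    and sep: "\<And>g. g \<in> carrier X - F \<Longrightarrow>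
      group (Q g) \<and> finite (carrier (Q g)) \<and> \<psi> g \<in> epi X (Q g) \<and> \<psi> g g \<notin> \<psi> g ` F"
  shows "finitely_separable X F"
  unfolding finitely_separable_def
proof (intro conjI ballI F)
  fix g assume g: "g \<in> carrier X - F"
  let ?Q = "Q g"
  interpret Q: group ?Q using sep[OF g] by blast
  obtain e :: "'c \<Rightarrow> nat" where e: "inj_on e (carrier ?Q)"
    using sep[OF g] finite_imp_inj_to_nat_seg by metis
  define d where "d = inv_into (carrier ?Q) e"
  define N :: "nat monoid" where
    "N = \<lparr>carrier = e ` carrier ?Q, mult = \<lambda>x y. e (d x \<otimes>\<^bsub>?Q\<^esub> d y), one = e \<one>\<^bsub>?Q\<^esub>\<rparr>"
  have de: "d (e x) = x" if "x \<in> carrier ?Q" for x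
    using that e by (simp add: d_def)
  have N: "group N"
  proof (rule groupI)
    fix x assume "x \<in> carrier N"
    then obtain a where a: "a \<in> carrier ?Q" "x = e a" by (auto simp: N_def)
    then show "\<exists>y\<in>carrier N. y \<otimes>\<^bsub>N\<^esub> x = \<one>\<^bsub>N\<^esub>"
      by (intro bexI[of _ "e (inv\<^bsub>?Q\<^esub> a)"]) (auto simp: N_def de)
  qed (auto simp: N_def de Q.m_assoc)
  have psi: "\<psi> g ` carrier X = carrier ?Q" "\<psi> g \<in> hom X ?Q" "\<psi> g g \<notin> \<psi> g ` F"
    using sep[OF g] by (auto simp: epi_def)
  have cl: "\<psi> g x \<in> carrier ?Q" if "x \<in> carrier X" for x
    using psi(1) that by blast
  have "e \<circ> \<psi> g \<in> epi X N"
    using psi(1,2) cl unfolding epi_def hom_def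
    by (auto simp: N_def de simp flip: psi(1))
  moreover have "(e \<circ> \<psi> g) g \<notin> (e \<circ> \<psi> g) ` F"
  proof
    assume "(e \<circ> \<psi> g) g \<in> (e \<circ> \<psi> g) ` F"
    then obtain f where f: "f \<in> F" "e (\<psi> g g) = e (\<psi> g f)" by auto
    then have "\<psi> g g = \<psi> g f"
      using e g cl subgroup.subset[OF F] by (auto dest!: inj_onD)
    with f psi(3) show False by auto
  qed
  moreover have "finite (carrier N)"
    using sep[OF g] by (simp add: N_def)
  ultimately show "\<exists>(Q :: nat monoid) \<psi>.
      group Q \<and> finite (carrier Q) \<and> \<psi> \<in> epi X Q \<and> \<psi> g \<notin> \<psi> ` F"
    using N by blast
qed

definition residually_finite :: "('a, 'm) monoid_scheme \<Rightarrow> bool" where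
  "residually_finite X \<longleftrightarrow> group X \<and> finitely_separable X {\<one>\<^bsub>X\<^esub>}"

definition cyclic_subgroup :: "'a set \<Rightarrow> ('a, 'm) monoid_scheme \<Rightarrow> bool" where
  "cyclic_subgroup C X \<longleftrightarrow> (\<exists>x \<in> carrier X. C = generate X {x})"

definition pi_c_group :: "('a, 'm) monoid_scheme \<Rightarrow> bool" where
  "pi_c_group X \<longleftrightarrow> group X \<and> (\<forall>C. cyclic_subgroup C X \<longrightarrow> finitely_separable X C)"

definition nonseparable_cyclics :: "('a, 'm) monoid_scheme \<Rightarrow> 'a set set" where
  "nonseparable_cyclics X = {C. cyclic_subgroup C X \<and> \<not> finitely_separable X C}"

definition conjugate_subgroups :: "('a, 'm) monoid_scheme \<Rightarrow> 'a set \<Rightarrow> 'a set \<Rightarrow> bool" where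
  "conjugate_subgroups X C D \<longleftrightarrow> (\<exists>g \<in> carrier X. C = g <#\<^bsub>X\<^esub> D #>\<^bsub>X\<^esub> (inv\<^bsub>X\<^esub> g))"

definition normal_finite_index :: "'a set \<Rightarrow> ('a, 'm) monoid_scheme \<Rightarrow> bool" where
  "normal_finite_index N X \<longleftrightarrow> N \<lhd> X \<and> finite (rcosets\<^bsub>X\<^esub> N)"

definition compatible :: "'a set \<Rightarrow> 'b set \<Rightarrow> ('a \<Rightarrow> 'b) \<Rightarrow> 'a set \<Rightarrow> 'b set \<Rightarrow> bool" where
  "compatible H K \<phi> R S \<longleftrightarrow> \<phi> ` (R \<inter> H) = S \<inter> K"

definition Omega ::
  "('a, 'm) monoid_scheme \<Rightarrow> ('b, 'n) monoid_scheme \<Rightarrow> 'a set \<Rightarrow> 'b set \<Rightarrow> ('a \<Rightarrow> 'b) \<Rightarrow>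
   ('a set \<times> 'b set) set" where
  "Omega A B H K \<phi> =
     {(R, S). normal_finite_index R A \<and> normal_finite_index S B \<and> compatible H K \<phi> R S}"


section \<open>The free product with amalgamation\<close>

(* The group presented by the elements of A and B as generators, subject to the multiplication
   tables of A and B and to h = h \<phi> for h in H. Every generator has an inverse
   among the generators, so positive words suffice. amalg_cong is the least congruence on such
   words that contains the relations. K enters only as the image of H under \<phi>. *)
inductive amalg_cong ::
  "('a, 'm) monoid_scheme \<Rightarrow> ('b, 'n) monoid_scheme \<Rightarrow> 'a set \<Rightarrow> ('a \<Rightarrow> 'b) \<Rightarrow>
   ('a + 'b) list \<Rightarrow> ('a + 'b) list \<Rightarrow> bool"
  for A B H \<phi> where
    refl: "w \<in> lists (carrier A <+> carrier B) \<Longrightarrow> amalg_cong A B H \<phi> w w"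
  | sym: "amalg_cong A B H \<phi> v w \<Longrightarrow> amalg_cong A B H \<phi> w v"
  | trans: "amalg_cong A B H \<phi> u v \<Longrightarrow> amalg_cong A B H \<phi> v w \<Longrightarrow> amalg_cong A B H \<phi> u w"
  | append: "amalg_cong A B H \<phi> v v' \<Longrightarrow> amalg_cong A B H \<phi> w w' \<Longrightarrow>
      amalg_cong A B H \<phi> (v @ w) (v' @ w')"
  | one_left: "amalg_cong A B H \<phi> [Inl \<one>\<^bsub>A\<^esub>] []"
  | one_right: "amalg_cong A B H \<phi> [Inr \<one>\<^bsub>B\<^esub>] []"
  | mult_left: "x \<in> carrier A \<Longrightarrow> y \<in> carrier A \<Longrightarrow>
      amalg_cong A B H \<phi> [Inl x, Inl y] [Inl (x \<otimes>\<^bsub>A\<^esub> y)]"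
  | mult_right: "x \<in> carrier B \<Longrightarrow> y \<in> carrier B \<Longrightarrow>
      amalg_cong A B H \<phi> [Inr x, Inr y] [Inr (x \<otimes>\<^bsub>B\<^esub> y)]"
  | amalg: "h \<in> H \<Longrightarrow> amalg_cong A B H \<phi> [Inl h] [Inr (\<phi> h)]"

definition amalg_class ::
  "('a, 'm) monoid_scheme \<Rightarrow> ('b, 'n) monoid_scheme \<Rightarrow> 'a set \<Rightarrow> ('a \<Rightarrow> 'b) \<Rightarrow>
   ('a + 'b) list \<Rightarrow> ('a + 'b) list set" where
  "amalg_class A B H \<phi> w = {v. amalg_cong A B H \<phi> w v}"

definition amalg_product ::
  "('a, 'm) monoid_scheme \<Rightarrow> ('b, 'n) monoid_scheme \<Rightarrow> 'a set \<Rightarrow> ('a \<Rightarrow> 'b) \<Rightarrow>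
   ('a + 'b) list set monoid" where
  "amalg_product A B H \<phi> =
     \<lparr>carrier = amalg_class A B H \<phi> ` lists (carrier A <+> carrier B),
      mult = \<lambda>U V. \<Union>u \<in> U. \<Union>v \<in> V. amalg_class A B H \<phi> (u @ v),
      one = amalg_class A B H \<phi> []\<rparr>"

definition amalg_inl ::
  "('a, 'm) monoid_scheme \<Rightarrow> ('b, 'n) monoid_scheme \<Rightarrow> 'a set \<Rightarrow> ('a \<Rightarrow> 'b) \<Rightarrow>
   'a \<Rightarrow> ('a + 'b) list set" where
  "amalg_inl A B H \<phi> a = amalg_class A B H \<phi> [Inl a]"

definition amalg_inr ::
  "('a, 'm) monoid_scheme \<Rightarrow> ('b, 'n) monoid_scheme \<Rightarrow> 'a set \<Rightarrow> ('a \<Rightarrow> 'b) \<Rightarrow>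
   'b \<Rightarrow> ('a + 'b) list set" where
  "amalg_inr A B H \<phi> b = amalg_class A B H \<phi> [Inr b]"

locale amalgamation = A: group A + B: group B
  for A :: "('a, 'm) monoid_scheme" and B :: "('b, 'n) monoid_scheme" +
  fixes H :: "'a set" and \<phi> :: "'a \<Rightarrow> 'b"
  assumes H_carrier: "H \<subseteq> carrier A"
    and phi_carrier: "\<phi> ` H \<subseteq> carrier B"
begin

abbreviation "W \<equiv> lists (carrier A <+> carrier B)"
abbreviation "cong \<equiv> amalg_cong A B H \<phi>"
abbreviation "cls \<equiv> amalg_class A B H \<phi>"
abbreviation "P \<equiv> amalg_product A B H \<phi>"

lemma cong_words: "cong v w \<Longrightarrow> v \<in> W \<and> w \<in> W"
  by (induction rule: amalg_cong.induct) (use H_carrier phi_carrier in \<open>auto simp: Plus_def\<close>)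

lemma class_eq: "cong v w \<Longrightarrow> cls v = cls w"
  unfolding amalg_class_def by (auto intro: amalg_cong.sym amalg_cong.trans)

lemma mult_class: "v \<in> W \<Longrightarrow> w \<in> W \<Longrightarrow> cls v \<otimes>\<^bsub>P\<^esub> cls w = cls (v @ w)"
proof -
  assume w: "v \<in> W" "w \<in> W"
  have eq: "cls (v' @ w') = cls (v @ w)" if "v' \<in> cls v" "w' \<in> cls w" for v' w'
    using that by (intro class_eq) (auto simp: amalg_class_def intro: amalg_cong.append amalg_cong.sym)
  have mem: "v \<in> cls v" "w \<in> cls w"
    using w by (auto simp: amalg_class_def intro: amalg_cong.refl)
  have "cls v \<otimes>\<^bsub>P\<^esub> cls w = (\<Union>v' \<in> cls v. \<Union>w' \<in> cls w. cls (v' @ w'))"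
    by (simp add: amalg_product_def)
  also have "\<dots> = (\<Union>v' \<in> cls v. \<Union>w' \<in> cls w. cls (v @ w))"
    using eq by simp
  also have "\<dots> = cls (v @ w)"
    using mem by auto
  finally show ?thesis .
qed

lemma carrier_P: "carrier P = cls ` W" and one_P: "\<one>\<^bsub>P\<^esub> = cls []"
  by (simp_all add: amalg_product_def)

lemma left_inverse_word: "w \<in> W \<Longrightarrow> \<exists>v \<in> W. cong (v @ w) []"
proof (induction w)
  case Nil
  then show ?case by (auto intro: amalg_cong.refl bexI[of _ "[]"])
next
  case (Cons x w)
  then obtain v where v: "v \<in> W" "cong (v @ w) []" and x: "x \<in> carrier A <+> carrier B" by auto
  have "\<exists>y. y \<in> carrier A <+> carrier B \<and> cong [y, x] []"
  proof (cases x)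
    case (Inl a)
    with x have a: "a \<in> carrier A" by auto
    then have "cong [Inl (inv\<^bsub>A\<^esub> a), Inl a] []"
      using amalg_cong.trans[OF amalg_cong.mult_left[of "inv\<^bsub>A\<^esub> a" A a B H \<phi>], of "[]"]
        amalg_cong.one_left[of A B H \<phi>] by simp
    with Inl a show ?thesis by (intro exI[of _ "Inl (inv\<^bsub>A\<^esub> a)"]) auto
  next
    case (Inr b)
    with x have b: "b \<in> carrier B" by auto
    then have "cong [Inr (inv\<^bsub>B\<^esub> b), Inr b] []"
      using amalg_cong.trans[OF amalg_cong.mult_right[of "inv\<^bsub>B\<^esub> b" B b A H \<phi>], of "[]"]
        amalg_cong.one_right[of A B H \<phi>] by simp
    with Inr b show ?thesis by (intro exI[of _ "Inr (inv\<^bsub>B\<^esub> b)"]) auto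
  qed
  then obtain y where y: "y \<in> carrier A <+> carrier B" "cong [y, x] []" by blast
  have w: "cong w w" and v': "cong v v" using Cons v by (auto intro: amalg_cong.refl)
  have "cong (v @ ([y, x] @ w)) (v @ ([] @ w))"
    by (intro amalg_cong.append v' y w)
  then have "cong ((v @ [y]) @ (x # w)) []"
    using v(2) by (auto intro: amalg_cong.trans)
  then show ?case using v y by (intro bexI[of _ "v @ [y]"]) auto
qed

lemma group_P: "group P"
proof (rule groupI)
  fix U assume "U \<in> carrier P"
  then obtain u where u: "u \<in> W" "U = cls u" by (auto simp: carrier_P)
  then obtain v where "v \<in> W" "cong (v @ u) []" using left_inverse_word by blast
  with u show "\<exists>V\<in>carrier P. V \<otimes>\<^bsub>P\<^esub> U = \<one>\<^bsub>P\<^esub>"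
    by (intro bexI[of _ "cls v"]) (simp_all add: carrier_P one_P mult_class class_eq del: lists_eq_set)
next
  fix U V T assume "U \<in> carrier P" "V \<in> carrier P" "T \<in> carrier P"
  then obtain u v t where "u \<in> W" "U = cls u" "v \<in> W" "V = cls v" "t \<in> W" "T = cls t"
    by (auto simp: carrier_P)
  moreover from this have "u @ v \<in> W" "v @ t \<in> W" by (simp_all del: lists_eq_set)
  ultimately show "U \<otimes>\<^bsub>P\<^esub> V \<otimes>\<^bsub>P\<^esub> T = U \<otimes>\<^bsub>P\<^esub> (V \<otimes>\<^bsub>P\<^esub> T)"
    by (simp add: mult_class del: lists_eq_set)
next
  fix U V assume "U \<in> carrier P" "V \<in> carrier P"
  then obtain u v where uv: "u \<in> W" "U = cls u" "v \<in> W" "V = cls v"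
    by (auto simp: carrier_P)
  then have "u @ v \<in> W" by (simp del: lists_eq_set)
  then show "U \<otimes>\<^bsub>P\<^esub> V \<in> carrier P"
    unfolding carrier_P uv(2,4) mult_class[OF uv(1,3)] by (rule imageI)
next
  show "\<one>\<^bsub>P\<^esub> \<in> carrier P" unfolding carrier_P one_P by (rule imageI) simp
next
  fix U assume "U \<in> carrier P"
  then obtain u where u: "u \<in> W" "U = cls u" by (auto simp: carrier_P)
  then show "\<one>\<^bsub>P\<^esub> \<otimes>\<^bsub>P\<^esub> U = U" using mult_class[of "[]" u] by (simp add: one_P)
qed

lemma inl_hom: "amalg_inl A B H \<phi> \<in> hom A P"
  by (rule homI) (simp_all add: amalg_inl_def carrier_P mult_class InlI InrI image_eqI
      class_eq[OF amalg_cong.mult_left] del: lists_eq_set)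

lemma inr_hom: "amalg_inr A B H \<phi> \<in> hom B P"
  by (rule homI) (simp_all add: amalg_inr_def carrier_P mult_class InlI InrI image_eqI
      class_eq[OF amalg_cong.mult_right] del: lists_eq_set)

lemma inl_eq_inr: "h \<in> H \<Longrightarrow> amalg_inl A B H \<phi> h = amalg_inr A B H \<phi> (\<phi> h)"
  unfolding amalg_inl_def amalg_inr_def by (intro class_eq amalg_cong.amalg)

theorem universal_property:
  assumes L: "group L" and f: "f \<in> hom A L" and g: "g \<in> hom B L"
    and fg: "\<And>h. h \<in> H \<Longrightarrow> f h = g (\<phi> h)"
  shows "\<exists>\<theta> \<in> hom P L. (\<forall>a \<in> carrier A. \<theta> (amalg_inl A B H \<phi> a) = f a) \<and>
                       (\<forall>b \<in> carrier B. \<theta> (amalg_inr A B H \<phi> b) = g b)" (is ?ex)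
    and "\<lbrakk>\<theta> \<in> hom P L; \<theta>' \<in> hom P L;
          \<And>a. a \<in> carrier A \<Longrightarrow> \<theta> (amalg_inl A B H \<phi> a) = \<theta>' (amalg_inl A B H \<phi> a);
          \<And>b. b \<in> carrier B \<Longrightarrow> \<theta> (amalg_inr A B H \<phi> b) = \<theta>' (amalg_inr A B H \<phi> b);
          U \<in> carrier P\<rbrakk> \<Longrightarrow> \<theta> U = \<theta>' U"
proof -
  interpret L: group L by fact
  interpret f: group_hom A L f using f by unfold_locales
  interpret g: group_hom B L g using g by unfold_locales
  define ev where "ev w = foldr (\<lambda>x y. case_sum f g x \<otimes>\<^bsub>L\<^esub> y) w \<one>\<^bsub>L\<^esub>" for w
  have ev_simps [simp]: "ev [] = \<one>\<^bsub>L\<^esub>" "ev (x # w) = case_sum f g x \<otimes>\<^bsub>L\<^esub> ev w" for x w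
    by (simp_all add: ev_def)
  have ev_closed: "ev w \<in> carrier L" if "w \<in> W" for w
    using that by (induction w) auto
  have ev_append: "ev (v @ w) = ev v \<otimes>\<^bsub>L\<^esub> ev w" if "v \<in> W" "w \<in> W" for v w
    using that(1)
  proof (induction v)
    case (Cons x v)
    with that have "case_sum f g x \<in> carrier L" "ev v \<in> carrier L" "ev w \<in> carrier L"
      using ev_closed by auto
    with Cons show ?case by (simp add: L.m_assoc)
  qed (use ev_closed[OF that(2)] in simp)
  have ev_cong: "ev v = ev w" if "cong v w" for v w
    using that
  proof (induction rule: amalg_cong.induct)
    case (append v v' w w')
    then show ?case using ev_append cong_words by metis
  next
    case (amalg h)
    then show ?case using fg by simp
  qed auto
  define \<theta> where "\<theta> U = ev (SOME u. u \<in> U)" for U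
  have \<theta>: "\<theta> (cls w) = ev w" if "w \<in> W" for w
  proof -
    have "(SOME u. u \<in> cls w) \<in> cls w"
      by (rule someI[of "\<lambda>u. u \<in> cls w" w]) (use that in \<open>simp add: amalg_class_def amalg_cong.refl\<close>)
    then have "cong w (SOME u. u \<in> cls w)" by (simp add: amalg_class_def)
    from ev_cong[OF this] show ?thesis by (simp add: \<theta>_def)
  qed
  have "\<theta> \<in> hom P L"
  proof (rule homI)
    fix U V assume "U \<in> carrier P" "V \<in> carrier P"
    then obtain u v where uv: "u \<in> W" "U = cls u" "v \<in> W" "V = cls v"
      by (auto simp: carrier_P)
    then have "u @ v \<in> W" by (simp del: lists_eq_set)
    then show "\<theta> (U \<otimes>\<^bsub>P\<^esub> V) = \<theta> U \<otimes>\<^bsub>L\<^esub> \<theta> V"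
      unfolding uv(2,4) mult_class[OF uv(1,3)] using \<theta> ev_append uv by simp
  qed (unfold carrier_P, use \<theta> ev_closed in force)
  moreover have "\<theta> (amalg_inl A B H \<phi> a) = f a" if "a \<in> carrier A" for a
    using that \<theta>[of "[Inl a]"] by (simp add: amalg_inl_def InlI)
  moreover have "\<theta> (amalg_inr A B H \<phi> b) = g b" if "b \<in> carrier B" for b
    using that \<theta>[of "[Inr b]"] by (simp add: amalg_inr_def InrI)
  ultimately show ?ex by blast
next
  assume \<theta>: "\<theta> \<in> hom P L" "\<theta>' \<in> hom P L"
    and A: "\<And>a. a \<in> carrier A \<Longrightarrow> \<theta> (amalg_inl A B H \<phi> a) = \<theta>' (amalg_inl A B H \<phi> a)"
    and B: "\<And>b. b \<in> carrier B \<Longrightarrow> \<theta> (amalg_inr A B H \<phi> b) = \<theta>' (amalg_inr A B H \<phi> b)"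
    and U: "U \<in> carrier P"
  have "\<theta> (cls w) = \<theta>' (cls w)" if "w \<in> W" for w
    using that
  proof (induction w)
    case Nil
    show ?case using hom_one[OF \<theta>(1) group_P L] hom_one[OF \<theta>(2) group_P L] by (simp add: one_P)
  next
    case (Cons x w)
    then have x: "[x] \<in> W" by auto
    have "\<theta> (cls [x]) = \<theta>' (cls [x])"
      using x A B by (cases x) (auto simp: amalg_inl_def amalg_inr_def)
    then show ?case
      using Cons x mult_class[of "[x]" w] hom_mult[OF \<theta>(1), of "cls [x]" "cls w"]
        hom_mult[OF \<theta>(2), of "cls [x]" "cls w"] by (simp add: carrier_P del: lists_eq_set)
  qed
  with U show "\<theta> U = \<theta>' U" unfolding carrier_P by force
qed

end

end

theory Submission
  imports Defs "HOL-Algebra.Bij" "HOL-Algebra.Multiplicative_Group"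
begin

text \<open>
  Finite separability is tested on finite permutation representations: if \<open>G\<close> acts on a finite
  set and some point \<open>p\<close> satisfies \<open>g p \<noteq> f p\<close> for all \<open>f \<in> F\<close>, then the permutation induced by
  \<open>g\<close> is not induced by any element of \<open>F\<close>. An action of an amalgamated product is nothing but a
  pair of actions of \<open>A\<close> and \<open>B\<close> on one set that agree on \<open>H\<close>, so finite actions can be built
  directly.

  The construction (\<open>finite_completion\<close>) shows that finite pieces of suitable infinite \<open>G\<close>-sets
  already occur in finite ones. Let \<open>G\<close> act on \<open>Y\<close> so that every point has stabiliser \<open>R\<close> in \<open>A\<close>
  and \<open>S\<close> in \<open>B\<close>, where \<open>(R, S) \<in> \<Omega>\<close>, and let \<open>X\<^sub>0\<close> be a finite part of \<open>Y\<close>. The sets \<open>U = A X\<^sub>0\<close> and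
  \<open>V = B X\<^sub>0\<close> are finite. Let \<open>A\<close> act on \<open>U \<times> V\<close> through the first coordinate and \<open>B\<close> through the
  second. These are two \<open>H\<close>-sets of the same cardinality in which all points have the same
  stabiliser \<open>R \<inter> H\<close>, so they are isomorphic, even by an isomorphism that extends
  \<open>(x, x\<^sub>0) \<mapsto> (x\<^sub>0, x)\<close> on the finite \<open>H\<close>-set generated by \<open>X\<^sub>0\<close>. Moving the action of \<open>B\<close> along
  this isomorphism makes the two actions agree on \<open>H\<close>, and \<open>X\<^sub>0\<close> is embedded together with all
  moves of elements of \<open>A\<close> and \<open>B\<close> between its points.

  The infinite \<open>G\<close>-sets are coset spaces \<open>G / D\<close>. For \<open>(R, S) \<in> \<Omega>\<close> there is a normal subgroup \<open>N\<close>
  of \<open>G\<close>, the kernel of the map onto the amalgam of \<open>A / R\<close> and \<open>B / S\<close>, which meets \<open>A\<close> in \<open>R\<close>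
  and \<open>B\<close> in \<open>S\<close>. It comes from van der Waerden's action on normal forms (\<open>normal_form_action\<close>),
  which also gives a length function on \<open>G\<close> that is constant on the cosets of \<open>N\<close>; an alternating
  product of \<open>n\<close> elements outside \<open>H R\<close> and \<open>K S\<close> has length \<open>n\<close>. To separate \<open>g\<close> from the group
  generated by \<open>c\<close> it suffices to find \<open>(R, S)\<close> such that \<open>g\<close> is not congruent to a power of \<open>c\<close>
  modulo \<open>N\<close> and \<open>c\<close> has finite order modulo \<open>N\<close> (then \<open>D = N\<close>, \<open>elliptic_separation\<close>) or infinite
  order modulo \<open>N\<close> (then \<open>D\<close> is generated by \<open>N\<close> and \<open>c\<close>, \<open>hyperbolic_separation\<close>).

  Up to conjugation, \<open>c\<close> lies in a factor or is a cyclically reduced product of length at least 2.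
  In the first case the cyclic group is separable in the factor by hypothesis, and \<open>(R, S)\<close> can be
  chosen small enough to keep \<open>g\<close> away from it. In the second case \<open>c\<^sup>k\<close> has length \<open>|k|\<close> times the
  length of \<open>c\<close>, so only finitely many powers are short enough to be congruent to \<open>g\<close>; the finitely
  many nontrivial elements \<open>g\<^sup>-\<^sup>1 c\<^sup>k\<close> survive for small \<open>(R, S)\<close>, because \<open>A\<close> and \<open>B\<close> are residually
  finite and \<open>H\<close> and \<open>K\<close> are finitely separable.
\<close>

section \<open>Group actions and finite separability\<close>

text \<open>
  In contrast to homomorphisms into the permutation group, the maps are not required to be
  extensional. This makes restricting, transporting and pairing actions a matter of writing down
  a term.
\<close>

definition acts_on :: "('g, 'm) monoid_scheme \<Rightarrow> 'x set \<Rightarrow> ('g \<Rightarrow> 'x \<Rightarrow> 'x) \<Rightarrow> bool" where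
  "acts_on \<Gamma> X \<sigma> \<longleftrightarrow>
     (\<forall>g \<in> carrier \<Gamma>. \<forall>x \<in> X. \<sigma> g x \<in> X) \<and>
     (\<forall>x \<in> X. \<sigma> \<one>\<^bsub>\<Gamma>\<^esub> x = x) \<and>
     (\<forall>g \<in> carrier \<Gamma>. \<forall>h \<in> carrier \<Gamma>. \<forall>x \<in> X. \<sigma> (g \<otimes>\<^bsub>\<Gamma>\<^esub> h) x = \<sigma> g (\<sigma> h x))"

lemma acts_on_closed: "acts_on \<Gamma> X \<sigma> \<Longrightarrow> g \<in> carrier \<Gamma> \<Longrightarrow> x \<in> X \<Longrightarrow> \<sigma> g x \<in> X"
  and acts_on_one: "acts_on \<Gamma> X \<sigma> \<Longrightarrow> x \<in> X \<Longrightarrow> \<sigma> \<one>\<^bsub>\<Gamma>\<^esub> x = x"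
  and acts_on_mult: "acts_on \<Gamma> X \<sigma> \<Longrightarrow> g \<in> carrier \<Gamma> \<Longrightarrow> h \<in> carrier \<Gamma> \<Longrightarrow> x \<in> X \<Longrightarrow>
    \<sigma> (g \<otimes>\<^bsub>\<Gamma>\<^esub> h) x = \<sigma> g (\<sigma> h x)"
  by (simp_all add: acts_on_def)

lemma acts_on_inv:
  assumes "group \<Gamma>" "acts_on \<Gamma> X \<sigma>" "g \<in> carrier \<Gamma>" "x \<in> X"
  shows "\<sigma> (inv\<^bsub>\<Gamma>\<^esub> g) (\<sigma> g x) = x" "\<sigma> g (\<sigma> (inv\<^bsub>\<Gamma>\<^esub> g) x) = x"
proof -
  interpret group \<Gamma> by fact
  show "\<sigma> (inv\<^bsub>\<Gamma>\<^esub> g) (\<sigma> g x) = x" "\<sigma> g (\<sigma> (inv\<^bsub>\<Gamma>\<^esub> g) x) = x"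
    using assms by (simp_all flip: acts_on_mult add: acts_on_one)
qed

lemma acts_on_eq_iff:
  assumes "group \<Gamma>" "acts_on \<Gamma> X \<sigma>" "g \<in> carrier \<Gamma>" "h \<in> carrier \<Gamma>" "x \<in> X"
  shows "\<sigma> g x = \<sigma> h x \<longleftrightarrow> \<sigma> (inv\<^bsub>\<Gamma>\<^esub> g \<otimes>\<^bsub>\<Gamma>\<^esub> h) x = x"
proof -
  interpret group \<Gamma> by fact
  have "\<sigma> h x \<in> X" using assms acts_on_closed by metis
  with assms show ?thesis
    by (metis acts_on_inv acts_on_mult inv_closed)
qed

lemma acts_on_stabilizer:
  assumes "group \<Gamma>" "acts_on \<Gamma> X \<sigma>" "x \<in> X"
  shows "subgroup {g \<in> carrier \<Gamma>. \<sigma> g x = x} \<Gamma>"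
proof -
  interpret group \<Gamma> by fact
  show ?thesis
  proof (rule subgroupI)
    show "{g \<in> carrier \<Gamma>. \<sigma> g x = x} \<noteq> {}" using assms acts_on_one by fastforce
    show "inv\<^bsub>\<Gamma>\<^esub> g \<in> {g \<in> carrier \<Gamma>. \<sigma> g x = x}" if "g \<in> {g \<in> carrier \<Gamma>. \<sigma> g x = x}" for g
      using that acts_on_inv(1)[OF assms(1,2) _ assms(3), of g] by auto
  qed (use assms acts_on_mult in \<open>fastforce+\<close>)
qed

lemma acts_on_restrict_hom:
  assumes "group \<Gamma>" "acts_on \<Gamma> X \<sigma>"
  shows "(\<lambda>g. restrict (\<sigma> g) X) \<in> hom \<Gamma> (BijGroup X)"
proof -
  interpret group \<Gamma> by fact
  have bij: "restrict (\<sigma> g) X \<in> Bij X" if "g \<in> carrier \<Gamma>" for g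
  proof -
    have "bij_betw (\<sigma> g) X X"
      by (rule bij_betw_byWitness[of _ "\<sigma> (inv\<^bsub>\<Gamma>\<^esub> g)"])
        (use acts_on_inv[OF assms that] acts_on_closed[OF assms(2)] that in \<open>auto\<close>)
    then show ?thesis by (simp add: Bij_def cong: bij_betw_cong)
  qed
  show ?thesis
    by (rule homI) (auto simp: BijGroup_def bij compose_def acts_on_mult[OF assms(2)]
        acts_on_closed[OF assms(2)] intro!: ext)
qed

lemma hom_BijGroup_acts_on:
  assumes "group \<Gamma>" "\<psi> \<in> hom \<Gamma> (BijGroup X)"
  shows "acts_on \<Gamma> X \<psi>"
proof -
  have B: "\<psi> g \<in> Bij X" if "g \<in> carrier \<Gamma>" for g
    using that assms(2) by (auto simp: hom_def BijGroup_def)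
  have "\<psi> \<one>\<^bsub>\<Gamma>\<^esub> = (\<lambda>x\<in>X. x)"
    using hom_one[OF assms(2,1) group_BijGroup] by (simp add: BijGroup_def)
  moreover have "\<psi> (g \<otimes>\<^bsub>\<Gamma>\<^esub> h) = compose X (\<psi> g) (\<psi> h)"
    if "g \<in> carrier \<Gamma>" "h \<in> carrier \<Gamma>" for g h
    using hom_mult[OF assms(2) that] B that by (simp add: BijGroup_def)
  moreover have "\<psi> g x \<in> X" if "g \<in> carrier \<Gamma>" "x \<in> X" for g x
    using Bij_imp_funcset[OF B[OF that(1)]] that(2) by auto
  ultimately show ?thesis
    by (simp add: acts_on_def compose_def)
qed

text \<open>
  The universal property, read for homomorphisms into a permutation group.
\<close>

lemma (in amalgamation) acts_on_amalg:
  assumes \<alpha>: "acts_on A X \<alpha>" and \<beta>: "acts_on B X \<beta>"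
    and agree: "\<And>h x. h \<in> H \<Longrightarrow> x \<in> X \<Longrightarrow> \<alpha> h x = \<beta> (\<phi> h) x"
  shows "\<exists>\<psi>. acts_on P X \<psi> \<and>
      (\<forall>a \<in> carrier A. \<forall>x \<in> X. \<psi> (amalg_inl A B H \<phi> a) x = \<alpha> a x) \<and>
      (\<forall>b \<in> carrier B. \<forall>x \<in> X. \<psi> (amalg_inr A B H \<phi> b) x = \<beta> b x)"
proof -
  have "restrict (\<alpha> h) X = restrict (\<beta> (\<phi> h)) X" if "h \<in> H" for h
    using agree[OF that] by (auto intro: restrict_ext)
  then obtain \<psi> where "\<psi> \<in> hom P (BijGroup X)"
    "\<forall>a \<in> carrier A. \<psi> (amalg_inl A B H \<phi> a) = restrict (\<alpha> a) X"
    "\<forall>b \<in> carrier B. \<psi> (amalg_inr A B H \<phi> b) = restrict (\<beta> b) X"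
    using universal_property(1)[OF group_BijGroup acts_on_restrict_hom[OF A.group_axioms \<alpha>]
        acts_on_restrict_hom[OF B.group_axioms \<beta>]] by blast
  with hom_BijGroup_acts_on[OF group_P] show ?thesis by (metis restrict_apply')
qed

text \<open>
  The image of \<open>\<Gamma>\<close> in the permutation group of \<open>X\<close> is the finite quotient that separates \<open>g\<close>
  from \<open>F\<close>: two elements with the same image move \<open>x\<close> to the same point.
\<close>

lemma finitely_separable_by_actions:
  fixes \<Gamma> :: "('g, 'm) monoid_scheme"
  assumes \<Gamma>: "group \<Gamma>" and F: "subgroup F \<Gamma>"
    and sep: "\<And>g. g \<in> carrier \<Gamma> - F \<Longrightarrow>
      \<exists>(X :: 'x set) \<sigma>. \<exists>x \<in> X. finite X \<and> acts_on \<Gamma> X \<sigma> \<and> (\<forall>f \<in> F. \<sigma> g x \<noteq> \<sigma> f x)"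
  shows "finitely_separable \<Gamma> F"
proof -
  interpret group \<Gamma> by fact
  have "\<exists>(Q :: ('x \<Rightarrow> 'x) monoid) \<psi>.
      group Q \<and> finite (carrier Q) \<and> \<psi> \<in> epi \<Gamma> Q \<and> \<psi> g \<notin> \<psi> ` F" if "g \<in> carrier \<Gamma> - F" for g
  proof -
    from sep[OF that] obtain X :: "'x set" and \<sigma> x
      where X: "finite X" "x \<in> X" and \<sigma>: "acts_on \<Gamma> X \<sigma>"
        and ne: "\<forall>f \<in> F. \<sigma> g x \<noteq> \<sigma> f x" by blast
    define \<psi> where "\<psi> = (\<lambda>g. restrict (\<sigma> g) X)"
    define Q where "Q = (BijGroup X)\<lparr>carrier := \<psi> ` carrier \<Gamma>\<rparr>"
    have \<psi>: "\<psi> \<in> hom \<Gamma> (BijGroup X)"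
      unfolding \<psi>_def by (rule acts_on_restrict_hom[OF \<Gamma> \<sigma>])
    then interpret \<psi>: group_hom \<Gamma> "BijGroup X" \<psi>
      by (intro group_hom.intro group_hom_axioms.intro \<Gamma> group_BijGroup)
    have "group Q"
      unfolding Q_def by (rule group.subgroup_imp_group[OF group_BijGroup \<psi>.img_is_subgroup])
    moreover have "finite (carrier Q)"
    proof (rule finite_subset)
      show "carrier Q \<subseteq> X \<rightarrow>\<^sub>E X"
        using acts_on_closed[OF \<sigma>] by (auto simp: Q_def \<psi>_def)
    qed (intro finite_PiE X)
    moreover have "\<psi> \<in> epi \<Gamma> Q"
      using \<psi> by (auto simp: epi_def hom_def Q_def)
    moreover have "\<psi> g \<notin> \<psi> ` F"
    proof
      assume "\<psi> g \<in> \<psi> ` F"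
      then obtain f where "f \<in> F" "\<psi> g = \<psi> f" by auto
      then have "\<sigma> g x = \<sigma> f x" using X by (metis \<psi>_def restrict_apply')
      with ne \<open>f \<in> F\<close> show False by blast
    qed
    ultimately show ?thesis by blast
  qed
  then obtain Q :: "'g \<Rightarrow> ('x \<Rightarrow> 'x) monoid" and \<psi> where
    "\<And>g. g \<in> carrier \<Gamma> - F \<Longrightarrow>
      group (Q g) \<and> finite (carrier (Q g)) \<and> \<psi> g \<in> epi \<Gamma> (Q g) \<and> \<psi> g g \<notin> \<psi> g ` F"
    by metis
  then show ?thesis by (rule finitely_separableI[OF F])
qed

text \<open>
  If all stabilisers equal \<open>T\<close>, every orbit is a copy of the same transitive \<open>\<Gamma>\<close>-set \<open>\<Gamma> / T\<close>. As
  long as \<open>X\<^sub>1\<close> is not all of \<open>X\<close>, the equality of cardinalities leaves an orbit to spare on both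
  sides, and mapping one to the other enlarges the domain. The induction is on the number of points
  that are still missing.
\<close>

lemma equivariant_extension:
  assumes \<Gamma>: "group \<Gamma>" and \<sigma>: "acts_on \<Gamma> X \<sigma>" and \<tau>: "acts_on \<Gamma> Y \<tau>"
    and fin: "finite X" "finite Y" "card X = card Y"
    and \<sigma>T: "\<And>g x. g \<in> carrier \<Gamma> \<Longrightarrow> x \<in> X \<Longrightarrow> \<sigma> g x = x \<longleftrightarrow> g \<in> T"
    and \<tau>T: "\<And>g y. g \<in> carrier \<Gamma> \<Longrightarrow> y \<in> Y \<Longrightarrow> \<tau> g y = y \<longleftrightarrow> g \<in> T"
    and X\<^sub>1: "X\<^sub>1 \<subseteq> X" "\<And>g x. g \<in> carrier \<Gamma> \<Longrightarrow> x \<in> X\<^sub>1 \<Longrightarrow> \<sigma> g x \<in> X\<^sub>1"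
    and \<theta>\<^sub>1: "\<theta>\<^sub>1 ` X\<^sub>1 \<subseteq> Y" "inj_on \<theta>\<^sub>1 X\<^sub>1"
      "\<And>g x. g \<in> carrier \<Gamma> \<Longrightarrow> x \<in> X\<^sub>1 \<Longrightarrow> \<theta>\<^sub>1 (\<sigma> g x) = \<tau> g (\<theta>\<^sub>1 x)"
  shows "\<exists>\<theta>. bij_betw \<theta> X Y \<and> (\<forall>x \<in> X\<^sub>1. \<theta> x = \<theta>\<^sub>1 x) \<and>
    (\<forall>g \<in> carrier \<Gamma>. \<forall>x \<in> X. \<theta> (\<sigma> g x) = \<tau> g (\<theta> x))"
  using X\<^sub>1 \<theta>\<^sub>1
proof (induction "card (X - X\<^sub>1)" arbitrary: X\<^sub>1 \<theta>\<^sub>1 rule: less_induct)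
  case less
  interpret group \<Gamma> by fact
  show ?case
  proof (cases "X\<^sub>1 = X")
    case True
    have "\<theta>\<^sub>1 ` X = Y"
      using less.prems(3,4) True fin by (intro card_subset_eq) (simp_all add: card_image)
    with less.prems True show ?thesis
      by (intro exI[of _ \<theta>\<^sub>1]) (auto simp: bij_betw_def)
  next
    case False
    with less.prems(1) obtain x where x: "x \<in> X" "x \<notin> X\<^sub>1" by blast
    have "card (\<theta>\<^sub>1 ` X\<^sub>1) < card Y"
      using psubset_card_mono[of X X\<^sub>1] less.prems(1,4) False fin by (simp add: card_image psubset_eq)
    then obtain y where y: "y \<in> Y" "y \<notin> \<theta>\<^sub>1 ` X\<^sub>1"
      using less.prems(3) by (metis less_irrefl subsetI subset_antisym)
    \<comment> \<open>Extend by the orbit of \<open>x\<close>; equality of stabilisers makes \<open>\<sigma> g x \<mapsto> \<tau> g y\<close> well defined and injective.\<close>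
    define O\<^sub>x where "O\<^sub>x = (\<lambda>g. \<sigma> g x) ` carrier \<Gamma>"
    define \<theta>\<^sub>2 where "\<theta>\<^sub>2 z = (if z \<in> X\<^sub>1 then \<theta>\<^sub>1 z
       else \<tau> (SOME g. g \<in> carrier \<Gamma> \<and> z = \<sigma> g x) y)" for z
    have disj: "\<sigma> g x \<notin> X\<^sub>1" if "g \<in> carrier \<Gamma>" for g
      using less.prems(2)[of "inv\<^bsub>\<Gamma>\<^esub> g" "\<sigma> g x"] acts_on_inv(1)[OF \<Gamma> \<sigma> that] x that by auto
    have same: "\<sigma> g x = \<sigma> h x \<longleftrightarrow> \<tau> g y = \<tau> h y" if "g \<in> carrier \<Gamma>" "h \<in> carrier \<Gamma>" for g h
      using acts_on_eq_iff[OF \<Gamma> \<sigma> that x(1)] acts_on_eq_iff[OF \<Gamma> \<tau> that y(1)]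
        \<sigma>T[OF _ x(1)] \<tau>T[OF _ y(1)] that by simp
    have \<theta>\<^sub>2_old: "\<theta>\<^sub>2 z = \<theta>\<^sub>1 z" if "z \<in> X\<^sub>1" for z
      using that by (simp add: \<theta>\<^sub>2_def)
    have \<theta>\<^sub>2_new: "\<theta>\<^sub>2 (\<sigma> g x) = \<tau> g y" if g: "g \<in> carrier \<Gamma>" for g
    proof -
      have "(SOME k. k \<in> carrier \<Gamma> \<and> \<sigma> g x = \<sigma> k x) \<in> carrier \<Gamma> \<and>
          \<sigma> g x = \<sigma> (SOME k. k \<in> carrier \<Gamma> \<and> \<sigma> g x = \<sigma> k x) x"
        by (rule someI[of "\<lambda>k. k \<in> carrier \<Gamma> \<and> \<sigma> g x = \<sigma> k x" g]) (use g in simp)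
      then have "\<tau> (SOME k. k \<in> carrier \<Gamma> \<and> \<sigma> g x = \<sigma> k x) y = \<tau> g y"
        using same g by metis
      then show ?thesis using disj[OF g] by (simp add: \<theta>\<^sub>2_def)
    qed
    have O\<^sub>x: "O\<^sub>x \<subseteq> X" "x \<in> O\<^sub>x"
      using acts_on_closed[OF \<sigma> _ x(1)] acts_on_one[OF \<sigma> x(1)] by (force simp: O\<^sub>x_def)+
    have new_image: "\<tau> g y \<notin> \<theta>\<^sub>1 ` X\<^sub>1" if g: "g \<in> carrier \<Gamma>" for g
    proof
      assume "\<tau> g y \<in> \<theta>\<^sub>1 ` X\<^sub>1"
      then obtain z where z: "z \<in> X\<^sub>1" "\<tau> g y = \<theta>\<^sub>1 z" by auto
      then have "y = \<theta>\<^sub>1 (\<sigma> (inv\<^bsub>\<Gamma>\<^esub> g) z)"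
        using less.prems(5)[of "inv\<^bsub>\<Gamma>\<^esub> g" z] acts_on_inv(1)[OF \<Gamma> \<tau> g y(1)] g by simp
      then show False using y(2) less.prems(2) z g by auto
    qed
    have c1: "card (X - (X\<^sub>1 \<union> O\<^sub>x)) < card (X - X\<^sub>1)"
      using x O\<^sub>x fin by (intro psubset_card_mono) auto
    have c2: "X\<^sub>1 \<union> O\<^sub>x \<subseteq> X" using O\<^sub>x less.prems(1) by blast
    have c3: "\<sigma> g z \<in> X\<^sub>1 \<union> O\<^sub>x" if "g \<in> carrier \<Gamma>" "z \<in> X\<^sub>1 \<union> O\<^sub>x" for g z
      using that less.prems(2) acts_on_mult[OF \<sigma> that(1) _ x(1)]
      by (force simp: O\<^sub>x_def simp flip: acts_on_mult[OF \<sigma> that(1) _ x(1)])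
    have c4: "\<theta>\<^sub>2 ` (X\<^sub>1 \<union> O\<^sub>x) \<subseteq> Y"
      using less.prems(3) \<theta>\<^sub>2_old \<theta>\<^sub>2_new acts_on_closed[OF \<tau> _ y(1)] by (auto simp: O\<^sub>x_def)
    have c5: "inj_on \<theta>\<^sub>2 (X\<^sub>1 \<union> O\<^sub>x)"
    proof -
      have "inj_on \<theta>\<^sub>2 X\<^sub>1" using less.prems(4) \<theta>\<^sub>2_old by (simp cong: inj_on_cong)
      moreover have "inj_on \<theta>\<^sub>2 O\<^sub>x"
        by (auto simp: O\<^sub>x_def inj_on_def \<theta>\<^sub>2_new same)
      moreover have "\<theta>\<^sub>2 ` X\<^sub>1 \<inter> \<theta>\<^sub>2 ` O\<^sub>x = {}"
      proof (rule equals0I)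
        fix z assume "z \<in> \<theta>\<^sub>2 ` X\<^sub>1 \<inter> \<theta>\<^sub>2 ` O\<^sub>x"
        then obtain u g where "u \<in> X\<^sub>1" "z = \<theta>\<^sub>2 u" "g \<in> carrier \<Gamma>" "z = \<theta>\<^sub>2 (\<sigma> g x)"
          unfolding O\<^sub>x_def by blast
        then have "\<tau> g y = \<theta>\<^sub>1 u" by (simp only: \<theta>\<^sub>2_old \<theta>\<^sub>2_new)
        then show False
          using new_image[OF \<open>g \<in> carrier \<Gamma>\<close>] imageI[OF \<open>u \<in> X\<^sub>1\<close>, of \<theta>\<^sub>1] by simp
      qed
      ultimately show ?thesis unfolding inj_on_Un by blast
    qed
    have c6: "\<theta>\<^sub>2 (\<sigma> g z) = \<tau> g (\<theta>\<^sub>2 z)" if "g \<in> carrier \<Gamma>" "z \<in> X\<^sub>1 \<union> O\<^sub>x" for g z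
      using that(2)
    proof
      assume "z \<in> X\<^sub>1"
      then show ?thesis using less.prems(2,5) that(1) \<theta>\<^sub>2_old by simp
    next
      assume "z \<in> O\<^sub>x"
      then obtain k where k: "k \<in> carrier \<Gamma>" "z = \<sigma> k x" by (auto simp: O\<^sub>x_def)
      then show ?thesis
        using \<theta>\<^sub>2_new[of "g \<otimes>\<^bsub>\<Gamma>\<^esub> k"] \<theta>\<^sub>2_new[of k] that(1)
          acts_on_mult[OF \<sigma> that(1) k(1) x(1)] acts_on_mult[OF \<tau> that(1) k(1) y(1)] by simp
    qed
    from less.hyps[OF c1 c2 c3 c4 c5 c6] obtain \<theta> where "bij_betw \<theta> X Y"
      "\<forall>z \<in> X\<^sub>1 \<union> O\<^sub>x. \<theta> z = \<theta>\<^sub>2 z"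
      "\<forall>g \<in> carrier \<Gamma>. \<forall>x \<in> X. \<theta> (\<sigma> g x) = \<tau> g (\<theta> x)" by blast
    then show ?thesis using \<theta>\<^sub>2_old by (intro exI[of _ \<theta>]) auto
  qed
qed

section \<open>Finite pieces of actions of an amalgamated product\<close>

locale amalgamated_product = amalgamation A B H \<phi>
  for A :: "('a, 'm) monoid_scheme" and B :: "('b, 'n) monoid_scheme"
    and H :: "'a set" and \<phi> :: "'a \<Rightarrow> 'b" +
  fixes K :: "'b set"
  assumes H: "subgroup H A" and K: "subgroup K B"
    and \<phi>: "\<phi> \<in> iso (A\<lparr>carrier := H\<rparr>) (B\<lparr>carrier := K\<rparr>)"
begin

abbreviation "inl \<equiv> amalg_inl A B H \<phi>"
abbreviation "inr \<equiv> amalg_inr A B H \<phi>"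

sublocale P: group P by (rule group_P)
sublocale inl: group_hom A P inl
  by (intro group_hom.intro group_hom_axioms.intro A.group_axioms group_P inl_hom)
sublocale inr: group_hom B P inr
  by (intro group_hom.intro group_hom_axioms.intro B.group_axioms group_P inr_hom)

lemma phi_H [simp]: "h \<in> H \<Longrightarrow> \<phi> h \<in> K"
  and phi_mult: "h \<in> H \<Longrightarrow> k \<in> H \<Longrightarrow> \<phi> (h \<otimes>\<^bsub>A\<^esub> k) = \<phi> h \<otimes>\<^bsub>B\<^esub> \<phi> k"
  and phi_image: "\<phi> ` H = K"
  and phi_inj: "inj_on \<phi> H"
  using \<phi> by (auto simp: iso_def hom_def bij_betw_def)

lemma H_mem [simp]: "h \<in> H \<Longrightarrow> h \<in> carrier A" and K_mem [simp]: "k \<in> K \<Longrightarrow> k \<in> carrier B"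
  using subgroup.subset[OF H] subgroup.subset[OF K] by auto

lemma phi_one: "\<phi> \<one>\<^bsub>A\<^esub> = \<one>\<^bsub>B\<^esub>"
proof -
  have 1: "\<one>\<^bsub>A\<^esub> \<in> H" by (rule subgroup.one_closed[OF H])
  then have "\<phi> \<one>\<^bsub>A\<^esub> \<otimes>\<^bsub>B\<^esub> \<phi> \<one>\<^bsub>A\<^esub> = \<phi> \<one>\<^bsub>A\<^esub>"
    using phi_mult[OF 1 1] by simp
  with 1 show ?thesis using B.r_cancel_one[of "\<phi> \<one>\<^bsub>A\<^esub>" "\<phi> \<one>\<^bsub>A\<^esub>"] by simp
qed

lemma phi_inv: "h \<in> H \<Longrightarrow> \<phi> (inv\<^bsub>A\<^esub> h) = inv\<^bsub>B\<^esub> (\<phi> h)"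
  using phi_mult[of "inv\<^bsub>A\<^esub> h" h] subgroup.m_inv_closed[OF H, of h]
  by (intro B.inv_equality[symmetric]) (simp_all add: phi_one)

lemma compatible_iff:
  assumes "compatible H K \<phi> R S" and h: "h \<in> H"
  shows "h \<in> R \<longleftrightarrow> \<phi> h \<in> S"
proof
  assume "h \<in> R"
  with assms show "\<phi> h \<in> S" by (auto simp: compatible_def)
next
  assume "\<phi> h \<in> S"
  with h have "\<phi> h \<in> \<phi> ` (R \<inter> H)" using assms(1) by (simp add: compatible_def)
  then show "h \<in> R" using phi_inj h by (auto dest: inj_onD)
qed

lemma H_group: "group (A\<lparr>carrier := H\<rparr>)"
  by (rule A.subgroup_imp_group[OF H])

end

lemma finite_orbit:
  assumes \<Gamma>: "group \<Gamma>" and \<sigma>: "acts_on \<Gamma> X \<sigma>" and x: "x \<in> X"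
    and R: "normal_finite_index R \<Gamma>" and fixed: "\<And>r. r \<in> R \<Longrightarrow> \<sigma> r x = x"
  shows "finite ((\<lambda>g. \<sigma> g x) ` carrier \<Gamma>)"
proof -
  interpret normal R \<Gamma> using R by (simp add: normal_finite_index_def)
  have const: "\<sigma> k x = \<sigma> g x" if g: "g \<in> carrier \<Gamma>" and k: "k \<in> R #>\<^bsub>\<Gamma>\<^esub> g" for g k
  proof -
    obtain r where r: "r \<in> R" "k = g \<otimes>\<^bsub>\<Gamma>\<^esub> r"
      using k g coset_eq by (auto simp: l_coset_def)
    then show ?thesis using acts_on_mult[OF \<sigma> g _ x, of r] fixed by simp
  qed
  have "(\<lambda>g. \<sigma> g x) ` carrier \<Gamma> \<subseteq> (\<lambda>C. \<sigma> (SOME k. k \<in> C) x) ` (rcosets\<^bsub>\<Gamma>\<^esub> R)"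
  proof
    fix y assume "y \<in> (\<lambda>g. \<sigma> g x) ` carrier \<Gamma>"
    then obtain g where g: "g \<in> carrier \<Gamma>" "y = \<sigma> g x" by auto
    have "(SOME k. k \<in> R #>\<^bsub>\<Gamma>\<^esub> g) \<in> R #>\<^bsub>\<Gamma>\<^esub> g"
      by (rule someI[of "\<lambda>k. k \<in> R #>\<^bsub>\<Gamma>\<^esub> g", OF rcos_self[OF g(1) is_subgroup]])
    from const[OF g(1) this] g have "y = \<sigma> (SOME k. k \<in> R #>\<^bsub>\<Gamma>\<^esub> g) x" by simp
    moreover have "R #>\<^bsub>\<Gamma>\<^esub> g \<in> rcosets\<^bsub>\<Gamma>\<^esub> R" using rcosetsI[OF subset g(1)] .
    ultimately show "y \<in> (\<lambda>C. \<sigma> (SOME k. k \<in> C) x) ` (rcosets\<^bsub>\<Gamma>\<^esub> R)" by (rule image_eqI)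
  qed
  moreover have "finite (rcosets\<^bsub>\<Gamma>\<^esub> R)" using R by (simp add: normal_finite_index_def)
  ultimately show ?thesis by (rule finite_surj[rotated])
qed

context amalgamated_product
begin

text \<open>
  The finite set is \<open>U \<times> V\<close> for \<open>U = A X\<^sub>0\<close> and \<open>V = B X\<^sub>0\<close>. Taking the product gives the \<open>A\<close>-set and
  the \<open>B\<close>-set the same cardinality at no cost, which is what the gluing of the two \<open>H\<close>-sets needs.
\<close>

lemma finite_completion:
  fixes Y :: "'y set"
  assumes RS: "(R, S) \<in> Omega A B H K \<phi>"
    and \<gamma>: "acts_on P Y \<gamma>"
    and stab_A: "\<And>a y. a \<in> carrier A \<Longrightarrow> y \<in> Y \<Longrightarrow> \<gamma> (inl a) y = y \<longleftrightarrow> a \<in> R"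
    and stab_B: "\<And>b y. b \<in> carrier B \<Longrightarrow> y \<in> Y \<Longrightarrow> \<gamma> (inr b) y = y \<longleftrightarrow> b \<in> S"
    and X\<^sub>0: "finite X\<^sub>0" "X\<^sub>0 \<subseteq> Y" "X\<^sub>0 \<noteq> {}"
  shows "\<exists>(X :: ('y \<times> 'y) set) \<psi> \<iota>. finite X \<and> acts_on P X \<psi> \<and> inj_on \<iota> X\<^sub>0 \<and> \<iota> ` X\<^sub>0 \<subseteq> X \<and>
    (\<forall>a \<in> carrier A. \<forall>x \<in> X\<^sub>0. \<gamma> (inl a) x \<in> X\<^sub>0 \<longrightarrow> \<psi> (inl a) (\<iota> x) = \<iota> (\<gamma> (inl a) x)) \<and>
    (\<forall>b \<in> carrier B. \<forall>x \<in> X\<^sub>0. \<gamma> (inr b) x \<in> X\<^sub>0 \<longrightarrow> \<psi> (inr b) (\<iota> x) = \<iota> (\<gamma> (inr b) x))"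
proof -
  have R: "normal_finite_index R A" and S: "normal_finite_index S B"
    and comp: "compatible H K \<phi> R S"
    using RS by (auto simp: Omega_def)
  define \<alpha> where "\<alpha> a = \<gamma> (inl a)" for a
  define \<beta> where "\<beta> b = \<gamma> (inr b)" for b
  have \<alpha>: "acts_on A Y \<alpha>" and \<beta>: "acts_on B Y \<beta>"
    using \<gamma> by (auto simp: acts_on_def \<alpha>_def \<beta>_def)
  have agree: "\<alpha> h y = \<beta> (\<phi> h) y" if "h \<in> H" for h y
    using inl_eq_inr[OF that] by (simp add: \<alpha>_def \<beta>_def)
  have Rsub: "R \<subseteq> carrier A" and Ssub: "S \<subseteq> carrier B"
    using R S by (auto simp: normal_finite_index_def dest!: normal_imp_subgroup subgroup.subset)
  define U where "U = (\<Union>x\<in>X\<^sub>0. (\<lambda>a. \<alpha> a x) ` carrier A)"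
  define V where "V = (\<Union>x\<in>X\<^sub>0. (\<lambda>b. \<beta> b x) ` carrier B)"
  define X\<^sub>1 where "X\<^sub>1 = (\<Union>x\<in>X\<^sub>0. (\<lambda>h. \<alpha> h x) ` H)"
  have UY: "U \<subseteq> Y" and VY: "V \<subseteq> Y"
    using acts_on_closed[OF \<alpha>] acts_on_closed[OF \<beta>] X\<^sub>0(2) by (auto simp: U_def V_def)
  have "finite ((\<lambda>a. \<alpha> a x) ` carrier A)" "finite ((\<lambda>b. \<beta> b x) ` carrier B)" if "x \<in> X\<^sub>0" for x
  proof -
    from that X\<^sub>0(2) have x: "x \<in> Y" by blast
    show "finite ((\<lambda>a. \<alpha> a x) ` carrier A)"
      by (rule finite_orbit[OF A.group_axioms \<alpha> x R]) (use stab_A x Rsub in \<open>auto simp: \<alpha>_def\<close>)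
    show "finite ((\<lambda>b. \<beta> b x) ` carrier B)"
      by (rule finite_orbit[OF B.group_axioms \<beta> x S]) (use stab_B x Ssub in \<open>auto simp: \<beta>_def\<close>)
  qed
  then have "finite U" "finite V" using X\<^sub>0(1) by (simp_all add: U_def V_def)
  have \<alpha>U: "acts_on A U \<alpha>"
  proof -
    have "\<alpha> a u \<in> U" if a: "a \<in> carrier A" and "u \<in> U" for a u
    proof -
      obtain x k where "x \<in> X\<^sub>0" "k \<in> carrier A" "u = \<alpha> k x" using \<open>u \<in> U\<close> by (auto simp: U_def)
      then have "\<alpha> a u = \<alpha> (a \<otimes>\<^bsub>A\<^esub> k) x" "a \<otimes>\<^bsub>A\<^esub> k \<in> carrier A"
        using acts_on_mult[OF \<alpha> a] a X\<^sub>0(2) by auto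
      with \<open>x \<in> X\<^sub>0\<close> show ?thesis by (auto simp: U_def)
    qed
    with \<alpha> UY show ?thesis by (auto simp: acts_on_def subset_iff)
  qed
  have \<beta>V: "acts_on B V \<beta>"
  proof -
    have "\<beta> b u \<in> V" if b: "b \<in> carrier B" and "u \<in> V" for b u
    proof -
      obtain x k where "x \<in> X\<^sub>0" "k \<in> carrier B" "u = \<beta> k x" using \<open>u \<in> V\<close> by (auto simp: V_def)
      then have "\<beta> b u = \<beta> (b \<otimes>\<^bsub>B\<^esub> k) x" "b \<otimes>\<^bsub>B\<^esub> k \<in> carrier B"
        using acts_on_mult[OF \<beta> b] b X\<^sub>0(2) by auto
      with \<open>x \<in> X\<^sub>0\<close> show ?thesis by (auto simp: V_def)
    qed
    with \<beta> VY show ?thesis by (auto simp: acts_on_def subset_iff)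
  qed
  have X01: "X\<^sub>0 \<subseteq> X\<^sub>1" and X1U: "X\<^sub>1 \<subseteq> U" and X1V: "X\<^sub>1 \<subseteq> V"
  proof -
    show "X\<^sub>0 \<subseteq> X\<^sub>1"
      using X\<^sub>0(2) acts_on_one[OF \<alpha>] subgroup.one_closed[OF H] by (force simp: X\<^sub>1_def)
    show "X\<^sub>1 \<subseteq> U" by (auto simp: X\<^sub>1_def U_def)
    show "X\<^sub>1 \<subseteq> V" using agree by (force simp: X\<^sub>1_def V_def)
  qed
  obtain x\<^sub>0 where "x\<^sub>0 \<in> X\<^sub>0" using X\<^sub>0(3) by blast
  then have x\<^sub>0: "x\<^sub>0 \<in> U" "x\<^sub>0 \<in> V" using X01 X1U X1V by auto
  define X where "X = U \<times> V"
  \<comment> \<open>The actions of \<open>A\<close> and \<open>B\<close> on \<open>U \<times> V\<close>, which do not yet agree on \<open>H\<close>.\<close>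
  define \<sigma> where "\<sigma> a = (\<lambda>(u :: 'y, v :: 'y). (\<alpha> a u, v))" for a
  define \<tau> where "\<tau> b = (\<lambda>(u :: 'y, v :: 'y). (u, \<beta> b v))" for b
  have \<sigma>: "acts_on A X \<sigma>" and \<tau>: "acts_on B X \<tau>"
    using \<alpha>U \<beta>V by (auto simp: acts_on_def X_def \<sigma>_def \<tau>_def)
  have \<sigma>H: "acts_on (A\<lparr>carrier := H\<rparr>) X \<sigma>" and \<tau>H: "acts_on (A\<lparr>carrier := H\<rparr>) X (\<lambda>h. \<tau> (\<phi> h))"
    using \<sigma> \<tau> by (auto simp: acts_on_def phi_mult phi_one)
  have X1_H: "\<alpha> h x \<in> X\<^sub>1" if h: "h \<in> H" and x: "x \<in> X\<^sub>1" for h x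
  proof -
    obtain y k where "y \<in> X\<^sub>0" "k \<in> H" "x = \<alpha> k y" using x by (auto simp: X\<^sub>1_def)
    then have "\<alpha> h x = \<alpha> (h \<otimes>\<^bsub>A\<^esub> k) y" "h \<otimes>\<^bsub>A\<^esub> k \<in> H"
      using acts_on_mult[OF \<alpha>, of h k y] h X\<^sub>0(2) subgroup.m_closed[OF H] by auto
    with \<open>y \<in> X\<^sub>0\<close> show ?thesis by (auto simp: X\<^sub>1_def)
  qed
  have "\<exists>\<theta>. bij_betw \<theta> X X \<and> (\<forall>p \<in> X\<^sub>1 \<times> {x\<^sub>0}. \<theta> p = (x\<^sub>0, fst p)) \<and>
    (\<forall>h \<in> carrier (A\<lparr>carrier := H\<rparr>). \<forall>x \<in> X. \<theta> (\<sigma> h x) = \<tau> (\<phi> h) (\<theta> x))"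
  proof (rule equivariant_extension[OF H_group \<sigma>H \<tau>H _ _ _, where T = R])
    show "finite X" "finite X" using \<open>finite U\<close> \<open>finite V\<close> by (simp_all add: X_def)
    show "\<sigma> h p = p \<longleftrightarrow> h \<in> R" if "h \<in> carrier (A\<lparr>carrier := H\<rparr>)" "p \<in> X" for h p
      using that UY stab_A[of h "fst p"] by (auto simp: \<sigma>_def X_def \<alpha>_def)
    show "\<tau> (\<phi> h) p = p \<longleftrightarrow> h \<in> R" if "h \<in> carrier (A\<lparr>carrier := H\<rparr>)" "p \<in> X" for h p
      using that VY stab_B[of "\<phi> h" "snd p"] compatible_iff[OF comp, of h]
      by (auto simp: \<tau>_def X_def \<beta>_def)
    show "X\<^sub>1 \<times> {x\<^sub>0} \<subseteq> X" using X1U x\<^sub>0 by (auto simp: X_def)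
    show "(\<lambda>p. (x\<^sub>0, fst p)) ` (X\<^sub>1 \<times> {x\<^sub>0}) \<subseteq> X" using X1V x\<^sub>0 by (auto simp: X_def)
    show "inj_on (\<lambda>p. (x\<^sub>0, fst p)) (X\<^sub>1 \<times> {x\<^sub>0})" by (auto simp: inj_on_def)
  qed (use X1_H agree in \<open>auto simp: \<sigma>_def \<tau>_def\<close>)
  then obtain \<theta> where \<theta>: "bij_betw \<theta> X X" and \<theta>X1: "\<And>x. x \<in> X\<^sub>1 \<Longrightarrow> \<theta> (x, x\<^sub>0) = (x\<^sub>0, x)"
    and \<theta>H: "\<And>h p. h \<in> H \<Longrightarrow> p \<in> X \<Longrightarrow> \<theta> (\<sigma> h p) = \<tau> (\<phi> h) (\<theta> p)" by auto
  define \<theta>' where "\<theta>' = inv_into X \<theta>"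
  have \<theta>': "\<theta>' (\<theta> p) = p" "\<theta> (\<theta>' p) = p" "\<theta> p \<in> X" "\<theta>' p \<in> X" if "p \<in> X" for p
    using \<theta> that by (auto simp: \<theta>'_def bij_betw_def f_inv_into_f inv_into_into)
  have \<tau>': "acts_on B X (\<lambda>b p. \<theta>' (\<tau> b (\<theta> p)))"
    using \<tau> by (auto simp: acts_on_def \<theta>')
  have "\<sigma> h p = \<theta>' (\<tau> (\<phi> h) (\<theta> p))" if "h \<in> H" "p \<in> X" for h p
    using that \<theta>H[symmetric] \<theta>' acts_on_closed[OF \<sigma>, of h p] by simp
  from acts_on_amalg[OF \<sigma> \<tau>' this] obtain \<psi> where \<psi>: "acts_on P X \<psi>"
    and \<psi>A: "\<forall>a \<in> carrier A. \<forall>p \<in> X. \<psi> (inl a) p = \<sigma> a p"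
    and \<psi>B: "\<forall>b \<in> carrier B. \<forall>p \<in> X. \<psi> (inr b) p = \<theta>' (\<tau> b (\<theta> p))" by blast
  have \<iota>X: "(x, x\<^sub>0) \<in> X" if "x \<in> X\<^sub>0" for x
    using that X01 X1U x\<^sub>0 by (auto simp: X_def)
  show ?thesis
  proof (intro exI[of _ X] exI[of _ \<psi>] exI[of _ "\<lambda>x. (x, x\<^sub>0)"] conjI ballI impI \<psi>)
    show "finite X" using \<open>finite U\<close> \<open>finite V\<close> by (simp add: X_def)
    show "inj_on (\<lambda>x. (x, x\<^sub>0)) X\<^sub>0" by (simp add: inj_on_def)
    show "(\<lambda>x. (x, x\<^sub>0)) ` X\<^sub>0 \<subseteq> X" using \<iota>X by blast
  next
    fix a x assume "a \<in> carrier A" "x \<in> X\<^sub>0"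
    then show "\<psi> (inl a) (x, x\<^sub>0) = (\<gamma> (inl a) x, x\<^sub>0)"
      using \<psi>A \<iota>X by (simp add: \<sigma>_def \<alpha>_def)
  next
    fix b x assume b: "b \<in> carrier B" and x: "x \<in> X\<^sub>0" "\<gamma> (inr b) x \<in> X\<^sub>0"
    then have "\<psi> (inr b) (x, x\<^sub>0) = \<theta>' (x\<^sub>0, \<gamma> (inr b) x)"
      using \<psi>B \<iota>X \<theta>X1 X01 by (auto simp: \<tau>_def \<beta>_def)
    also have "\<dots> = \<theta>' (\<theta> (\<gamma> (inr b) x, x\<^sub>0))" using \<theta>X1 X01 x by auto
    also have "\<dots> = (\<gamma> (inr b) x, x\<^sub>0)" using \<theta>' \<iota>X x by simp
    finally show "\<psi> (inr b) (x, x\<^sub>0) = (\<gamma> (inr b) x, x\<^sub>0)" .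
  qed
qed

lemma letter_class_cases:
  assumes "x \<in> carrier A <+> carrier B"
  obtains (left) a where "a \<in> carrier A" "x = Inl a" "cls [x] = inl a"
  | (right) b where "b \<in> carrier B" "x = Inr b" "cls [x] = inr b"
  using assms by (auto simp: amalg_inl_def amalg_inr_def)

lemma cls_closed [simp]: "w \<in> W \<Longrightarrow> cls w \<in> carrier P"
  unfolding carrier_P by (rule imageI)

lemma cls_Cons:
  "x \<in> carrier A <+> carrier B \<Longrightarrow> w \<in> W \<Longrightarrow> cls (x # w) = cls [x] \<otimes>\<^bsub>P\<^esub> cls w"
  using mult_class[of "[x]" w] by simp

lemma word_of: assumes "g \<in> carrier P" obtains w where "w \<in> W" "g = cls w"
  using assms by (auto simp: carrier_P simp del: lists_eq_set)

text \<open>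
  Write every element of \<open>E\<close> as a word and let \<open>X\<^sub>0\<close> consist of all points that are visited when
  these words are applied to \<open>y\<close> letter by letter. The finite completion of \<open>X\<^sub>0\<close> reproduces all these
  walks, and hence the coincidences between their end points.
\<close>

lemma finite_orbit_model:
  fixes Y :: "'y set"
  assumes RS: "(R, S) \<in> Omega A B H K \<phi>"
    and \<gamma>: "acts_on P Y \<gamma>" and y: "y \<in> Y"
    and stab_A: "\<And>a y. a \<in> carrier A \<Longrightarrow> y \<in> Y \<Longrightarrow> \<gamma> (inl a) y = y \<longleftrightarrow> a \<in> R"
    and stab_B: "\<And>b y. b \<in> carrier B \<Longrightarrow> y \<in> Y \<Longrightarrow> \<gamma> (inr b) y = y \<longleftrightarrow> b \<in> S"
    and E: "finite E" "E \<subseteq> carrier P"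
  shows "\<exists>(X :: ('y \<times> 'y) set) \<psi>. \<exists>x \<in> X. finite X \<and> acts_on P X \<psi> \<and>
    (\<forall>g \<in> E. \<forall>g' \<in> E. \<psi> g x = \<psi> g' x \<longleftrightarrow> \<gamma> g y = \<gamma> g' y)"
proof -
  have "\<forall>g \<in> E. \<exists>w \<in> W. g = cls w" using E(2) word_of by (metis subsetD)
  then obtain wd where wd: "\<And>g. g \<in> E \<Longrightarrow> wd g \<in> W" "\<And>g. g \<in> E \<Longrightarrow> g = cls (wd g)"
    by metis
  define X\<^sub>0 where "X\<^sub>0 = insert y (\<Union>g\<in>E. (\<lambda>i. \<gamma> (cls (drop i (wd g))) y) ` {..length (wd g)})"
  have drop_W: "drop i w \<in> W" if "w \<in> W" for i w
    using that by (auto dest: in_set_dropD)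
  have "finite X\<^sub>0" "X\<^sub>0 \<subseteq> Y" "X\<^sub>0 \<noteq> {}"
    using E(1) y acts_on_closed[OF \<gamma> cls_closed[OF drop_W[OF wd(1)]]] by (auto simp: X\<^sub>0_def)
  from finite_completion[OF RS \<gamma> stab_A stab_B this]
  obtain X :: "('y \<times> 'y) set" and \<psi> \<iota> where X: "finite X" "acts_on P X \<psi>"
    and \<iota>: "inj_on \<iota> X\<^sub>0" "\<iota> ` X\<^sub>0 \<subseteq> X"
    and \<psi>A: "\<And>a x. a \<in> carrier A \<Longrightarrow> x \<in> X\<^sub>0 \<Longrightarrow> \<gamma> (inl a) x \<in> X\<^sub>0 \<Longrightarrow>
        \<psi> (inl a) (\<iota> x) = \<iota> (\<gamma> (inl a) x)"
    and \<psi>B: "\<And>b x. b \<in> carrier B \<Longrightarrow> x \<in> X\<^sub>0 \<Longrightarrow> \<gamma> (inr b) x \<in> X\<^sub>0 \<Longrightarrow>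
        \<psi> (inr b) (\<iota> x) = \<iota> (\<gamma> (inr b) x)" by metis
  have \<iota>y: "\<iota> y \<in> X" using \<iota> by (auto simp: X\<^sub>0_def)
  have track: "\<psi> (cls w) (\<iota> y) = \<iota> (\<gamma> (cls w) y)"
    if "w \<in> W" "\<forall>i \<le> length w. \<gamma> (cls (drop i w)) y \<in> X\<^sub>0" for w
    using that
  proof (induction w rule: list.induct)
    case Nil
    then show ?case using acts_on_one[OF \<gamma> y] acts_on_one[OF X(2) \<iota>y] by (simp flip: one_P)
  next
    case (Cons x w)
    then have x: "x \<in> carrier A <+> carrier B" and w: "w \<in> W" by auto
    have suffixes: "\<forall>i \<le> length w. \<gamma> (cls (drop i w)) y \<in> X\<^sub>0"
      using Cons.prems(2) by fastforce
    have IH: "\<psi> (cls w) (\<iota> y) = \<iota> (\<gamma> (cls w) y)" using Cons.IH w suffixes by blast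
    have here: "\<gamma> (cls w) y \<in> X\<^sub>0" and there: "\<gamma> (cls (x # w)) y \<in> X\<^sub>0"
      using suffixes Cons.prems(2) by force+
    have x': "cls [x] \<in> carrier P" using x by simp
    have \<gamma>x: "\<gamma> (cls (x # w)) y = \<gamma> (cls [x]) (\<gamma> (cls w) y)"
      using acts_on_mult[OF \<gamma> x' cls_closed[OF w] y] by (simp add: cls_Cons[OF x w])
    have "\<psi> (cls (x # w)) (\<iota> y) = \<psi> (cls [x]) (\<iota> (\<gamma> (cls w) y))"
      using acts_on_mult[OF X(2) x' cls_closed[OF w] \<iota>y] by (simp add: cls_Cons[OF x w] IH)
    also have "\<dots> = \<iota> (\<gamma> (cls [x]) (\<gamma> (cls w) y))"
      using x \<psi>A \<psi>B here there \<gamma>x by (cases rule: letter_class_cases) auto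
    finally show ?case by (simp add: \<gamma>x)
  qed
  have end_pt: "\<psi> g (\<iota> y) = \<iota> (\<gamma> g y)" "\<gamma> g y \<in> X\<^sub>0" if g: "g \<in> E" for g
  proof -
    have traj: "\<forall>i \<le> length (wd g). \<gamma> (cls (drop i (wd g))) y \<in> X\<^sub>0"
      using g by (auto simp: X\<^sub>0_def)
    show "\<psi> g (\<iota> y) = \<iota> (\<gamma> g y)" using track[OF wd(1)[OF g] traj] wd(2)[OF g] by simp
    show "\<gamma> g y \<in> X\<^sub>0" using traj[rule_format, of 0] wd(2)[OF g] by simp
  qed
  show ?thesis
  proof (intro exI[of _ X] exI[of _ \<psi>] bexI[OF _ \<iota>y] conjI ballI X)
    fix g g' assume "g \<in> E" "g' \<in> E"
    then show "\<psi> g (\<iota> y) = \<psi> g' (\<iota> y) \<longleftrightarrow> \<gamma> g y = \<gamma> g' y"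
      using end_pt \<iota>(1) by (simp add: inj_on_eq_iff)
  qed
qed

end

section \<open>Separation from cyclic subgroups by means of coset spaces\<close>

lemma (in group) acts_on_left_cosets:
  assumes "subgroup D G"
  shows "acts_on G ((\<lambda>g. g <# D) ` carrier G) (\<lambda>g C. g <# C)"
proof -
  have D: "D \<subseteq> carrier G" by (rule subgroup.subset[OF assms])
  show ?thesis by (auto simp: acts_on_def lcos_m_assoc[OF D] m_assoc)
qed

lemma (in group) l_coset_eq_iff:
  assumes D: "subgroup D G" and "g \<in> carrier G" "h \<in> carrier G"
  shows "g <# D = h <# D \<longleftrightarrow> inv g \<otimes> h \<in> D"
proof
  assume "g <# D = h <# D"
  moreover have "h \<in> h <# D" using assms subgroup.one_closed[OF D] by (force simp: l_coset_def)
  ultimately obtain d where "d \<in> D" "h = g \<otimes> d" by (auto simp: l_coset_def)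
  with assms subgroup.mem_carrier[OF D] show "inv g \<otimes> h \<in> D"
    by (simp add: inv_solve_left' flip: m_assoc)
next
  assume "inv g \<otimes> h \<in> D"
  moreover have "h = g \<otimes> (inv g \<otimes> h)" using assms by (simp flip: m_assoc)
  ultimately have "h \<in> g <# D" by (auto simp: l_coset_def)
  then show "g <# D = h <# D" using assms l_repr_independence by blast
qed

lemma power_mem_finite_index:
  assumes \<Gamma>: "group \<Gamma>" and R: "normal_finite_index R \<Gamma>" and g: "g \<in> carrier \<Gamma>"
  obtains e :: nat where "e > 0" "g [^]\<^bsub>\<Gamma>\<^esub> e \<in> R"
proof -
  interpret normal R \<Gamma> using R by (simp add: normal_finite_index_def)
  interpret Q: group "\<Gamma> Mod R" by (rule factorgroup_is_group)
  have "finite (carrier (\<Gamma> Mod R))" using R by (simp add: normal_finite_index_def FactGroup_def)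
  then have e: "order (\<Gamma> Mod R) > 0" by (simp add: Q.order_gt_0_iff_finite)
  have "R #>\<^bsub>\<Gamma>\<^esub> g \<in> carrier (\<Gamma> Mod R)" using g by (simp add: carrier_FactGroup)
  then have "R #>\<^bsub>\<Gamma>\<^esub> (g [^]\<^bsub>\<Gamma>\<^esub> order (\<Gamma> Mod R)) = R"
    using Q.pow_order_eq_1 g by (simp flip: FactGroup_pow)
  then have "g [^]\<^bsub>\<Gamma>\<^esub> order (\<Gamma> Mod R) \<in> R"
    using coset_join1 g is_subgroup subset by simp
  with e that show ?thesis by blast
qed

context amalgamated_product
begin

text \<open>
  The points of the finite sets are pairs of cosets, because the sets come from the finite
  completion of a coset space.
\<close>

abbreviation separated_by_finite_action :: "('a + 'b) list set \<Rightarrow> ('a + 'b) list set set \<Rightarrow> bool" where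
  "separated_by_finite_action g F \<equiv>
    \<exists>(X :: (('a + 'b) list set set \<times> ('a + 'b) list set set) set) \<psi>. \<exists>x \<in> X.
      finite X \<and> acts_on P X \<psi> \<and> (\<forall>f \<in> F. \<psi> g x \<noteq> \<psi> f x)"

text \<open>
  The hypotheses on \<open>D\<close> say that every point of \<open>G / D\<close> has stabilisers \<open>R\<close> and \<open>S\<close>. In a finite
  model of the points \<open>g D, D, c D, \<dots>, c\<^sup>m D\<close> the element \<open>c\<^sup>m\<close> fixes the base point, so the
  powers of \<open>c\<close> move it only to the finitely many points that are compared with its image under \<open>g\<close>.
\<close>

lemma cyclic_separation:
  assumes RS: "(R, S) \<in> Omega A B H K \<phi>" and D: "subgroup D P"
    and DA: "\<And>a g. a \<in> carrier A \<Longrightarrow> g \<in> carrier P \<Longrightarrow> inv\<^bsub>P\<^esub> g \<otimes>\<^bsub>P\<^esub> inl a \<otimes>\<^bsub>P\<^esub> g \<in> D \<longleftrightarrow> a \<in> R"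
    and DB: "\<And>b g. b \<in> carrier B \<Longrightarrow> g \<in> carrier P \<Longrightarrow> inv\<^bsub>P\<^esub> g \<otimes>\<^bsub>P\<^esub> inr b \<otimes>\<^bsub>P\<^esub> g \<in> D \<longleftrightarrow> b \<in> S"
    and c: "c \<in> carrier P" and g: "g \<in> carrier P"
    and m: "m > 0" "c [^]\<^bsub>P\<^esub> (m :: nat) \<in> D"
    and sep: "\<And>k :: nat. k < m \<Longrightarrow> inv\<^bsub>P\<^esub> g \<otimes>\<^bsub>P\<^esub> c [^]\<^bsub>P\<^esub> k \<notin> D"
  shows "separated_by_finite_action g (generate P {c})"
proof -
  define Y where "Y = (\<lambda>g. g <#\<^bsub>P\<^esub> D) ` carrier P"
  define E where "E = insert g ((\<lambda>k :: nat. c [^]\<^bsub>P\<^esub> k) ` {..m})"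
  have Dc: "D \<subseteq> carrier P" by (rule subgroup.subset[OF D])
  have \<gamma>: "acts_on P Y (\<lambda>g C. g <#\<^bsub>P\<^esub> C)" unfolding Y_def by (rule P.acts_on_left_cosets[OF D])
  have DY: "D \<in> Y" using P.lcos_mult_one[OF Dc] P.one_closed unfolding Y_def by (metis imageI)
  have stab: "u <#\<^bsub>P\<^esub> C = C \<longleftrightarrow> inv\<^bsub>P\<^esub> h \<otimes>\<^bsub>P\<^esub> u \<otimes>\<^bsub>P\<^esub> h \<in> D"
    if u: "u \<in> carrier P" and h: "h \<in> carrier P" "C = h <#\<^bsub>P\<^esub> D" for u h C
  proof -
    have "u <#\<^bsub>P\<^esub> C = C \<longleftrightarrow> h <#\<^bsub>P\<^esub> D = (u \<otimes>\<^bsub>P\<^esub> h) <#\<^bsub>P\<^esub> D"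
      using u h by (auto simp: P.lcos_m_assoc[OF Dc])
    also have "\<dots> \<longleftrightarrow> inv\<^bsub>P\<^esub> h \<otimes>\<^bsub>P\<^esub> u \<otimes>\<^bsub>P\<^esub> h \<in> D"
      using u h by (simp add: P.l_coset_eq_iff[OF D] P.m_assoc)
    finally show ?thesis .
  qed
  have stab_A: "inl a <#\<^bsub>P\<^esub> C = C \<longleftrightarrow> a \<in> R" if "a \<in> carrier A" "C \<in> Y" for a C
    using that stab[of "inl a"] DA by (auto simp: Y_def)
  have stab_B: "inr b <#\<^bsub>P\<^esub> C = C \<longleftrightarrow> b \<in> S" if "b \<in> carrier B" "C \<in> Y" for b C
    using that stab[of "inr b"] DB by (auto simp: Y_def)
  have "finite E" "E \<subseteq> carrier P" using c g by (auto simp: E_def)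
  from finite_orbit_model[OF RS \<gamma> DY stab_A stab_B this]
  obtain X :: "(('a + 'b) list set set \<times> ('a + 'b) list set set) set" and \<psi> x
    where X: "x \<in> X" "finite X" and \<psi>: "acts_on P X \<psi>"
      and E: "\<And>u u'. u \<in> E \<Longrightarrow> u' \<in> E \<Longrightarrow> \<psi> u x = \<psi> u' x \<longleftrightarrow> u <#\<^bsub>P\<^esub> D = u' <#\<^bsub>P\<^esub> D"
    by blast
  let ?cm = "c [^]\<^bsub>P\<^esub> m"
  have cm: "?cm \<in> carrier P" using c by simp
  have "\<psi> ?cm x = \<psi> (c [^]\<^bsub>P\<^esub> (0 :: nat)) x"
    using E[of ?cm "c [^]\<^bsub>P\<^esub> (0 :: nat)"] m c subgroup.m_inv_closed[OF D m(2)]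
    by (force simp: E_def P.l_coset_eq_iff[OF D])
  then have "?cm \<in> {u \<in> carrier P. \<psi> u x = x}"
    using cm acts_on_one[OF \<psi> X(1)] by simp
  then have stab_cm: "?cm [^]\<^bsub>P\<^esub> q \<in> {u \<in> carrier P. \<psi> u x = x}" for q :: int
    by (rule P.subgroup_int_pow_closed[OF acts_on_stabilizer[OF group_P \<psi> X(1)]])
  have "\<psi> g x \<noteq> \<psi> f x" if fc: "f \<in> generate P {c}" for f
  proof
    assume eq: "\<psi> g x = \<psi> f x"
    obtain i :: int where f: "f = c [^]\<^bsub>P\<^esub> i" using fc P.generate_pow[OF c] by auto
    define r where "r = nat (i mod int m)"
    have r: "r < m" "i = int r + int m * (i div int m)" using m(1) by (simp_all add: r_def nat_less_iff)
    have "f = c [^]\<^bsub>P\<^esub> r \<otimes>\<^bsub>P\<^esub> ?cm [^]\<^bsub>P\<^esub> (i div int m)"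
      using c by (subst f, subst r(2)) (simp add: P.int_pow_mult P.int_pow_pow flip: int_pow_int)
    then have "\<psi> f x = \<psi> (c [^]\<^bsub>P\<^esub> r) x"
      using acts_on_mult[OF \<psi> _ _ X(1), of "c [^]\<^bsub>P\<^esub> r" "?cm [^]\<^bsub>P\<^esub> (i div int m)"] c stab_cm
      by simp
    with eq have "\<psi> g x = \<psi> (c [^]\<^bsub>P\<^esub> r) x" by simp
    then have "inv\<^bsub>P\<^esub> g \<otimes>\<^bsub>P\<^esub> c [^]\<^bsub>P\<^esub> r \<in> D"
      using E[of g "c [^]\<^bsub>P\<^esub> r"] r(1) c g by (simp add: E_def P.l_coset_eq_iff[OF D])
    with sep[OF r(1)] show False by blast
  qed
  with X \<psi> show ?thesis by blast
qed

text \<open>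
  This is the case \<open>D = N\<close> of \<open>cyclic_separation\<close>: all conjugates of \<open>N\<close> coincide with \<open>N\<close>.
\<close>

lemma elliptic_separation:
  assumes RS: "(R, S) \<in> Omega A B H K \<phi>" and N: "N \<lhd> P"
    and NA: "\<And>a. a \<in> carrier A \<Longrightarrow> inl a \<in> N \<longleftrightarrow> a \<in> R"
    and NB: "\<And>b. b \<in> carrier B \<Longrightarrow> inr b \<in> N \<longleftrightarrow> b \<in> S"
    and c: "c \<in> carrier P" and g: "g \<in> carrier P"
    and m: "m > 0" "c [^]\<^bsub>P\<^esub> (m :: nat) \<in> N"
    and sep: "\<And>k :: nat. inv\<^bsub>P\<^esub> g \<otimes>\<^bsub>P\<^esub> c [^]\<^bsub>P\<^esub> k \<notin> N"
  shows "separated_by_finite_action g (generate P {c})"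
proof -
  interpret N: normal N P by fact
  have "inv\<^bsub>P\<^esub> g \<otimes>\<^bsub>P\<^esub> u \<otimes>\<^bsub>P\<^esub> g \<in> N \<longleftrightarrow> u \<in> N"
    if "u \<in> carrier P" "g \<in> carrier P" for u g
  proof
    assume "inv\<^bsub>P\<^esub> g \<otimes>\<^bsub>P\<^esub> u \<otimes>\<^bsub>P\<^esub> g \<in> N"
    from N.inv_op_closed2[OF that(2) this] that show "u \<in> N"
      by (simp add: P.m_assoc P.inv_solve_left') (simp flip: P.m_assoc)
  qed (use N.inv_op_closed1[OF that(2)] in simp)
  then show ?thesis
    using cyclic_separation[OF RS N.is_subgroup _ _ c g m sep] NA NB by simp
qed

text \<open>
  Take for \<open>D\<close> in \<open>cyclic_separation\<close> the preimage of the cyclic group generated by \<open>c\<close> in \<open>G / N\<close>. That group is infinite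
  cyclic, hence torsion-free, while the elements of \<open>A\<close> and \<open>B\<close> have finite order modulo \<open>N\<close>.
  Therefore a conjugate of an element of a factor lies in \<open>D\<close> only if it lies in \<open>N\<close>.
\<close>

lemma hyperbolic_separation:
  assumes RS: "(R, S) \<in> Omega A B H K \<phi>" and N: "N \<lhd> P"
    and NA: "\<And>a. a \<in> carrier A \<Longrightarrow> inl a \<in> N \<longleftrightarrow> a \<in> R"
    and NB: "\<And>b. b \<in> carrier B \<Longrightarrow> inr b \<in> N \<longleftrightarrow> b \<in> S"
    and c: "c \<in> carrier P" and g: "g \<in> carrier P"
    and inf: "\<And>k :: int. c [^]\<^bsub>P\<^esub> k \<in> N \<Longrightarrow> k = 0"
    and sep: "\<And>k :: int. inv\<^bsub>P\<^esub> g \<otimes>\<^bsub>P\<^esub> c [^]\<^bsub>P\<^esub> k \<notin> N"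
  shows "separated_by_finite_action g (generate P {c})"
proof -
  interpret N: normal N P by fact
  interpret q: group_hom P "P Mod N" "\<lambda>x. N #>\<^bsub>P\<^esub> x"
    by (intro group_hom.intro group_hom_axioms.intro group_P N.factorgroup_is_group N.r_coset_hom_Mod)
  have q1: "N #>\<^bsub>P\<^esub> x = N \<longleftrightarrow> x \<in> N" if "x \<in> carrier P" for x
    using P.coset_join1[OF _ that N.is_subgroup] P.coset_join2[OF that N.is_subgroup] by iprover
  have q_mem: "N #>\<^bsub>P\<^esub> x = N #>\<^bsub>P\<^esub> y \<longleftrightarrow> inv\<^bsub>P\<^esub> x \<otimes>\<^bsub>P\<^esub> y \<in> N"
    if "x \<in> carrier P" "y \<in> carrier P" for x y
    using that P.l_coset_eq_iff[OF N.is_subgroup, of x y] N.coset_eq by simp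
  define D where "D = {x \<in> carrier P. \<exists>k :: int. N #>\<^bsub>P\<^esub> x = N #>\<^bsub>P\<^esub> (c [^]\<^bsub>P\<^esub> k)}"
  have D: "subgroup D P"
  proof (rule P.subgroupI)
    show "D \<subseteq> carrier P" "D \<noteq> {}" using c by (auto simp: D_def)
  next
    fix x assume "x \<in> D"
    then obtain k :: int where x: "x \<in> carrier P" and "N #>\<^bsub>P\<^esub> x = N #>\<^bsub>P\<^esub> (c [^]\<^bsub>P\<^esub> k)"
      by (auto simp: D_def)
    then have "N #>\<^bsub>P\<^esub> (inv\<^bsub>P\<^esub> x) = N #>\<^bsub>P\<^esub> (c [^]\<^bsub>P\<^esub> (- k))"
      using c by (simp add: q.hom_inv P.int_pow_neg)
    with x show "inv\<^bsub>P\<^esub> x \<in> D" by (auto simp: D_def)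
  next
    fix x y assume "x \<in> D" "y \<in> D"
    then obtain k l :: int where x: "x \<in> carrier P" "N #>\<^bsub>P\<^esub> x = N #>\<^bsub>P\<^esub> (c [^]\<^bsub>P\<^esub> k)"
      and y: "y \<in> carrier P" "N #>\<^bsub>P\<^esub> y = N #>\<^bsub>P\<^esub> (c [^]\<^bsub>P\<^esub> l)"
      by (auto simp: D_def)
    then have "N #>\<^bsub>P\<^esub> (x \<otimes>\<^bsub>P\<^esub> y) = N #>\<^bsub>P\<^esub> (c [^]\<^bsub>P\<^esub> (k + l))"
      using c q.hom_mult[of x y] q.hom_mult[of "c [^]\<^bsub>P\<^esub> k" "c [^]\<^bsub>P\<^esub> l"]
      by (simp add: P.int_pow_mult)
    with x y show "x \<otimes>\<^bsub>P\<^esub> y \<in> D" by (auto simp: D_def)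
  qed
  have ND: "N \<subseteq> D"
  proof
    fix x assume "x \<in> N"
    then have "x \<in> carrier P" "N #>\<^bsub>P\<^esub> x = N #>\<^bsub>P\<^esub> (c [^]\<^bsub>P\<^esub> (0 :: int))"
      using q1 N.mem_carrier q1[of "\<one>\<^bsub>P\<^esub>"] N.one_closed by auto
    then show "x \<in> D" unfolding D_def by blast
  qed
  \<comment> \<open>This will be applied to elements of the factors, which have powers in \<open>R\<close> or \<open>S\<close>.\<close>
  have torsion: "inv\<^bsub>P\<^esub> h \<otimes>\<^bsub>P\<^esub> u \<otimes>\<^bsub>P\<^esub> h \<in> D \<longleftrightarrow> u \<in> N"
    if u: "u \<in> carrier P" and h: "h \<in> carrier P" and e: "e > 0" "u [^]\<^bsub>P\<^esub> (e :: nat) \<in> N" for u h e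
  proof
    assume "u \<in> N"
    then show "inv\<^bsub>P\<^esub> h \<otimes>\<^bsub>P\<^esub> u \<otimes>\<^bsub>P\<^esub> h \<in> D" using N.inv_op_closed1[OF h] ND by blast
  next
    let ?v = "inv\<^bsub>P\<^esub> h \<otimes>\<^bsub>P\<^esub> u \<otimes>\<^bsub>P\<^esub> h"
    assume "?v \<in> D"
    then obtain k :: int where k: "N #>\<^bsub>P\<^esub> ?v = N #>\<^bsub>P\<^esub> (c [^]\<^bsub>P\<^esub> k)" by (auto simp: D_def)
    have v: "?v \<in> carrier P" using u h by simp
    have pow: "?v [^]\<^bsub>P\<^esub> j = inv\<^bsub>P\<^esub> h \<otimes>\<^bsub>P\<^esub> u [^]\<^bsub>P\<^esub> j \<otimes>\<^bsub>P\<^esub> h" for j :: nat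
    proof (induction j)
      case (Suc j)
      have "h \<otimes>\<^bsub>P\<^esub> (inv\<^bsub>P\<^esub> h \<otimes>\<^bsub>P\<^esub> (u \<otimes>\<^bsub>P\<^esub> h)) = u \<otimes>\<^bsub>P\<^esub> h"
        using u h by (simp flip: P.m_assoc)
      with Suc u h show ?case by (simp add: P.m_assoc)
    qed (use h in simp)
    have "?v [^]\<^bsub>P\<^esub> e \<in> N" using N.inv_op_closed1[OF h e(2)] by (simp add: pow)
    then have "N = N #>\<^bsub>P\<^esub> (?v [^]\<^bsub>P\<^esub> e)" using q1[of "?v [^]\<^bsub>P\<^esub> e"] v by simp
    also have "\<dots> = (N #>\<^bsub>P\<^esub> (c [^]\<^bsub>P\<^esub> k)) [^]\<^bsub>P Mod N\<^esub> e" using q.hom_nat_pow[OF v] k by simp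
    also have "\<dots> = N #>\<^bsub>P\<^esub> (c [^]\<^bsub>P\<^esub> (k * int e))"
      using q.hom_nat_pow[of "c [^]\<^bsub>P\<^esub> k" e] c by (simp add: P.int_pow_pow flip: int_pow_int)
    finally have "c [^]\<^bsub>P\<^esub> (k * int e) \<in> N"
      by (subst q1[symmetric]) (use c in auto)
    from inf[OF this] e(1) have "k = 0" by simp
    with k have "?v \<in> N" using q1[OF v] q1[of "\<one>\<^bsub>P\<^esub>"] N.one_closed by simp
    from N.inv_op_closed2[OF h this] show "u \<in> N"
      using u h by (simp add: P.m_assoc P.inv_solve_left') (simp flip: P.m_assoc)
  qed
  have RS': "normal_finite_index R A" "normal_finite_index S B" using RS by (auto simp: Omega_def)
  have "inv\<^bsub>P\<^esub> h \<otimes>\<^bsub>P\<^esub> inl a \<otimes>\<^bsub>P\<^esub> h \<in> D \<longleftrightarrow> a \<in> R" if a: "a \<in> carrier A" and h: "h \<in> carrier P" for a h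
  proof -
    obtain e :: nat where "e > 0" "a [^]\<^bsub>A\<^esub> e \<in> R"
      using power_mem_finite_index[OF A.group_axioms RS'(1) a] by blast
    then show ?thesis using torsion[of "inl a" h e] NA a h by (simp flip: inl.hom_nat_pow)
  qed
  moreover have "inv\<^bsub>P\<^esub> h \<otimes>\<^bsub>P\<^esub> inr b \<otimes>\<^bsub>P\<^esub> h \<in> D \<longleftrightarrow> b \<in> S"
    if b: "b \<in> carrier B" and h: "h \<in> carrier P" for b h
  proof -
    obtain e :: nat where "e > 0" "b [^]\<^bsub>B\<^esub> e \<in> S"
      using power_mem_finite_index[OF B.group_axioms RS'(2) b] by blast
    then show ?thesis using torsion[of "inr b" h e] NB b h by (simp flip: inr.hom_nat_pow)
  qed
  moreover have "c [^]\<^bsub>P\<^esub> (1 :: nat) \<in> D"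
    using c by (auto simp: D_def intro!: exI[of _ "1 :: int"])
  moreover have "inv\<^bsub>P\<^esub> g \<otimes>\<^bsub>P\<^esub> c [^]\<^bsub>P\<^esub> k \<notin> D" if "k < 1" for k :: nat
  proof
    assume "inv\<^bsub>P\<^esub> g \<otimes>\<^bsub>P\<^esub> c [^]\<^bsub>P\<^esub> k \<in> D"
    then have "inv\<^bsub>P\<^esub> g \<in> D" using that g by simp
    then have "g \<in> D" using subgroup.m_inv_closed[OF D] g by fastforce
    then obtain l :: int where "N #>\<^bsub>P\<^esub> g = N #>\<^bsub>P\<^esub> (c [^]\<^bsub>P\<^esub> l)" by (auto simp: D_def)
    then show False using q_mem[of g "c [^]\<^bsub>P\<^esub> l"] g c sep[of l] by simp
  qed
  ultimately show ?thesis
    using cyclic_separation[OF RS D _ _ c g, of 1] by simp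
qed

end

section \<open>Normal forms and a length function modulo a compatible pair\<close>

definition coset_rep :: "('g, 'm) monoid_scheme \<Rightarrow> 'g set \<Rightarrow> 'g \<Rightarrow> 'g" where
  "coset_rep \<Gamma> U x = (SOME t. t \<in> U #>\<^bsub>\<Gamma>\<^esub> x)"

context group
begin

lemma coset_rep_mem:
  assumes "subgroup U G" "x \<in> carrier G"
  shows "coset_rep G U x \<in> U #> x"
  unfolding coset_rep_def using rcos_self[OF assms(2,1)] by (rule someI)

lemma coset_rep_closed:
  assumes "subgroup U G" "x \<in> carrier G"
  shows "coset_rep G U x \<in> carrier G"
  using coset_rep_mem[OF assms] r_coset_subset_G[OF subgroup.subset[OF assms(1)] assms(2)] by blast

lemma coset_rep_mult:
  assumes "subgroup U G" "x \<in> carrier G" "u \<in> U"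
  shows "coset_rep G U (u \<otimes> x) = coset_rep G U x"
proof -
  have "U #> (u \<otimes> x) = U #> x"
    using assms subgroup.subset[OF assms(1)] subgroup.mem_carrier[OF assms(1,3)]
    by (simp add: coset_join2 flip: coset_mult_assoc)
  then show ?thesis by (simp add: coset_rep_def)
qed

lemma coset_rep_quotient:
  assumes U: "subgroup U G" and x: "x \<in> carrier G"
  obtains u where "u \<in> U" "x = u \<otimes> coset_rep G U x" "x \<otimes> inv (coset_rep G U x) = u"
proof -
  obtain v where v: "v \<in> U" "coset_rep G U x = v \<otimes> x"
    using coset_rep_mem[OF assms] by (auto simp: r_coset_def)
  show ?thesis
  proof (rule that[of "inv v"])
    show "inv v \<in> U" using U v(1) by (rule subgroup.m_inv_closed)
    show "x = inv v \<otimes> coset_rep G U x" "x \<otimes> inv (coset_rep G U x) = inv v"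
      using v x subgroup.mem_carrier[OF U v(1)]
      by (simp_all add: inv_mult_group flip: m_assoc)
  qed
qed

lemma coset_rep_in_iff:
  assumes U: "subgroup U G" and x: "x \<in> carrier G"
  shows "coset_rep G U x \<in> U \<longleftrightarrow> x \<in> U"
proof -
  obtain v where v: "v \<in> U" "coset_rep G U x = v \<otimes> x"
    using coset_rep_mem[OF assms] by (auto simp: r_coset_def)
  have "x = inv v \<otimes> (v \<otimes> x)" using x subgroup.mem_carrier[OF U v(1)] by (simp flip: m_assoc)
  then show ?thesis
    using v subgroup.m_closed[OF U] subgroup.m_inv_closed[OF U] by metis
qed

lemma coset_rep_idem:
  assumes "subgroup U G" "x \<in> carrier G"
  shows "coset_rep G U (coset_rep G U x) = coset_rep G U x"
proof -
  obtain v where "v \<in> U" "coset_rep G U x = v \<otimes> x"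
    using coset_rep_mem[OF assms] by (auto simp: r_coset_def)
  then show ?thesis using coset_rep_mult[OF assms] by simp
qed

end

text \<open>
  These are the coordinates of van der Waerden's method. A normal form consists of a label for an
  element of \<open>U\<close> followed by a list of syllables, each a chosen representative of a coset of \<open>U\<close>.
  An element \<open>x = u t\<close> of \<open>\<Gamma>\<close>, where \<open>t\<close> is the representative of \<open>U x\<close>, together with a list \<open>s\<close>
  describes the normal form with label \<open>j u\<close> and syllables \<open>t, s\<close>, where \<open>t\<close> is omitted if it
  lies in \<open>U\<close>. The label \<open>j\<close> allows the two factors, whose subgroups \<open>U\<close> live in different types,
  to use the same set of labels.
\<close>

definition prefix_coords ::
  "('g, 'm) monoid_scheme \<Rightarrow> 'g set \<Rightarrow> ('g \<Rightarrow> 'k) \<Rightarrow> ('g \<Rightarrow> 's) \<Rightarrow> 'g \<times> 's list \<Rightarrow> 'k \<times> 's list" where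
  "prefix_coords \<Gamma> U j I = (\<lambda>(x, s). (j (x \<otimes>\<^bsub>\<Gamma>\<^esub> inv\<^bsub>\<Gamma>\<^esub> (coset_rep \<Gamma> U x)),
      if x \<in> U then s else I (coset_rep \<Gamma> U x) # s))"

text \<open>
  All elements \<open>x\<close> of \<open>U\<close> have the same representative, which need not be the unit; so the label
  still determines \<open>x\<close> when the syllable is omitted.
\<close>

lemma prefix_coords_bij:
  assumes \<Gamma>: "group \<Gamma>" and U: "subgroup U \<Gamma>" and j: "inj_on j U" and I: "inj I"
    and T: "T = coset_rep \<Gamma> U ` (carrier \<Gamma> - U)"
    and L: "\<And>t s. t \<in> T \<Longrightarrow> I t # s \<notin> L"
  shows "bij_betw (prefix_coords \<Gamma> U j I) (carrier \<Gamma> \<times> L) (j ` U \<times> (L \<union> {I t # s | t s. t \<in> T \<and> s \<in> L}))"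
proof -
  interpret group \<Gamma> by fact
  let ?e = "prefix_coords \<Gamma> U j I" and ?\<rho> = "coset_rep \<Gamma> U"
  have TI: "?\<rho> x \<in> T" if "x \<in> carrier \<Gamma>" "x \<notin> U" for x using that by (auto simp: T)
  have Uc: "x \<in> carrier \<Gamma>" if "x \<in> U" for x by (rule subgroup.mem_carrier[OF U that])
  have \<rho>U: "?\<rho> x = ?\<rho> \<one>\<^bsub>\<Gamma>\<^esub>" if "x \<in> U" for x
    using coset_rep_mult[OF U one_closed that] Uc[OF that] by simp
  have "inj_on ?e (carrier \<Gamma> \<times> L)"
  proof (rule inj_onI, clarify)
    fix x s x' s' assume x: "x \<in> carrier \<Gamma>" "x' \<in> carrier \<Gamma>" and s: "s \<in> L" "s' \<in> L"
      and eq: "?e (x, s) = ?e (x', s')"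
    obtain u where u: "u \<in> U" "x = u \<otimes>\<^bsub>\<Gamma>\<^esub> ?\<rho> x" "x \<otimes>\<^bsub>\<Gamma>\<^esub> inv\<^bsub>\<Gamma>\<^esub> (?\<rho> x) = u"
      using coset_rep_quotient[OF U x(1)] .
    obtain u' where u': "u' \<in> U" "x' = u' \<otimes>\<^bsub>\<Gamma>\<^esub> ?\<rho> x'" "x' \<otimes>\<^bsub>\<Gamma>\<^esub> inv\<^bsub>\<Gamma>\<^esub> (?\<rho> x') = u'"
      using coset_rep_quotient[OF U x(2)] .
    from eq have "j u = j u'" by (simp add: prefix_coords_def u(3) u'(3))
    with j u(1) u'(1) have "u = u'" by (simp add: inj_on_eq_iff)
    moreover have "?\<rho> x = ?\<rho> x' \<and> s = s'"
      using eq I s L TI x \<rho>U by (auto simp: prefix_coords_def inj_eq split: if_splits)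
    ultimately show "x = x' \<and> s = s'" using u(2) u'(2) by simp
  qed
  moreover have "?e ` (carrier \<Gamma> \<times> L) = j ` U \<times> (L \<union> {I t # s | t s. t \<in> T \<and> s \<in> L})"
  proof (intro equalityI subsetI)
    fix z assume "z \<in> ?e ` (carrier \<Gamma> \<times> L)"
    then obtain x s where x: "x \<in> carrier \<Gamma>" "s \<in> L" "z = ?e (x, s)" by auto
    obtain u where "u \<in> U" "x \<otimes>\<^bsub>\<Gamma>\<^esub> inv\<^bsub>\<Gamma>\<^esub> (?\<rho> x) = u" using coset_rep_quotient[OF U x(1)] .
    with x TI show "z \<in> j ` U \<times> (L \<union> {I t # s | t s. t \<in> T \<and> s \<in> L})"
      by (auto simp: prefix_coords_def)
  next
    fix z assume "z \<in> j ` U \<times> (L \<union> {I t # s | t s. t \<in> T \<and> s \<in> L})"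
    then obtain u r where z: "z = (j u, r)" "u \<in> U" and r: "r \<in> L \<or> (\<exists>t s. r = I t # s \<and> t \<in> T \<and> s \<in> L)"
      by auto
    from r show "z \<in> ?e ` (carrier \<Gamma> \<times> L)"
    proof (elim disjE exE conjE)
      assume "r \<in> L"
      let ?x = "u \<otimes>\<^bsub>\<Gamma>\<^esub> ?\<rho> \<one>\<^bsub>\<Gamma>\<^esub>"
      have \<rho>1: "?\<rho> \<one>\<^bsub>\<Gamma>\<^esub> \<in> U"
        using coset_rep_in_iff[OF U one_closed] subgroup.one_closed[OF U] by simp
      then have "?x \<in> U" using z(2) U subgroup.m_closed by metis
      moreover from this have "?\<rho> ?x = ?\<rho> \<one>\<^bsub>\<Gamma>\<^esub>" by (rule \<rho>U)
      ultimately have "?e (?x, r) = z"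
        using \<rho>1 z Uc by (simp add: prefix_coords_def m_assoc)
      with \<open>?x \<in> U\<close> \<open>r \<in> L\<close> Uc show ?thesis by (metis SigmaI imageI)
    next
      fix t s assume t: "r = I t # s" "t \<in> T" "s \<in> L"
      let ?x = "u \<otimes>\<^bsub>\<Gamma>\<^esub> t"
      from t(2) obtain y where y: "y \<in> carrier \<Gamma>" "y \<notin> U" "t = ?\<rho> y" by (auto simp: T)
      then have tc: "t \<in> carrier \<Gamma>" "t \<notin> U" "?\<rho> t = t"
        using coset_rep_closed[OF U] coset_rep_in_iff[OF U] coset_rep_idem[OF U] by simp_all
      have \<rho>x: "?\<rho> ?x = t" using coset_rep_mult[OF U tc(1) z(2)] tc(3) by simp
      have "?x \<in> carrier \<Gamma>" using tc z(2) Uc by simp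
      moreover from this have "?x \<notin> U" using coset_rep_in_iff[OF U] \<rho>x tc(2) by metis
      moreover have "?e (?x, s) = z"
        using \<open>?x \<notin> U\<close> \<rho>x z t(1) tc(1) Uc by (simp add: prefix_coords_def m_assoc)
      ultimately show ?thesis using t(3) by (metis SigmaI imageI)
    qed
  qed
  ultimately show ?thesis by (simp add: bij_betw_def)
qed

lemma acts_on_transport:
  assumes \<Gamma>: "group \<Gamma>" and e: "bij_betw e (carrier \<Gamma> \<times> L) Z"
  obtains \<sigma> where "acts_on \<Gamma> Z \<sigma>"
    "\<And>g x s. g \<in> carrier \<Gamma> \<Longrightarrow> x \<in> carrier \<Gamma> \<Longrightarrow> s \<in> L \<Longrightarrow> \<sigma> g (e (x, s)) = e (g \<otimes>\<^bsub>\<Gamma>\<^esub> x, s)"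
proof -
  interpret group \<Gamma> by fact
  define d where "d = inv_into (carrier \<Gamma> \<times> L) e"
  define \<sigma> where "\<sigma> g z = e (g \<otimes>\<^bsub>\<Gamma>\<^esub> fst (d z), snd (d z))" for g z
  have \<sigma>e: "\<sigma> g (e (x, s)) = e (g \<otimes>\<^bsub>\<Gamma>\<^esub> x, s)" if "x \<in> carrier \<Gamma>" "s \<in> L" for g x s
    using e that by (simp add: \<sigma>_def d_def bij_betw_def)
  have Z: "\<exists>x s. x \<in> carrier \<Gamma> \<and> s \<in> L \<and> z = e (x, s)" if "z \<in> Z" for z
    using e that by (auto simp: bij_betw_def)
  have eZ: "e (x, s) \<in> Z" if "x \<in> carrier \<Gamma>" "s \<in> L" for x s
    using e that by (auto simp: bij_betw_def)
  have "acts_on \<Gamma> Z \<sigma>"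
    by (auto simp: acts_on_def \<sigma>e eZ m_assoc dest!: Z)
  with \<sigma>e that show ?thesis by blast
qed

text \<open>
  Through the coordinates, left multiplication of \<open>\<Gamma>\<close> on itself becomes a free action on normal
  forms. Both factors act on the same set \<open>Z\<close> in this way. The last three properties describe
  the actions without the coordinates: \<open>U\<close> changes only the label, no element lengthens the list by
  more than one syllable, and an element outside \<open>U\<close> adds a syllable to any list that does not
  start with a syllable of its own factor.
\<close>

lemma syllable_action:
  assumes \<Gamma>: "group \<Gamma>" and U: "subgroup U \<Gamma>" and j: "inj_on j U" and I: "inj I"
    and T: "T = coset_rep \<Gamma> U ` (carrier \<Gamma> - U)"
    and L: "\<And>t s. t \<in> T \<Longrightarrow> I t # s \<notin> L"
    and Z: "Z = j ` U \<times> (L \<union> {I t # s | t s. t \<in> T \<and> s \<in> L})"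
  obtains \<sigma> where "acts_on \<Gamma> Z \<sigma>"
    "\<And>g z. g \<in> carrier \<Gamma> \<Longrightarrow> z \<in> Z \<Longrightarrow> \<sigma> g z = z \<longleftrightarrow> g = \<one>\<^bsub>\<Gamma>\<^esub>"
    "\<And>u v r. u \<in> U \<Longrightarrow> v \<in> U \<Longrightarrow> (j v, r) \<in> Z \<Longrightarrow> \<sigma> u (j v, r) = (j (u \<otimes>\<^bsub>\<Gamma>\<^esub> v), r)"
    "\<And>g z. g \<in> carrier \<Gamma> \<Longrightarrow> z \<in> Z \<Longrightarrow> length (snd (\<sigma> g z)) \<le> Suc (length (snd z))"
    "\<And>g z. g \<in> carrier \<Gamma> - U \<Longrightarrow> z \<in> Z \<Longrightarrow> snd z \<in> L \<Longrightarrow> \<exists>t. snd (\<sigma> g z) = I t # snd z"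
proof -
  interpret group \<Gamma> by fact
  let ?e = "prefix_coords \<Gamma> U j I" and ?\<rho> = "coset_rep \<Gamma> U"
  have Uc: "x \<in> carrier \<Gamma>" if "x \<in> U" for x by (rule subgroup.mem_carrier[OF U that])
  have e: "bij_betw ?e (carrier \<Gamma> \<times> L) Z"
    unfolding Z by (rule prefix_coords_bij[OF \<Gamma> U j I T L])
  then obtain \<sigma> where \<sigma>: "acts_on \<Gamma> Z \<sigma>"
    and \<sigma>e: "\<And>g x s. g \<in> carrier \<Gamma> \<Longrightarrow> x \<in> carrier \<Gamma> \<Longrightarrow> s \<in> L \<Longrightarrow> \<sigma> g (?e (x, s)) = ?e (g \<otimes>\<^bsub>\<Gamma>\<^esub> x, s)"
    using acts_on_transport[OF \<Gamma>] by blast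
  have decomp: "\<exists>x s. x \<in> carrier \<Gamma> \<and> s \<in> L \<and> z = ?e (x, s)" if "z \<in> Z" for z
    using e that by (auto simp: bij_betw_def)
  have U_mult: "u \<otimes>\<^bsub>\<Gamma>\<^esub> x \<in> U \<longleftrightarrow> x \<in> U" if "u \<in> U" "x \<in> carrier \<Gamma>" for u x
    using coset_rep_mult[OF U that(2,1)] coset_rep_in_iff[OF U] that Uc m_closed by metis
  have U_mult': "g \<otimes>\<^bsub>\<Gamma>\<^esub> u \<in> U \<longleftrightarrow> g \<in> U" if "u \<in> U" "g \<in> carrier \<Gamma>" for u g
  proof
    assume "g \<otimes>\<^bsub>\<Gamma>\<^esub> u \<in> U"
    then have "g \<otimes>\<^bsub>\<Gamma>\<^esub> u \<otimes>\<^bsub>\<Gamma>\<^esub> inv\<^bsub>\<Gamma>\<^esub> u \<in> U"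
      using that(1) subgroup.m_closed[OF U] subgroup.m_inv_closed[OF U] by blast
    then show "g \<in> U" using that Uc by (simp add: m_assoc)
  qed (use that(1) U subgroup.m_closed in metis)
  show ?thesis
  proof (rule that[OF \<sigma>])
    fix g z assume g: "g \<in> carrier \<Gamma>" and z: "z \<in> Z"
    from decomp[OF z] obtain x s where x: "x \<in> carrier \<Gamma>" "s \<in> L" "z = ?e (x, s)" by blast
    have "\<sigma> g z = z \<longleftrightarrow> (g \<otimes>\<^bsub>\<Gamma>\<^esub> x, s) = (x, s)"
      using \<sigma>e[OF g x(1,2)] x g inj_on_eq_iff[OF bij_betw_imp_inj_on[OF e], of "(g \<otimes>\<^bsub>\<Gamma>\<^esub> x, s)" "(x, s)"]
      by simp
    then show "\<sigma> g z = z \<longleftrightarrow> g = \<one>\<^bsub>\<Gamma>\<^esub>" using g x(1) by simp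
    show "length (snd (\<sigma> g z)) \<le> Suc (length (snd z))"
      using \<sigma>e[OF g x(1,2)] by (simp add: x(3) prefix_coords_def)
  next
    fix u v r assume u: "u \<in> U" and v: "v \<in> U" and z: "(j v, r) \<in> Z"
    from decomp[OF z] obtain x s where x: "x \<in> carrier \<Gamma>" "s \<in> L" "(j v, r) = ?e (x, s)" by blast
    obtain w where w: "w \<in> U" "x \<otimes>\<^bsub>\<Gamma>\<^esub> inv\<^bsub>\<Gamma>\<^esub> (?\<rho> x) = w" using coset_rep_quotient[OF U x(1)] .
    have "j v = j w" and r: "r = (if x \<in> U then s else I (?\<rho> x) # s)"
      using x(3) by (simp_all add: prefix_coords_def w(2))
    then have "v = w" using j v w(1) by (simp add: inj_on_eq_iff)
    have "\<sigma> u (j v, r) = ?e (u \<otimes>\<^bsub>\<Gamma>\<^esub> x, s)" using \<sigma>e[OF Uc[OF u] x(1,2)] x(3) by simp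
    also have "\<dots> = (j (u \<otimes>\<^bsub>\<Gamma>\<^esub> v), r)"
      using u x(1) Uc[OF u] w(2) coset_rep_closed[OF U x(1)]
      by (simp add: prefix_coords_def coset_rep_mult[OF U] U_mult r \<open>v = w\<close> m_assoc)
    finally show "\<sigma> u (j v, r) = (j (u \<otimes>\<^bsub>\<Gamma>\<^esub> v), r)" .
  next
    fix g z assume g: "g \<in> carrier \<Gamma> - U" and z: "z \<in> Z" and zL: "snd z \<in> L"
    from decomp[OF z] obtain x s where x: "x \<in> carrier \<Gamma>" "s \<in> L" "z = ?e (x, s)" by blast
    have "x \<in> U"
    proof (rule ccontr)
      assume "x \<notin> U"
      with x L[of "?\<rho> x" s] zL show False by (auto simp: prefix_coords_def T)
    qed
    then have "g \<otimes>\<^bsub>\<Gamma>\<^esub> x \<notin> U" using g U_mult' by blast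
    with \<open>x \<in> U\<close> show "\<exists>t. snd (\<sigma> g z) = I t # snd z"
      using \<sigma>e[of g x s] g x by (auto simp: prefix_coords_def)
  qed
qed

context amalgamated_product
begin

text \<open>
  By the hypothesis on the kernels, \<open>f\<close> and \<open>g \<circ> \<phi>\<close> induce the same partition of \<open>H\<close>. Its blocks label
  the elements of \<open>f H\<close> as well as those of \<open>g K\<close>, so an element of \<open>H\<close> changes the label in the same
  way whether it acts through \<open>f\<close> or through \<open>g\<close>.
\<close>

lemma normal_form_action:
  fixes L :: "('c, 'l) monoid_scheme" and M :: "('d, 'k) monoid_scheme"
  assumes L: "group L" and M: "group M" and f: "f \<in> hom A L" and g: "g \<in> hom B M"
    and ker: "\<And>h. h \<in> H \<Longrightarrow> f h = \<one>\<^bsub>L\<^esub> \<longleftrightarrow> g (\<phi> h) = \<one>\<^bsub>M\<^esub>"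
  obtains Z :: "('a set \<times> ('c + 'd) list) set" and \<psi> \<epsilon> where "acts_on P Z \<psi>" "\<epsilon> \<in> Z" "snd \<epsilon> = []"
    "\<And>a z. a \<in> carrier A \<Longrightarrow> z \<in> Z \<Longrightarrow> \<psi> (inl a) z = z \<longleftrightarrow> f a = \<one>\<^bsub>L\<^esub>"
    "\<And>b z. b \<in> carrier B \<Longrightarrow> z \<in> Z \<Longrightarrow> \<psi> (inr b) z = z \<longleftrightarrow> g b = \<one>\<^bsub>M\<^esub>"
    "\<And>a z. a \<in> carrier A \<Longrightarrow> z \<in> Z \<Longrightarrow> length (snd (\<psi> (inl a) z)) \<le> Suc (length (snd z))"
    "\<And>b z. b \<in> carrier B \<Longrightarrow> z \<in> Z \<Longrightarrow> length (snd (\<psi> (inr b) z)) \<le> Suc (length (snd z))"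
    "\<And>a z. a \<in> carrier A \<Longrightarrow> f a \<notin> f ` H \<Longrightarrow> z \<in> Z \<Longrightarrow> snd z = [] \<or> \<not> isl (hd (snd z)) \<Longrightarrow>
      \<exists>t. snd (\<psi> (inl a) z) = Inl t # snd z"
    "\<And>b z. b \<in> carrier B \<Longrightarrow> g b \<notin> g ` K \<Longrightarrow> z \<in> Z \<Longrightarrow> snd z = [] \<or> isl (hd (snd z)) \<Longrightarrow>
      \<exists>t. snd (\<psi> (inr b) z) = Inr t # snd z"
proof -
  interpret f: group_hom A L f by (intro group_hom.intro group_hom_axioms.intro A.group_axioms L f)
  interpret g: group_hom B M g by (intro group_hom.intro group_hom_axioms.intro B.group_axioms M g)
  define U where "U = f ` H"
  define V where "V = g ` K"
  have U: "subgroup U L" unfolding U_def by (rule f.subgroup_img_is_subgroup[OF H])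
  have V: "subgroup V M" unfolding V_def by (rule g.subgroup_img_is_subgroup[OF K])
  have H_mult: "h \<otimes>\<^bsub>A\<^esub> k \<in> H" if "h \<in> H" "k \<in> H" for h k
    by (rule subgroup.m_closed[OF H that])
  have same: "f h = f k \<longleftrightarrow> g (\<phi> h) = g (\<phi> k)" if h: "h \<in> H" and k: "k \<in> H" for h k
  proof -
    have "f h = f k \<longleftrightarrow> f (inv\<^bsub>A\<^esub> h \<otimes>\<^bsub>A\<^esub> k) = \<one>\<^bsub>L\<^esub>"
      using h k by (auto simp: f.H.inv_solve_left')
    also have "\<dots> \<longleftrightarrow> g (inv\<^bsub>B\<^esub> (\<phi> h) \<otimes>\<^bsub>B\<^esub> \<phi> k) = \<one>\<^bsub>M\<^esub>"
      using ker[of "inv\<^bsub>A\<^esub> h \<otimes>\<^bsub>A\<^esub> k"] h k subgroup.m_inv_closed[OF H h] H_mult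
      by (simp add: phi_mult phi_inv)
    also have "\<dots> \<longleftrightarrow> g (\<phi> h) = g (\<phi> k)"
      using h k by (auto simp: g.H.inv_solve_left')
    finally show ?thesis .
  qed
  \<comment> \<open>Both labels of an element are the block of \<open>H\<close> that is mapped to it.\<close>
  define jL where "jL x = {h \<in> H. f h = x}" for x
  define jM where "jM y = {h \<in> H. g (\<phi> h) = y}" for y
  have jLM: "jL (f h) = jM (g (\<phi> h))" if "h \<in> H" for h
    using same that by (auto simp: jL_def jM_def)
  have jL: "inj_on jL U" by (auto simp: inj_on_def U_def jL_def)
  have jM: "inj_on jM V" by (auto simp: inj_on_def V_def jM_def simp flip: phi_image)
  have J: "jM ` V = jL ` U" using jLM by (auto simp: U_def V_def image_image simp flip: phi_image)
  define T\<^sub>L where "T\<^sub>L = coset_rep L U ` (carrier L - U)"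
  define T\<^sub>M where "T\<^sub>M = coset_rep M V ` (carrier M - V)"
  define Seq where "Seq = {s. successively (\<lambda>x y. isl x \<noteq> isl y) s \<and> set s \<subseteq> Inl ` T\<^sub>L \<union> Inr ` T\<^sub>M}"
  define S\<^sub>L where "S\<^sub>L = {s \<in> Seq. s = [] \<or> \<not> isl (hd s)}"
  define S\<^sub>M where "S\<^sub>M = {s \<in> Seq. s = [] \<or> isl (hd s)}"
  define Z where "Z = jL ` U \<times> Seq"
  have "Seq = S\<^sub>L \<union> {Inl t # s | t s. t \<in> T\<^sub>L \<and> s \<in> S\<^sub>L}"
  proof (intro equalityI subsetI)
    fix s assume s: "s \<in> Seq"
    show "s \<in> S\<^sub>L \<union> {Inl t # s | t s. t \<in> T\<^sub>L \<and> s \<in> S\<^sub>L}"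
    proof (cases "s \<in> S\<^sub>L")
      case False
      with s obtain x r where "s = x # r" "isl x" by (cases s) (auto simp: S\<^sub>L_def)
      with s show ?thesis by (auto simp: Seq_def S\<^sub>L_def successively_Cons)
    qed simp
  qed (auto simp: Seq_def S\<^sub>L_def successively_Cons)
  then have ZL: "Z = jL ` U \<times> (S\<^sub>L \<union> {Inl t # s | t s. t \<in> T\<^sub>L \<and> s \<in> S\<^sub>L})" by (simp add: Z_def)
  have "Seq = S\<^sub>M \<union> {Inr t # s | t s. t \<in> T\<^sub>M \<and> s \<in> S\<^sub>M}"
  proof (intro equalityI subsetI)
    fix s assume s: "s \<in> Seq"
    show "s \<in> S\<^sub>M \<union> {Inr t # s | t s. t \<in> T\<^sub>M \<and> s \<in> S\<^sub>M}"
    proof (cases "s \<in> S\<^sub>M")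
      case False
      with s obtain x r where "s = x # r" "\<not> isl x" by (cases s) (auto simp: S\<^sub>M_def)
      with s show ?thesis by (auto simp: Seq_def S\<^sub>M_def successively_Cons)
    qed simp
  qed (auto simp: Seq_def S\<^sub>M_def successively_Cons)
  then have ZM: "Z = jM ` V \<times> (S\<^sub>M \<union> {Inr t # s | t s. t \<in> T\<^sub>M \<and> s \<in> S\<^sub>M})" by (simp add: Z_def J)
  have "Inl t # s \<notin> S\<^sub>L" "Inr t' # s \<notin> S\<^sub>M" for t t' s by (simp_all add: S\<^sub>L_def S\<^sub>M_def)
  note notin = this
  obtain \<sigma> where \<sigma>: "acts_on L Z \<sigma>"
    and \<sigma>1: "\<And>x z. x \<in> carrier L \<Longrightarrow> z \<in> Z \<Longrightarrow> \<sigma> x z = z \<longleftrightarrow> x = \<one>\<^bsub>L\<^esub>"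
    and \<sigma>U: "\<And>u v r. u \<in> U \<Longrightarrow> v \<in> U \<Longrightarrow> (jL v, r) \<in> Z \<Longrightarrow> \<sigma> u (jL v, r) = (jL (u \<otimes>\<^bsub>L\<^esub> v), r)"
    and \<sigma>len: "\<And>x z. x \<in> carrier L \<Longrightarrow> z \<in> Z \<Longrightarrow> length (snd (\<sigma> x z)) \<le> Suc (length (snd z))"
    and \<sigma>new: "\<And>x z. x \<in> carrier L - U \<Longrightarrow> z \<in> Z \<Longrightarrow> snd z \<in> S\<^sub>L \<Longrightarrow> \<exists>t. snd (\<sigma> x z) = Inl t # snd z"
    using syllable_action[OF L U jL inj_Inl T\<^sub>L_def notin(1) ZL] by blast
  obtain \<tau> where \<tau>: "acts_on M Z \<tau>"
    and \<tau>1: "\<And>x z. x \<in> carrier M \<Longrightarrow> z \<in> Z \<Longrightarrow> \<tau> x z = z \<longleftrightarrow> x = \<one>\<^bsub>M\<^esub>"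
    and \<tau>V: "\<And>u v r. u \<in> V \<Longrightarrow> v \<in> V \<Longrightarrow> (jM v, r) \<in> Z \<Longrightarrow> \<tau> u (jM v, r) = (jM (u \<otimes>\<^bsub>M\<^esub> v), r)"
    and \<tau>len: "\<And>x z. x \<in> carrier M \<Longrightarrow> z \<in> Z \<Longrightarrow> length (snd (\<tau> x z)) \<le> Suc (length (snd z))"
    and \<tau>new: "\<And>x z. x \<in> carrier M - V \<Longrightarrow> z \<in> Z \<Longrightarrow> snd z \<in> S\<^sub>M \<Longrightarrow> \<exists>t. snd (\<tau> x z) = Inr t # snd z"
    using syllable_action[OF M V jM inj_Inr T\<^sub>M_def notin(2) ZM] by blast
  have "acts_on A Z (\<lambda>a. \<sigma> (f a))" "acts_on B Z (\<lambda>b. \<tau> (g b))"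
    using \<sigma> \<tau> by (simp_all add: acts_on_def)
  moreover have "\<sigma> (f h) z = \<tau> (g (\<phi> h)) z" if h: "h \<in> H" and z: "z \<in> Z" for h z
  proof -
    obtain k r where k: "k \<in> H" "z = (jL (f k), r)" using z by (auto simp: Z_def U_def)
    have "\<sigma> (f h) z = (jL (f (h \<otimes>\<^bsub>A\<^esub> k)), r)"
      using \<sigma>U[of "f h" "f k" r] h k z by (simp add: U_def)
    moreover have "\<tau> (g (\<phi> h)) z = (jM (g (\<phi> (h \<otimes>\<^bsub>A\<^esub> k))), r)"
      using \<tau>V[of "g (\<phi> h)" "g (\<phi> k)" r] h k z by (simp add: V_def jLM phi_mult)
    ultimately show ?thesis by (simp only: jLM[OF H_mult[OF h k(1)]])
  qed
  ultimately obtain \<psi> where \<psi>: "acts_on P Z \<psi>"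
    and \<psi>A: "\<And>a z. a \<in> carrier A \<Longrightarrow> z \<in> Z \<Longrightarrow> \<psi> (inl a) z = \<sigma> (f a) z"
    and \<psi>B: "\<And>b z. b \<in> carrier B \<Longrightarrow> z \<in> Z \<Longrightarrow> \<psi> (inr b) z = \<tau> (g b) z"
    using acts_on_amalg[of Z "\<lambda>a. \<sigma> (f a)" "\<lambda>b. \<tau> (g b)"] by blast
  have Z_snd: "snd z \<in> Seq" if "z \<in> Z" for z using that by (auto simp: Z_def)
  show ?thesis
  proof (rule that[OF \<psi>, of "(jL (f \<one>\<^bsub>A\<^esub>), [])"])
    show "(jL (f \<one>\<^bsub>A\<^esub>), []) \<in> Z"
      using subgroup.one_closed[OF H] by (simp add: Z_def U_def Seq_def del: f.hom_one)
  next
    fix a z assume "a \<in> carrier A" "f a \<notin> f ` H" "z \<in> Z" "snd z = [] \<or> \<not> isl (hd (snd z))"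
    then show "\<exists>t. snd (\<psi> (inl a) z) = Inl t # snd z"
      using \<sigma>new[of "f a" z] Z_snd by (simp add: \<psi>A S\<^sub>L_def U_def)
  next
    fix b z assume "b \<in> carrier B" "g b \<notin> g ` K" "z \<in> Z" "snd z = [] \<or> isl (hd (snd z))"
    then show "\<exists>t. snd (\<psi> (inr b) z) = Inr t # snd z"
      using \<tau>new[of "g b" z] Z_snd by (simp add: \<psi>B S\<^sub>M_def V_def)
  qed (simp_all add: \<psi>A \<psi>B \<sigma>1 \<tau>1 \<sigma>len \<tau>len)
qed

text \<open>
  The letter lies outside \<open>H R\<close> or outside \<open>K S\<close>, respectively: it remains outside the amalgamated
  subgroup in the quotient by \<open>(R, S)\<close>.
\<close>

definition syllable :: "'a set \<Rightarrow> 'b set \<Rightarrow> 'a + 'b \<Rightarrow> bool" where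
  "syllable R S x \<longleftrightarrow> (case x of
     Inl a \<Rightarrow> a \<in> carrier A \<and> (\<forall>h \<in> H. inv\<^bsub>A\<^esub> h \<otimes>\<^bsub>A\<^esub> a \<notin> R)
   | Inr b \<Rightarrow> b \<in> carrier B \<and> (\<forall>k \<in> K. inv\<^bsub>B\<^esub> k \<otimes>\<^bsub>B\<^esub> b \<notin> S))"

abbreviation alternating :: "('a + 'b) list \<Rightarrow> bool" where
  "alternating \<equiv> successively (\<lambda>x y. isl x \<noteq> isl y)"

end

text \<open>
  \<open>N\<close> plays the role of the kernel of the map from \<open>G\<close> onto the amalgam of \<open>A / R\<close> and \<open>B / S\<close>,
  and \<open>len\<close> that of the syllable length in this amalgam, read as a function on \<open>G\<close>.
\<close>

locale length_quotient = amalgamated_product A B H \<phi> K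
  for A :: "('a, 'm) monoid_scheme" and B :: "('b, 'n) monoid_scheme"
    and H :: "'a set" and \<phi> :: "'a \<Rightarrow> 'b" and K :: "'b set" +
  fixes R :: "'a set" and S :: "'b set" and N :: "('a + 'b) list set set"
    and len :: "('a + 'b) list set \<Rightarrow> nat"
  assumes RS: "(R, S) \<in> Omega A B H K \<phi>"
    and N: "N \<lhd> P"
    and inl_N: "\<And>a. a \<in> carrier A \<Longrightarrow> inl a \<in> N \<longleftrightarrow> a \<in> R"
    and inr_N: "\<And>b. b \<in> carrier B \<Longrightarrow> inr b \<in> N \<longleftrightarrow> b \<in> S"
    and len_cong: "\<And>u v. u \<in> carrier P \<Longrightarrow> v \<in> carrier P \<Longrightarrow> inv\<^bsub>P\<^esub> u \<otimes>\<^bsub>P\<^esub> v \<in> N \<Longrightarrow> len u = len v"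
    and len_le: "\<And>w. w \<in> W \<Longrightarrow> len (cls w) \<le> length w"
    and len_reduced: "\<And>w. alternating w \<Longrightarrow> \<forall>x \<in> set w. syllable R S x \<Longrightarrow> len (cls w) = length w"

context amalgamated_product
begin

text \<open>
  Apply the action on normal forms to \<open>A \<rightarrow> A / R\<close> and \<open>B \<rightarrow> B / S\<close>; compatibility of \<open>R\<close> and \<open>S\<close> is
  exactly the condition on the kernels. \<open>N\<close> is the kernel of the resulting action of \<open>G\<close>, and the
  length of \<open>u\<close> is the number of syllables of the image of the empty normal form under \<open>u\<close>.
\<close>

lemma length_quotient_exists:
  assumes RS: "(R, S) \<in> Omega A B H K \<phi>"
  shows "\<exists>N len. length_quotient A B H \<phi> K R S N len"
proof -
  interpret R: normal R A using RS by (simp add: Omega_def normal_finite_index_def)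
  interpret S: normal S B using RS by (simp add: Omega_def normal_finite_index_def)
  have comp: "compatible H K \<phi> R S" using RS by (simp add: Omega_def)
  define f where "f a = R #>\<^bsub>A\<^esub> a" for a
  define g where "g b = S #>\<^bsub>B\<^esub> b" for b
  have f: "f \<in> hom A (A Mod R)" and g: "g \<in> hom B (B Mod S)"
    using R.r_coset_hom_Mod S.r_coset_hom_Mod by (simp_all add: f_def[abs_def] g_def[abs_def])
  have f_eq: "f a = f b \<longleftrightarrow> inv\<^bsub>A\<^esub> a \<otimes>\<^bsub>A\<^esub> b \<in> R" if "a \<in> carrier A" "b \<in> carrier A" for a b
    using A.l_coset_eq_iff[OF R.is_subgroup that] R.coset_eq that by (simp add: f_def)
  have g_eq: "g a = g b \<longleftrightarrow> inv\<^bsub>B\<^esub> a \<otimes>\<^bsub>B\<^esub> b \<in> S" if "a \<in> carrier B" "b \<in> carrier B" for a b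
    using B.l_coset_eq_iff[OF S.is_subgroup that] S.coset_eq that by (simp add: g_def)
  have f1: "f a = \<one>\<^bsub>A Mod R\<^esub> \<longleftrightarrow> a \<in> R" if "a \<in> carrier A" for a
    using f_eq[of "\<one>\<^bsub>A\<^esub>" a] that R.subset by (auto simp: f_def)
  have g1: "g b = \<one>\<^bsub>B Mod S\<^esub> \<longleftrightarrow> b \<in> S" if "b \<in> carrier B" for b
    using g_eq[of "\<one>\<^bsub>B\<^esub>" b] that S.subset by (auto simp: g_def)
  have ker: "f h = \<one>\<^bsub>A Mod R\<^esub> \<longleftrightarrow> g (\<phi> h) = \<one>\<^bsub>B Mod S\<^esub>" if "h \<in> H" for h
    using that compatible_iff[OF comp that] by (simp add: f1 g1 del: one_FactGroup)
  obtain Z :: "('a set \<times> ('a set + 'b set) list) set" and \<psi> \<epsilon>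
    where \<psi>: "acts_on P Z \<psi>" and \<epsilon>: "\<epsilon> \<in> Z" "snd \<epsilon> = []"
      and \<psi>A: "\<And>a z. a \<in> carrier A \<Longrightarrow> z \<in> Z \<Longrightarrow> \<psi> (inl a) z = z \<longleftrightarrow> f a = \<one>\<^bsub>A Mod R\<^esub>"
      and \<psi>B: "\<And>b z. b \<in> carrier B \<Longrightarrow> z \<in> Z \<Longrightarrow> \<psi> (inr b) z = z \<longleftrightarrow> g b = \<one>\<^bsub>B Mod S\<^esub>"
      and lenA: "\<And>a z. a \<in> carrier A \<Longrightarrow> z \<in> Z \<Longrightarrow> length (snd (\<psi> (inl a) z)) \<le> Suc (length (snd z))"
      and lenB: "\<And>b z. b \<in> carrier B \<Longrightarrow> z \<in> Z \<Longrightarrow> length (snd (\<psi> (inr b) z)) \<le> Suc (length (snd z))"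
      and newA: "\<And>a z. a \<in> carrier A \<Longrightarrow> f a \<notin> f ` H \<Longrightarrow> z \<in> Z \<Longrightarrow> snd z = [] \<or> \<not> isl (hd (snd z)) \<Longrightarrow>
        \<exists>t. snd (\<psi> (inl a) z) = Inl t # snd z"
      and newB: "\<And>b z. b \<in> carrier B \<Longrightarrow> g b \<notin> g ` K \<Longrightarrow> z \<in> Z \<Longrightarrow> snd z = [] \<or> isl (hd (snd z)) \<Longrightarrow>
        \<exists>t. snd (\<psi> (inr b) z) = Inr t # snd z"
    using normal_form_action[OF R.factorgroup_is_group S.factorgroup_is_group f g ker] by blast
  define N where "N = {u \<in> carrier P. \<forall>z \<in> Z. \<psi> u z = z}"
  define len where "len u = length (snd (\<psi> u \<epsilon>))" for u
  have \<psi>_cl: "\<psi> u z \<in> Z" if "u \<in> carrier P" "z \<in> Z" for u z by (rule acts_on_closed[OF \<psi> that])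
  have N: "subgroup N P"
  proof (rule P.subgroupI)
    show "N \<noteq> {}" using acts_on_one[OF \<psi>] P.one_closed by (auto simp: N_def)
    show "inv\<^bsub>P\<^esub> u \<in> N" if "u \<in> N" for u
      using that acts_on_inv(1)[OF group_P \<psi>, of u] by (simp add: N_def)
  qed (use acts_on_mult[OF \<psi>] in \<open>auto simp: N_def\<close>)
  have normal: "N \<lhd> P"
  proof (rule P.normal_inv_iff[THEN iffD2], intro conjI N ballI)
    fix x n assume "x \<in> carrier P" "n \<in> N"
    then show "x \<otimes>\<^bsub>P\<^esub> n \<otimes>\<^bsub>P\<^esub> inv\<^bsub>P\<^esub> x \<in> N"
      by (simp add: N_def acts_on_mult[OF \<psi>] \<psi>_cl acts_on_inv(2)[OF group_P \<psi>])
  qed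
  have NA: "inl a \<in> N \<longleftrightarrow> a \<in> R" if "a \<in> carrier A" for a
    using \<psi>A[OF that, unfolded f1[OF that]] \<epsilon>(1) that unfolding N_def by fastforce
  have NB: "inr b \<in> N \<longleftrightarrow> b \<in> S" if "b \<in> carrier B" for b
    using \<psi>B[OF that, unfolded g1[OF that]] \<epsilon>(1) that unfolding N_def by fastforce
  have len_N: "len u = len v"
    if "u \<in> carrier P" "v \<in> carrier P" "inv\<^bsub>P\<^esub> u \<otimes>\<^bsub>P\<^esub> v \<in> N" for u v
    using that acts_on_eq_iff[OF group_P \<psi> that(1,2) \<epsilon>(1)] \<epsilon>(1) by (simp add: len_def N_def)
  have step: "\<psi> (cls (x # w)) \<epsilon> = \<psi> (cls [x]) (\<psi> (cls w) \<epsilon>)" "\<psi> (cls w) \<epsilon> \<in> Z"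
    if "x \<in> carrier A <+> carrier B" "w \<in> W" for x w
  proof -
    have "cls [x] \<in> carrier P" "cls w \<in> carrier P" using that by simp_all
    then show "\<psi> (cls (x # w)) \<epsilon> = \<psi> (cls [x]) (\<psi> (cls w) \<epsilon>)" "\<psi> (cls w) \<epsilon> \<in> Z"
      using acts_on_mult[OF \<psi>, of "cls [x]" "cls w" \<epsilon>] \<psi>_cl \<epsilon>(1)
      by (simp_all add: cls_Cons[OF that])
  qed
  have nil: "\<psi> (cls []) \<epsilon> = \<epsilon>" using acts_on_one[OF \<psi> \<epsilon>(1)] by (simp flip: one_P)
  have len_le: "len (cls w) \<le> length w" if "w \<in> W" for w
    using that
  proof (induction w rule: list.induct)
    case Nil
    show ?case by (simp add: len_def nil \<epsilon>)
  next
    case (Cons x w)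
    then have x: "x \<in> carrier A <+> carrier B" and w: "w \<in> W" by auto
    have "len (cls (x # w)) \<le> len (cls w) + 1"
      using x lenA lenB step[OF x w] by (cases rule: letter_class_cases) (auto simp: len_def)
    with Cons.IH[OF w] show ?case by simp
  qed
  have len_eq: "len (cls w) = length w" if w: "alternating w" "\<forall>x \<in> set w. syllable R S x" for w
  proof -
    have new_left: "f a \<notin> f ` H" if "syllable R S (Inl a)" for a
    proof
      assume "f a \<in> f ` H"
      then obtain h where "h \<in> H" "f h = f a" by auto
      with that show False by (auto simp: syllable_def f_eq)
    qed
    have new_right: "g b \<notin> g ` K" if "syllable R S (Inr b)" for b
    proof
      assume "g b \<in> g ` K"
      then obtain k where "k \<in> K" "g k = g b" by auto
      with that show False by (auto simp: syllable_def g_eq)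
    qed
    have in_W: "w \<in> W" if "\<forall>x \<in> set w. syllable R S x" for w
    proof -
      have "x \<in> carrier A <+> carrier B" if "syllable R S x" for x
        using that by (auto simp: syllable_def split: sum.splits)
      with that show ?thesis by auto
    qed
    have "length (snd (\<psi> (cls w) \<epsilon>)) = length w \<and>
        (w \<noteq> [] \<longrightarrow> isl (hd (snd (\<psi> (cls w) \<epsilon>))) = isl (hd w))"
      using w
    proof (induction w rule: list.induct)
      case Nil
      show ?case by (simp add: nil \<epsilon>)
    next
      case (Cons x w)
      then have w: "alternating w" "\<forall>x \<in> set w. syllable R S x"
        and x: "w \<noteq> [] \<Longrightarrow> isl x \<noteq> isl (hd w)" "syllable R S x" by (auto simp: successively_Cons)
      have xW: "x \<in> carrier A <+> carrier B" and wW: "w \<in> W"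
        using in_W[OF Cons.prems(2)] by auto
      have IH: "length (snd (\<psi> (cls w) \<epsilon>)) = length w"
        "w \<noteq> [] \<Longrightarrow> isl (hd (snd (\<psi> (cls w) \<epsilon>))) = isl (hd w)" using Cons.IH w by auto
      then have hd: "snd (\<psi> (cls w) \<epsilon>) = [] \<or> isl (hd (snd (\<psi> (cls w) \<epsilon>))) \<noteq> isl x"
        using x(1) by (cases "w = []") auto
      from xW show ?case
      proof (cases rule: letter_class_cases)
        case (left a)
        then obtain t where "snd (\<psi> (cls (x # w)) \<epsilon>) = Inl t # snd (\<psi> (cls w) \<epsilon>)"
          using newA[OF _ new_left, of a "\<psi> (cls w) \<epsilon>"] step[OF xW wW] x(2) hd by auto
        with IH(1) left show ?thesis by simp
      next
        case (right b)
        then obtain t where "snd (\<psi> (cls (x # w)) \<epsilon>) = Inr t # snd (\<psi> (cls w) \<epsilon>)"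
          using newB[OF _ new_right, of b "\<psi> (cls w) \<epsilon>"] step[OF xW wW] x(2) hd by auto
        with IH(1) right show ?thesis by simp
      qed
    qed
    then show ?thesis by (simp add: len_def)
  qed
  have "length_quotient A B H \<phi> K R S N len"
    by (intro length_quotient.intro length_quotient_axioms.intro amalgamated_product_axioms)
      (fact RS normal NA NB len_N len_le len_eq)+
  then show ?thesis by blast
qed

end

section \<open>Normal subgroups of finite index that avoid given elements\<close>

lemma normal_finite_index_carrier:
  assumes "group \<Gamma>"
  shows "normal_finite_index (carrier \<Gamma>) \<Gamma>"
proof -
  interpret group \<Gamma> by fact
  have "carrier \<Gamma> \<lhd> \<Gamma>" by (simp add: normal_inv_iff subgroup_self)
  moreover have "rcosets\<^bsub>\<Gamma>\<^esub> (carrier \<Gamma>) \<subseteq> {carrier \<Gamma>}"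
    by (auto simp: RCOSETS_def coset_join2 subgroup_self)
  ultimately show ?thesis using finite_subset by (auto simp: normal_finite_index_def)
qed

lemma normal_finite_index_Int:
  assumes "group \<Gamma>" "normal_finite_index M \<Gamma>" "normal_finite_index N \<Gamma>"
  shows "normal_finite_index (M \<inter> N) \<Gamma>"
proof -
  interpret group \<Gamma> by fact
  have M: "M \<lhd> \<Gamma>" and N: "N \<lhd> \<Gamma>" and fin: "finite ((rcosets\<^bsub>\<Gamma>\<^esub> M) \<times> (rcosets\<^bsub>\<Gamma>\<^esub> N))"
    using assms by (simp_all add: normal_finite_index_def)
  have sub: "M \<subseteq> carrier \<Gamma>" "N \<subseteq> carrier \<Gamma>"
    using M N by (auto dest: normal_imp_subgroup subgroup.subset)
  have "rcosets\<^bsub>\<Gamma>\<^esub> (M \<inter> N) \<subseteq> (\<lambda>(C, D). C \<inter> D) ` ((rcosets\<^bsub>\<Gamma>\<^esub> M) \<times> (rcosets\<^bsub>\<Gamma>\<^esub> N))"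
  proof
    fix E assume "E \<in> rcosets\<^bsub>\<Gamma>\<^esub> (M \<inter> N)"
    then obtain x where x: "x \<in> carrier \<Gamma>" "E = (M \<inter> N) #>\<^bsub>\<Gamma>\<^esub> x" by (auto simp: RCOSETS_def)
    have "E = (M #>\<^bsub>\<Gamma>\<^esub> x) \<inter> (N #>\<^bsub>\<Gamma>\<^esub> x)"
      using x sub by (auto simp: r_coset_def subset_iff)
    moreover have "M #>\<^bsub>\<Gamma>\<^esub> x \<in> rcosets\<^bsub>\<Gamma>\<^esub> M" "N #>\<^bsub>\<Gamma>\<^esub> x \<in> rcosets\<^bsub>\<Gamma>\<^esub> N"
      using rcosetsI x sub by auto
    ultimately show "E \<in> (\<lambda>(C, D). C \<inter> D) ` ((rcosets\<^bsub>\<Gamma>\<^esub> M) \<times> (rcosets\<^bsub>\<Gamma>\<^esub> N))" by force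
  qed
  then have "finite (rcosets\<^bsub>\<Gamma>\<^esub> (M \<inter> N))" using fin finite_surj by blast
  then show ?thesis using normal_subgroup_intersect[OF M N] by (simp add: normal_finite_index_def)
qed

text \<open>
  \<open>M\<close> is the kernel of a finite quotient that separates \<open>g\<close> from \<open>F\<close>.
\<close>

lemma finitely_separable_avoid:
  assumes \<Gamma>: "group \<Gamma>" and F: "finitely_separable \<Gamma> F" and g: "g \<in> carrier \<Gamma> - F"
  shows "\<exists>M. normal_finite_index M \<Gamma> \<and> (\<forall>f \<in> F. inv\<^bsub>\<Gamma>\<^esub> f \<otimes>\<^bsub>\<Gamma>\<^esub> g \<notin> M)"
proof -
  have Fs: "F \<subseteq> carrier \<Gamma>" using F by (auto simp: finitely_separable_def dest: subgroup.subset)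
  obtain Q :: "nat monoid" and \<psi> where Q: "group Q" "finite (carrier Q)"
    and \<psi>: "\<psi> \<in> epi \<Gamma> Q" and sep: "\<psi> g \<notin> \<psi> ` F"
    using F g unfolding finitely_separable_def by blast
  have hom: "\<psi> \<in> hom \<Gamma> Q" and surj: "\<psi> ` carrier \<Gamma> = carrier Q"
    using \<psi> by (auto simp: epi_def)
  interpret \<psi>: group_hom \<Gamma> Q \<psi> by (intro group_hom.intro group_hom_axioms.intro \<Gamma> Q hom)
  let ?M = "kernel \<Gamma> Q \<psi>"
  have "bij_betw (\<lambda>X. the_elem (\<psi> ` X)) (carrier (\<Gamma> Mod ?M)) (carrier Q)"
    using \<psi>.FactGroup_iso_set[OF surj] by (simp add: iso_def)
  then have "finite (rcosets\<^bsub>\<Gamma>\<^esub> ?M)"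
    using Q(2) bij_betw_finite by (auto simp: FactGroup_def)
  then have "normal_finite_index ?M \<Gamma>"
    using \<psi>.normal_kernel by (simp add: normal_finite_index_def)
  moreover have "inv\<^bsub>\<Gamma>\<^esub> f \<otimes>\<^bsub>\<Gamma>\<^esub> g \<notin> ?M" if f: "f \<in> F" for f
  proof
    assume "inv\<^bsub>\<Gamma>\<^esub> f \<otimes>\<^bsub>\<Gamma>\<^esub> g \<in> ?M"
    with f Fs g have "\<psi> g = \<psi> f"
      by (auto simp: kernel_def \<psi>.H.inv_solve_left' subset_iff)
    with sep f show False by blast
  qed
  ultimately show ?thesis by blast
qed

lemma finitely_separable_avoid_many:
  assumes \<Gamma>: "group \<Gamma>" and "finite I"
    and "\<And>F g. (F, g) \<in> I \<Longrightarrow> finitely_separable \<Gamma> F \<and> g \<in> carrier \<Gamma> - F"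
  shows "\<exists>M. normal_finite_index M \<Gamma> \<and> (\<forall>F g f. (F, g) \<in> I \<longrightarrow> f \<in> F \<longrightarrow> inv\<^bsub>\<Gamma>\<^esub> f \<otimes>\<^bsub>\<Gamma>\<^esub> g \<notin> M)"
  using assms(2,3)
proof (induction I rule: finite_induct)
  case empty
  then show ?case using normal_finite_index_carrier[OF \<Gamma>] by auto
next
  case (insert p I)
  obtain F g where p: "p = (F, g)" by (cases p)
  from insert.IH insert.prems obtain M where M: "normal_finite_index M \<Gamma>"
    "\<And>F g f. (F, g) \<in> I \<Longrightarrow> f \<in> F \<Longrightarrow> inv\<^bsub>\<Gamma>\<^esub> f \<otimes>\<^bsub>\<Gamma>\<^esub> g \<notin> M"
    by (metis insertI2)
  obtain N where N: "normal_finite_index N \<Gamma>" "\<And>f. f \<in> F \<Longrightarrow> inv\<^bsub>\<Gamma>\<^esub> f \<otimes>\<^bsub>\<Gamma>\<^esub> g \<notin> N"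
    using insert.prems[of F g] finitely_separable_avoid[OF \<Gamma>, of F g] p by blast
  show ?case
  proof (intro exI[of _ "M \<inter> N"] conjI allI impI)
    show "normal_finite_index (M \<inter> N) \<Gamma>" by (rule normal_finite_index_Int[OF \<Gamma> M(1) N(1)])
  next
    fix F' g' f assume "(F', g') \<in> insert p I" "f \<in> F'"
    then show "inv\<^bsub>\<Gamma>\<^esub> f \<otimes>\<^bsub>\<Gamma>\<^esub> g' \<notin> M \<inter> N" using M(2)[of F' g' f] N(2)[of f] p by auto
  qed
qed

section \<open>Reduced and cyclically reduced words\<close>

context amalgamated_product
begin

definition proper :: "'a + 'b \<Rightarrow> bool" where
  "proper x \<longleftrightarrow> (case x of Inl a \<Rightarrow> a \<in> carrier A - H | Inr b \<Rightarrow> b \<in> carrier B - K)"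

lemma cls_pair:
  "x \<in> carrier A <+> carrier B \<Longrightarrow> y \<in> carrier A <+> carrier B \<Longrightarrow> cls [x, y] = cls [x] \<otimes>\<^bsub>P\<^esub> cls [y]"
  by (rule cls_Cons) auto

lemma letter_closed [simp]: "x \<in> carrier A <+> carrier B \<Longrightarrow> cls [x] \<in> carrier P"
  by simp

lemma merge_letters:
  assumes "x \<in> carrier A <+> carrier B" "y \<in> carrier A <+> carrier B" "isl x = isl y"
  obtains z where "z \<in> carrier A <+> carrier B" "isl z = isl x" "cls [z] = cls [x] \<otimes>\<^bsub>P\<^esub> cls [y]"
  using assms(1)
proof (cases rule: letter_class_cases)
  case (left a)
  with assms obtain b where b: "b \<in> carrier A" "y = Inl b" by auto
  with left that[of "Inl (a \<otimes>\<^bsub>A\<^esub> b)"] show ?thesis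
    by (auto simp: inl.hom_mult simp flip: amalg_inl_def)
next
  case (right a)
  with assms obtain b where b: "b \<in> carrier B" "y = Inr b" by auto
  with right that[of "Inr (a \<otimes>\<^bsub>B\<^esub> b)"] show ?thesis
    by (auto simp: inr.hom_mult simp flip: amalg_inr_def)
qed

lemma inverse_letter:
  assumes "x \<in> carrier A <+> carrier B"
  obtains y where "y \<in> carrier A <+> carrier B" "isl y = isl x" "cls [y] = inv\<^bsub>P\<^esub> (cls [x])"
    "proper y \<longleftrightarrow> proper x"
  using assms
proof (cases rule: letter_class_cases)
  case (left a)
  have "inv\<^bsub>A\<^esub> a \<in> H \<longleftrightarrow> a \<in> H"
    using left(1) subgroup.m_inv_closed[OF H] A.inv_inv by metis
  with left that[of "Inl (inv\<^bsub>A\<^esub> a)"] show ?thesis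
    by (auto simp: inl.hom_inv proper_def simp flip: amalg_inl_def)
next
  case (right b)
  have "inv\<^bsub>B\<^esub> b \<in> K \<longleftrightarrow> b \<in> K"
    using right(1) subgroup.m_inv_closed[OF K] B.inv_inv by metis
  with right that[of "Inr (inv\<^bsub>B\<^esub> b)"] show ?thesis
    by (auto simp: inr.hom_inv proper_def simp flip: amalg_inr_def)
qed

lemma swap_letter:
  assumes "x \<in> carrier A <+> carrier B" "\<not> proper x"
  obtains y where "y \<in> carrier A <+> carrier B" "isl y \<noteq> isl x" "cls [y] = cls [x]" "\<not> proper y"
  using assms(1)
proof (cases rule: letter_class_cases)
  case (left a)
  with assms have "a \<in> H" by (simp add: proper_def)
  then have "Inr (\<phi> a) \<in> carrier A <+> carrier B" by (intro InrI) simp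
  with left \<open>a \<in> H\<close> that[of "Inr (\<phi> a)"] show ?thesis
    using inl_eq_inr[of a] by (auto simp: proper_def simp flip: amalg_inr_def)
next
  case (right b)
  with assms have "b \<in> K" by (simp add: proper_def)
  then obtain h where "h \<in> H" "b = \<phi> h" using phi_image by blast
  then have "Inl h \<in> carrier A <+> carrier B" by (intro InlI) simp
  with right \<open>h \<in> H\<close> \<open>b = \<phi> h\<close> that[of "Inl h"] show ?thesis
    using inl_eq_inr[of h] by (auto simp: proper_def simp flip: amalg_inl_def)
qed

lemma power_letter:
  assumes "x \<in> carrier A <+> carrier B"
  obtains y where "y \<in> carrier A <+> carrier B" "isl y = isl x" "cls [y] = cls [x] [^]\<^bsub>P\<^esub> (k :: nat)"
  using assms
proof (cases rule: letter_class_cases)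
  case (left a)
  with that[of "Inl (a [^]\<^bsub>A\<^esub> k)"] show ?thesis
    by (auto simp: inl.hom_nat_pow simp flip: amalg_inl_def)
next
  case (right b)
  with that[of "Inr (b [^]\<^bsub>B\<^esub> k)"] show ?thesis
    by (auto simp: inr.hom_nat_pow simp flip: amalg_inr_def)
qed

text \<open>
  A letter from the amalgamated subgroup can be moved to the other factor, where it is absorbed by
  its neighbour.
\<close>

lemma shorten_pair:
  assumes x: "x \<in> carrier A <+> carrier B" and y: "y \<in> carrier A <+> carrier B"
    and "\<not> (isl x \<noteq> isl y \<and> proper x \<and> proper y)"
  obtains z where "z \<in> carrier A <+> carrier B" "cls [z] = cls [x, y]"
proof (cases "isl x = isl y")
  case True
  with merge_letters[OF x y] that show ?thesis by (metis cls_pair x y)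
next
  case False
  with assms(3) consider "\<not> proper x" | "\<not> proper y" by blast
  then show ?thesis
  proof cases
    case 1
    then obtain x' where "x' \<in> carrier A <+> carrier B" "isl x' \<noteq> isl x" "cls [x'] = cls [x]"
      using swap_letter[OF x] by metis
    with False merge_letters[OF _ y] that show ?thesis by (metis cls_pair x y)
  next
    case 2
    then obtain y' where "y' \<in> carrier A <+> carrier B" "isl y' \<noteq> isl y" "cls [y'] = cls [y]"
      using swap_letter[OF y] by metis
    with False merge_letters[OF x] that show ?thesis by (metis cls_pair x y)
  qed
qed

lemma shortest_word_pair:
  assumes w: "p @ x # y # q \<in> W"
    and short: "\<And>v. v \<in> W \<Longrightarrow> cls v = cls (p @ x # y # q) \<Longrightarrow> length (p @ x # y # q) \<le> length v"
  shows "isl x \<noteq> isl y \<and> proper x \<and> proper y"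
proof (rule ccontr)
  assume "\<not> ?thesis"
  moreover have x: "x \<in> carrier A <+> carrier B" "y \<in> carrier A <+> carrier B" and p: "p \<in> W" "q \<in> W"
    using w by auto
  ultimately obtain z where z: "z \<in> carrier A <+> carrier B" "cls [z] = cls [x, y]"
    using shorten_pair by metis
  have W: "[x, y] \<in> W" "[z] \<in> W" "[x, y] @ q \<in> W" "[z] @ q \<in> W" "p @ z # q \<in> W"
    using x z p by auto
  have "cls (p @ z # q) = cls p \<otimes>\<^bsub>P\<^esub> (cls [z] \<otimes>\<^bsub>P\<^esub> cls q)"
    using mult_class[OF W(2) p(2)] mult_class[OF p(1) W(4)] by simp
  also have "\<dots> = cls (p @ x # y # q)"
    using mult_class[OF W(1) p(2)] mult_class[OF p(1) W(3)] by (simp add: z(2))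
  finally show False using short[OF W(5)] by simp
qed

end

lemma successively_if_pairs:
  assumes "\<And>p x y q. w = p @ x # y # q \<Longrightarrow> Q x y"
  shows "successively Q w"
  using assms
proof (induction w)
  case (Cons x w)
  have "successively Q w" by (rule Cons.IH) (use Cons.prems[of "x # _"] in auto)
  moreover have "w \<noteq> [] \<Longrightarrow> Q x (hd w)" using Cons.prems[of "[]" x "hd w" "tl w"] by simp
  ultimately show ?case by (auto simp: successively_Cons)
qed simp

lemma all_if_pairs:
  assumes "\<And>p x y q. w = p @ x # y # q \<Longrightarrow> Q x \<and> Q y" and "length w \<ge> 2"
  shows "\<forall>x \<in> set w. Q x"
proof
  fix x assume "x \<in> set w"
  then obtain p q where w: "w = p @ x # q" using split_list by metis
  show "Q x"
  proof (cases q)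
    case (Cons y r)
    then show ?thesis using assms(1)[of p x y r] w by simp
  next
    case Nil
    then have "p \<noteq> []" using w assms(2) by auto
    then have "w = butlast p @ last p # x # []" using w Nil by simp
    then show ?thesis using assms(1) by blast
  qed
qed

context amalgamated_product
begin

text \<open>
  In a word of minimal length no two neighbours can be replaced by one letter.
\<close>

lemma shortest_word_reduced:
  assumes w: "w \<in> W" and short: "\<And>v. v \<in> W \<Longrightarrow> cls v = cls w \<Longrightarrow> length w \<le> length v"
    and len: "length w \<ge> 2"
  shows "alternating w" "\<forall>x \<in> set w. proper x"
proof -
  have pair: "isl x \<noteq> isl y \<and> proper x \<and> proper y" if "w = p @ x # y # q" for p x y q
    using shortest_word_pair[of p x y q] w short that by blast
  show "alternating w" using pair by (intro successively_if_pairs) blast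
  show "\<forall>x \<in> set w. proper x" by (rule all_if_pairs[OF _ len]) (use pair in blast)
qed

lemma reduced_word:
  assumes "g \<in> carrier P"
  obtains w where "w \<in> W" "cls w = g" "length w \<le> 1 \<or> alternating w \<and> (\<forall>x \<in> set w. proper x)"
proof -
  obtain w where w: "w \<in> W" "cls w = g" and
    short: "\<And>v. v \<in> W \<and> cls v = g \<Longrightarrow> length w \<le> length v"
    using ex_has_least_nat[of "\<lambda>w. w \<in> W \<and> cls w = g" _ length] word_of[OF assms] by metis
  show ?thesis
  proof (cases "length w \<ge> 2")
    case True
    with shortest_word_reduced[OF w(1)] short w that show ?thesis by metis
  next
    case False
    with w that show ?thesis by simp
  qed
qed

text \<open>
  Choose a shortest word among all words that represent conjugates of \<open>c\<close>. Its rotation by one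
  letter represents another conjugate, so it is reduced too, and this compares the last letter of
  the word with the first.
\<close>

lemma cyclically_reduced_word:
  assumes c: "c \<in> carrier P"
  obtains w y where "w \<in> W" "y \<in> carrier P" "cls w = y \<otimes>\<^bsub>P\<^esub> c \<otimes>\<^bsub>P\<^esub> inv\<^bsub>P\<^esub> y"
    "length w \<le> 1 \<or> alternating w \<and> (\<forall>x \<in> set w. proper x) \<and> isl (last w) \<noteq> isl (hd w)"
proof -
  define conj where "conj w \<longleftrightarrow> w \<in> W \<and> (\<exists>y \<in> carrier P. cls w = y \<otimes>\<^bsub>P\<^esub> c \<otimes>\<^bsub>P\<^esub> inv\<^bsub>P\<^esub> y)" for w
  obtain w\<^sub>0 where w0: "w\<^sub>0 \<in> W" "c = cls w\<^sub>0" using word_of[OF c] .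
  have "cls w\<^sub>0 = \<one>\<^bsub>P\<^esub> \<otimes>\<^bsub>P\<^esub> c \<otimes>\<^bsub>P\<^esub> inv\<^bsub>P\<^esub> \<one>\<^bsub>P\<^esub>" using c w0(2) by simp
  then have "conj w\<^sub>0" unfolding conj_def using w0(1) P.one_closed by blast
  then obtain w where w: "conj w" and short: "\<And>v. conj v \<Longrightarrow> length w \<le> length v"
    using ex_has_least_nat[of conj w\<^sub>0 length] by blast
  from w obtain y where wW: "w \<in> W" and y: "y \<in> carrier P" "cls w = y \<otimes>\<^bsub>P\<^esub> c \<otimes>\<^bsub>P\<^esub> inv\<^bsub>P\<^esub> y"
    by (auto simp only: conj_def)
  show ?thesis
  proof (cases "length w \<ge> 2")
    case True
    have same: "conj v" if "v \<in> W" "cls v = cls w" for v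
      using that y by (auto simp only: conj_def)
    have red: "alternating w" "\<forall>x \<in> set w. proper x"
      using shortest_word_reduced[OF wW short[OF same] True] by blast+
    obtain x u where "w = x # u" using True by (cases w) auto
    then have xu: "w = x # u" "u \<noteq> []" using True by auto
    have x: "x \<in> carrier A <+> carrier B" and u: "u \<in> W" using wW xu by auto
    have ux: "u @ [x] \<in> W" "[x] \<in> W" using x u by auto
    have cx: "cls [x] \<in> carrier P" "cls u \<in> carrier P" using ux u by simp_all
    have "cls (u @ [x]) = cls u \<otimes>\<^bsub>P\<^esub> cls [x]" using mult_class[OF u ux(2)] by simp
    also have "\<dots> = inv\<^bsub>P\<^esub> (cls [x]) \<otimes>\<^bsub>P\<^esub> cls w \<otimes>\<^bsub>P\<^esub> cls [x]"
      using cx by (simp add: xu cls_Cons[OF x u] flip: P.m_assoc)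
    also have "\<dots> = (inv\<^bsub>P\<^esub> (cls [x]) \<otimes>\<^bsub>P\<^esub> y) \<otimes>\<^bsub>P\<^esub> c \<otimes>\<^bsub>P\<^esub> inv\<^bsub>P\<^esub> (inv\<^bsub>P\<^esub> (cls [x]) \<otimes>\<^bsub>P\<^esub> y)"
      using cx y c by (simp add: P.inv_mult_group P.m_assoc)
    finally have rot: "cls (u @ [x]) =
      (inv\<^bsub>P\<^esub> (cls [x]) \<otimes>\<^bsub>P\<^esub> y) \<otimes>\<^bsub>P\<^esub> c \<otimes>\<^bsub>P\<^esub> inv\<^bsub>P\<^esub> (inv\<^bsub>P\<^esub> (cls [x]) \<otimes>\<^bsub>P\<^esub> y)" .
    have "conj v" if "v \<in> W" "cls v = cls (u @ [x])" for v
      unfolding conj_def using that rot cx y by (metis P.inv_closed P.m_closed)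
    then have "alternating (u @ [x])"
      using shortest_word_reduced(1)[OF ux(1)] short True xu(1) by simp
    then have "isl (last w) \<noteq> isl (hd w)"
      using xu by (auto simp: successively_append_iff)
    with red that[OF wW y] show ?thesis by blast
  next
    case False
    with that[OF wW y] show ?thesis by simp
  qed
qed

end

section \<open>Factors modulo a compatible pair\<close>

context length_quotient
begin

sublocale N: normal N P by (rule N)

lemma len_N: "u \<in> N \<Longrightarrow> len u = 0"
  using len_cong[of "\<one>\<^bsub>P\<^esub>" u] len_le[of "[]"] by (simp flip: one_P)

lemma reduced_notin_N:
  assumes "alternating w" "\<forall>x \<in> set w. syllable R S x" "w \<noteq> []"
  shows "cls w \<notin> N"
  using len_reduced[OF assms(1,2)] len_N assms(3) by force

lemma N_conj:
  assumes u: "u \<in> carrier P" and v: "v \<in> carrier P" and uv: "u \<otimes>\<^bsub>P\<^esub> v \<in> N"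
  shows "v \<otimes>\<^bsub>P\<^esub> u \<in> N"
  using N.inv_op_closed1[OF u uv] u v by (simp flip: P.m_assoc)

lemma N_inv:
  assumes u: "u \<in> carrier P" and v: "v \<in> carrier P" and uv: "inv\<^bsub>P\<^esub> u \<otimes>\<^bsub>P\<^esub> v \<in> N"
  shows "inv\<^bsub>P\<^esub> v \<otimes>\<^bsub>P\<^esub> u \<in> N"
  using N.m_inv_closed[OF uv] u v by (simp add: P.inv_mult_group)

lemma non_syllable:
  assumes "x \<in> carrier A <+> carrier B" "\<not> syllable R S x"
  obtains z where "z \<in> carrier A <+> carrier B" "isl z = isl x" "\<not> proper z"
    "inv\<^bsub>P\<^esub> (cls [z]) \<otimes>\<^bsub>P\<^esub> cls [x] \<in> N"
  using assms(1)
proof (cases rule: letter_class_cases)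
  case (left a)
  with assms(2) obtain h where h: "h \<in> H" "inv\<^bsub>A\<^esub> h \<otimes>\<^bsub>A\<^esub> a \<in> R" by (auto simp: syllable_def)
  then have "inl (inv\<^bsub>A\<^esub> h \<otimes>\<^bsub>A\<^esub> a) \<in> N" using left(1) inl_N[of "inv\<^bsub>A\<^esub> h \<otimes>\<^bsub>A\<^esub> a"] by simp
  then show ?thesis
    using that[of "Inl h"] h(1) left by (auto simp: proper_def InlI simp flip: amalg_inl_def)
next
  case (right b)
  with assms(2) obtain k where k: "k \<in> K" "inv\<^bsub>B\<^esub> k \<otimes>\<^bsub>B\<^esub> b \<in> S" by (auto simp: syllable_def)
  then have "inr (inv\<^bsub>B\<^esub> k \<otimes>\<^bsub>B\<^esub> b) \<in> N" using right(1) inr_N[of "inv\<^bsub>B\<^esub> k \<otimes>\<^bsub>B\<^esub> b"] by simp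
  then show ?thesis
    using that[of "Inr k"] k(1) right by (auto simp: proper_def InrI simp flip: amalg_inr_def)
qed

lemma syllable_notin_coset:
  assumes "x \<in> carrier A <+> carrier B" "syllable R S x"
    and z: "z \<in> carrier A <+> carrier B" "isl z = isl x" "\<not> proper z"
  shows "inv\<^bsub>P\<^esub> (cls [z]) \<otimes>\<^bsub>P\<^esub> cls [x] \<notin> N"
  using assms(1)
proof (cases rule: letter_class_cases)
  case (left a)
  with z obtain h where h: "h \<in> H" "z = Inl h" by (auto simp: proper_def)
  then have "inl (inv\<^bsub>A\<^esub> h \<otimes>\<^bsub>A\<^esub> a) \<notin> N"
    using left assms(2) inl_N[of "inv\<^bsub>A\<^esub> h \<otimes>\<^bsub>A\<^esub> a"] by (auto simp: syllable_def)
  then show ?thesis using h left by (simp flip: amalg_inl_def)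
next
  case (right b)
  with z obtain k where k: "k \<in> K" "z = Inr k" by (auto simp: proper_def)
  then have "inr (inv\<^bsub>B\<^esub> k \<otimes>\<^bsub>B\<^esub> b) \<notin> N"
    using right assms(2) inr_N[of "inv\<^bsub>B\<^esub> k \<otimes>\<^bsub>B\<^esub> b"] by (auto simp: syllable_def)
  then show ?thesis using k right by (simp flip: amalg_inr_def)
qed

text \<open>
  Suppose that \<open>x\<close> and \<open>y\<close>, from different factors, agree modulo \<open>N\<close>. If the inverse of \<open>y\<close> is a
  syllable, the alternating word with the letters \<open>y\<^sup>-\<^sup>1, x\<close> has length 2 but lies in \<open>N\<close>. Otherwise
  \<open>y\<close>, and with it \<open>x\<close>, is congruent to an element of the amalgamated subgroup, so \<open>x\<close> is not a
  syllable.
\<close>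

lemma syllable_notin_other_factor:
  assumes x: "x \<in> carrier A <+> carrier B" "syllable R S x"
    and y: "y \<in> carrier A <+> carrier B" "isl y \<noteq> isl x"
  shows "inv\<^bsub>P\<^esub> (cls [x]) \<otimes>\<^bsub>P\<^esub> cls [y] \<notin> N"
proof
  assume xy: "inv\<^bsub>P\<^esub> (cls [x]) \<otimes>\<^bsub>P\<^esub> cls [y] \<in> N"
  note yx = N_inv[OF letter_closed[OF x(1)] letter_closed[OF y(1)] xy]
  obtain y' where y': "y' \<in> carrier A <+> carrier B" "isl y' = isl y" "cls [y'] = inv\<^bsub>P\<^esub> (cls [y])"
    using inverse_letter[OF y(1)] .
  show False
  proof (cases "syllable R S y'")
    case True
    have "cls [y', x] \<in> N" using yx y'(3) cls_pair[OF y'(1) x(1)] by simp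
    then show False using reduced_notin_N[of "[y', x]"] True x(2) y' y(2) by simp
  next
    case False
    from non_syllable[OF y'(1) this] obtain z where z: "z \<in> carrier A <+> carrier B" "isl z = isl y'"
      "\<not> proper z" "inv\<^bsub>P\<^esub> (cls [z]) \<otimes>\<^bsub>P\<^esub> cls [y'] \<in> N" .
    obtain z' where z': "z' \<in> carrier A <+> carrier B" "isl z' = isl z" "cls [z'] = inv\<^bsub>P\<^esub> (cls [z])"
      "\<not> proper z'" using inverse_letter[OF z(1)] z(3) by metis
    obtain t where t: "t \<in> carrier A <+> carrier B" "isl t \<noteq> isl z'" "cls [t] = cls [z']" "\<not> proper t"
      using swap_letter[OF z'(1,4)] .
    have cl: "cls [x] \<in> carrier P" "cls [y] \<in> carrier P" "cls [z] \<in> carrier P" using x y z by simp_all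
    have "inv\<^bsub>P\<^esub> (cls [z]) \<otimes>\<^bsub>P\<^esub> inv\<^bsub>P\<^esub> (cls [y]) \<in> N" using z(4) y'(3) by simp
    from N.m_inv_closed[OF this] have "cls [y] \<otimes>\<^bsub>P\<^esub> cls [z] \<in> N"
      using cl by (simp add: P.inv_mult_group)
    from N_conj[OF cl(2,3) this] have "cls [z] \<otimes>\<^bsub>P\<^esub> cls [y] \<in> N" .
    from N.m_closed[OF this yx] have "cls [z] \<otimes>\<^bsub>P\<^esub> cls [x] \<in> N"
      using cl by (simp add: P.m_assoc P.inv_solve_left') (simp flip: P.m_assoc)
    moreover have "inv\<^bsub>P\<^esub> (cls [t]) = cls [z]" using t(3) z'(3) cl by simp
    ultimately show False
      using syllable_notin_coset[OF x t(1) _ t(4)] t(2) z' z y' y by auto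
  qed
qed

end

section \<open>Separation of cyclic subgroups of the amalgamated product\<close>

locale separating_amalgam = amalgamated_product A B H \<phi> K
  for A :: "('a, 'm) monoid_scheme" and B :: "('b, 'n) monoid_scheme"
    and H :: "'a set" and \<phi> :: "'a \<Rightarrow> 'b" and K :: "'b set" +
  assumes rf_A: "residually_finite A" and rf_B: "residually_finite B"
    and sep_H: "finitely_separable A H" and sep_K: "finitely_separable B K"
    and cofinal: "\<And>M N. normal_finite_index M A \<Longrightarrow> normal_finite_index N B \<Longrightarrow>
           \<exists>(R, S) \<in> Omega A B H K \<phi>. R \<subseteq> M \<and> S \<subseteq> N"
begin

text \<open>
  Separability turns each requirement into one on a normal subgroup of finite index of \<open>A\<close> or \<open>B\<close>, and
  finitely many of these can be intersected. Every requirement is inherited by smaller subgroups,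
  so a pair of \<open>\<Omega>\<close> below the intersections satisfies it. A letter outside \<open>H\<close> or \<open>K\<close> becomes a
  syllable by separability of \<open>H\<close> or \<open>K\<close>.
\<close>

lemma pair_exists:
  assumes E: "finite E" "\<And>x. x \<in> E \<Longrightarrow> proper x"
    and I: "finite I" "\<And>F g. (F, g) \<in> I \<Longrightarrow> finitely_separable A F \<and> g \<in> carrier A - F"
    and J: "finite J" "\<And>F g. (F, g) \<in> J \<Longrightarrow> finitely_separable B F \<and> g \<in> carrier B - F"
  shows "\<exists>R S. (R, S) \<in> Omega A B H K \<phi> \<and> (\<forall>x \<in> E. syllable R S x) \<and>
    (\<forall>F g f. (F, g) \<in> I \<longrightarrow> f \<in> F \<longrightarrow> inv\<^bsub>A\<^esub> f \<otimes>\<^bsub>A\<^esub> g \<notin> R) \<and>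
    (\<forall>F g f. (F, g) \<in> J \<longrightarrow> f \<in> F \<longrightarrow> inv\<^bsub>B\<^esub> f \<otimes>\<^bsub>B\<^esub> g \<notin> S)"
proof -
  let ?I = "I \<union> (\<lambda>a. (H, a)) ` (Inl -` E)" and ?J = "J \<union> (\<lambda>b. (K, b)) ` (Inr -` E)"
  have "finite ?I" "finite ?J" using E(1) I(1) J(1) by (simp_all add: finite_vimageI)
  moreover have "finitely_separable A F \<and> g \<in> carrier A - F" if "(F, g) \<in> ?I" for F g
    using that I(2) E(2) sep_H by (fastforce simp: proper_def)
  moreover have "finitely_separable B F \<and> g \<in> carrier B - F" if "(F, g) \<in> ?J" for F g
    using that J(2) E(2) sep_K by (fastforce simp: proper_def)
  ultimately obtain M N where M: "normal_finite_index M A"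
      "\<And>F g f. (F, g) \<in> ?I \<Longrightarrow> f \<in> F \<Longrightarrow> inv\<^bsub>A\<^esub> f \<otimes>\<^bsub>A\<^esub> g \<notin> M"
    and N: "normal_finite_index N B"
      "\<And>F g f. (F, g) \<in> ?J \<Longrightarrow> f \<in> F \<Longrightarrow> inv\<^bsub>B\<^esub> f \<otimes>\<^bsub>B\<^esub> g \<notin> N"
    using finitely_separable_avoid_many[OF A.group_axioms, of ?I]
      finitely_separable_avoid_many[OF B.group_axioms, of ?J] by metis
  obtain R S where RS: "(R, S) \<in> Omega A B H K \<phi>" "R \<subseteq> M" "S \<subseteq> N"
    using cofinal[OF M(1) N(1)] by blast
  show ?thesis
  proof (intro exI[of _ R] exI[of _ S] conjI RS(1) ballI)
    fix x assume x: "x \<in> E"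
    then have "proper x" by (rule E(2))
    then show "syllable R S x"
      using M(2)[of H] N(2)[of K] RS(2,3) x
      by (cases x) (auto simp: syllable_def proper_def image_iff)
  next
    show "\<forall>F g f. (F, g) \<in> I \<longrightarrow> f \<in> F \<longrightarrow> inv\<^bsub>A\<^esub> f \<otimes>\<^bsub>A\<^esub> g \<notin> R"
      using M(2) RS(2) by (meson UnI1 subsetD)
    show "\<forall>F g f. (F, g) \<in> J \<longrightarrow> f \<in> F \<longrightarrow> inv\<^bsub>B\<^esub> f \<otimes>\<^bsub>B\<^esub> g \<notin> S"
      using N(2) RS(3) by (meson UnI1 subsetD)
  qed
qed

text \<open>
  It has to be arranged that \<open>g\<close> is not congruent modulo \<open>N\<close> to any power of the letter \<open>x\<close>; all
  these powers are letters from the factor of \<open>x\<close>. If \<open>g\<close> is a reduced word of length at least 2,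
  keep its length. If \<open>g\<close> is a single letter from the other factor outside the amalgamated
  subgroup, keep it a syllable. If \<open>g\<close> lies in the factor of \<open>x\<close>, use that the cyclic group is
  separable there.
\<close>

lemma elliptic_cyclic_separation:
  assumes x: "x \<in> carrier A <+> carrier B"
    and sepA: "\<And>a. x = Inl a \<Longrightarrow> finitely_separable A (generate A {a})"
    and sepB: "\<And>b. x = Inr b \<Longrightarrow> finitely_separable B (generate B {b})"
    and g: "g \<in> carrier P" "g \<notin> generate P {cls [x]}"
  shows "separated_by_finite_action g (generate P {cls [x]})"
proof -
  let ?c = "cls [x]"
  have c: "?c \<in> carrier P" using x by simp
  have pow: "?c [^]\<^bsub>P\<^esub> k \<in> generate P {?c}" for k :: nat
    using P.generate_pow[OF c] by (auto simp flip: int_pow_int)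
  have "\<exists>R S. (R, S) \<in> Omega A B H K \<phi> \<and>
    (\<forall>N len. length_quotient A B H \<phi> K R S N len \<longrightarrow> (\<forall>k :: nat. inv\<^bsub>P\<^esub> g \<otimes>\<^bsub>P\<^esub> ?c [^]\<^bsub>P\<^esub> k \<notin> N))"
  proof -
    obtain w where w: "w \<in> W" "cls w = g" "length w \<le> 1 \<or> alternating w \<and> (\<forall>x \<in> set w. proper x)"
      using reduced_word[OF g(1)] .
    have "g \<noteq> \<one>\<^bsub>P\<^esub>" using g(2) generate.one by metis
    then have "w \<noteq> []" using w(2) one_P by auto
    then consider (long) "length w \<ge> 2" "alternating w" "\<forall>x \<in> set w. proper x"
      | (other) z where "w = [z]" "isl z \<noteq> isl x" "proper z"
      | (same) z where "z \<in> carrier A <+> carrier B" "isl z = isl x" "cls [z] = g"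
    proof (cases "length w \<ge> 2")
      case False
      with \<open>w \<noteq> []\<close> obtain z where z: "w = [z]" by (cases w) (auto simp: Suc_le_eq)
      with w have zl: "z \<in> carrier A <+> carrier B" "cls [z] = g" by auto
      show ?thesis
      proof (cases "isl z \<noteq> isl x \<and> proper z")
        case False
        then consider "isl z = isl x" | "isl z \<noteq> isl x" "\<not> proper z" by blast
        then show ?thesis using zl swap_letter[OF zl(1)] same by cases metis+
      qed (use other z in blast)
    qed (use w(3) long in auto)
    then show ?thesis
    proof cases
      case long
      obtain R S where RS: "(R, S) \<in> Omega A B H K \<phi>" "\<And>x. x \<in> set w \<Longrightarrow> syllable R S x"
        using pair_exists[of "set w" "{}" "{}"] long(3) by auto
      show ?thesis
      proof (intro exI[of _ R] exI[of _ S] conjI RS allI impI notI)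
        fix N len k assume q: "length_quotient A B H \<phi> K R S N len"
          and "inv\<^bsub>P\<^esub> g \<otimes>\<^bsub>P\<^esub> ?c [^]\<^bsub>P\<^esub> (k :: nat) \<in> N"
        interpret q: length_quotient A B H \<phi> K R S N len by (rule q)
        obtain y where y: "y \<in> carrier A <+> carrier B" "cls [y] = ?c [^]\<^bsub>P\<^esub> k"
          using power_letter[OF x] .
        have "length w = len (?c [^]\<^bsub>P\<^esub> k)"
          using q.len_reduced[OF long(2)] RS(2) q.len_cong[OF g(1) _ \<open>inv\<^bsub>P\<^esub> g \<otimes>\<^bsub>P\<^esub> _ \<in> N\<close>] c w(2)
          by simp
        also have "\<dots> \<le> 1" using q.len_le[of "[y]"] y by simp
        finally show False using long(1) by simp
      qed
    next
      case (other z)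
      then have z: "z \<in> carrier A <+> carrier B" "cls [z] = g" using w by auto
      obtain R S where RS: "(R, S) \<in> Omega A B H K \<phi>" "syllable R S z"
        using pair_exists[of "{z}" "{}" "{}"] other by auto
      show ?thesis
      proof (intro exI[of _ R] exI[of _ S] conjI RS allI impI)
        fix N len and k :: nat assume q: "length_quotient A B H \<phi> K R S N len"
        interpret q: length_quotient A B H \<phi> K R S N len by (rule q)
        obtain y where y: "y \<in> carrier A <+> carrier B" "isl y = isl x" "cls [y] = ?c [^]\<^bsub>P\<^esub> k"
          using power_letter[OF x] .
        show "inv\<^bsub>P\<^esub> g \<otimes>\<^bsub>P\<^esub> ?c [^]\<^bsub>P\<^esub> k \<notin> N"
          using q.syllable_notin_other_factor[OF z(1) RS(2) y(1)] other y z(2) by simp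
      qed
    next
      case (same z)
      from x show ?thesis
      proof (cases rule: letter_class_cases)
        case (left a)
        with same obtain a' where a': "a' \<in> carrier A" "g = inl a'"
          by (auto simp flip: amalg_inl_def)
        have img: "generate P {?c} = inl ` generate A {a}"
          using inl.generate_img[of "{a}"] left by simp
        with g(2) a' have "a' \<notin> generate A {a}" by blast
        with sepA[OF left(2)] a'(1)
        have "\<exists>R S. (R, S) \<in> Omega A B H K \<phi> \<and> (\<forall>f \<in> generate A {a}. inv\<^bsub>A\<^esub> f \<otimes>\<^bsub>A\<^esub> a' \<notin> R)"
          using pair_exists[of "{}" "{(generate A {a}, a')}" "{}"] by auto
        then obtain R S where RS: "(R, S) \<in> Omega A B H K \<phi>"
          "\<And>f. f \<in> generate A {a} \<Longrightarrow> inv\<^bsub>A\<^esub> f \<otimes>\<^bsub>A\<^esub> a' \<notin> R" by blast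
        show ?thesis
        proof (intro exI[of _ R] exI[of _ S] conjI RS allI impI notI)
          fix N len k assume q: "length_quotient A B H \<phi> K R S N len"
            and gN: "inv\<^bsub>P\<^esub> g \<otimes>\<^bsub>P\<^esub> ?c [^]\<^bsub>P\<^esub> (k :: nat) \<in> N"
          interpret q: length_quotient A B H \<phi> K R S N len by (rule q)
          obtain f where f: "f \<in> generate A {a}" "?c [^]\<^bsub>P\<^esub> k = inl f" using pow[of k] img by auto
          have fc: "f \<in> carrier A" using A.generate_in_carrier[of "{a}" f] f left by simp
          have "inl (inv\<^bsub>A\<^esub> f \<otimes>\<^bsub>A\<^esub> a') \<in> N"
            using q.N_inv[OF g(1) _ gN] f a' fc by simp
          then show False using q.inl_N[of "inv\<^bsub>A\<^esub> f \<otimes>\<^bsub>A\<^esub> a'"] RS(2)[OF f(1)] fc a' by simp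
        qed
      next
        case (right b)
        with same obtain b' where b': "b' \<in> carrier B" "g = inr b'"
          by (auto simp flip: amalg_inr_def)
        have img: "generate P {?c} = inr ` generate B {b}"
          using inr.generate_img[of "{b}"] right by simp
        with g(2) b' have "b' \<notin> generate B {b}" by blast
        with sepB[OF right(2)] b'(1)
        have "\<exists>R S. (R, S) \<in> Omega A B H K \<phi> \<and> (\<forall>f \<in> generate B {b}. inv\<^bsub>B\<^esub> f \<otimes>\<^bsub>B\<^esub> b' \<notin> S)"
          using pair_exists[of "{}" "{}" "{(generate B {b}, b')}"] by auto
        then obtain R S where RS: "(R, S) \<in> Omega A B H K \<phi>"
          "\<And>f. f \<in> generate B {b} \<Longrightarrow> inv\<^bsub>B\<^esub> f \<otimes>\<^bsub>B\<^esub> b' \<notin> S" by blast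
        show ?thesis
        proof (intro exI[of _ R] exI[of _ S] conjI RS allI impI notI)
          fix N len k assume q: "length_quotient A B H \<phi> K R S N len"
            and gN: "inv\<^bsub>P\<^esub> g \<otimes>\<^bsub>P\<^esub> ?c [^]\<^bsub>P\<^esub> (k :: nat) \<in> N"
          interpret q: length_quotient A B H \<phi> K R S N len by (rule q)
          obtain f where f: "f \<in> generate B {b}" "?c [^]\<^bsub>P\<^esub> k = inr f" using pow[of k] img by auto
          have fc: "f \<in> carrier B" using B.generate_in_carrier[of "{b}" f] f right by simp
          have "inr (inv\<^bsub>B\<^esub> f \<otimes>\<^bsub>B\<^esub> b') \<in> N"
            using q.N_inv[OF g(1) _ gN] f b' fc by simp
          then show False using q.inr_N[of "inv\<^bsub>B\<^esub> f \<otimes>\<^bsub>B\<^esub> b'"] RS(2)[OF f(1)] fc b' by simp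
        qed
      qed
    qed
  qed
  then obtain R S where RS: "(R, S) \<in> Omega A B H K \<phi>"
    and sep: "\<And>N len k. length_quotient A B H \<phi> K R S N len \<Longrightarrow> inv\<^bsub>P\<^esub> g \<otimes>\<^bsub>P\<^esub> ?c [^]\<^bsub>P\<^esub> (k :: nat) \<notin> N"
    by blast
  obtain N len where q: "length_quotient A B H \<phi> K R S N len" using length_quotient_exists[OF RS] by blast
  interpret q: length_quotient A B H \<phi> K R S N len by (rule q)
  have fin: "normal_finite_index R A" "normal_finite_index S B" using RS by (auto simp: Omega_def)
  obtain m :: nat where m: "m > 0" "?c [^]\<^bsub>P\<^esub> m \<in> N"
    using x
  proof (cases rule: letter_class_cases)
    case (left a)
    obtain m :: nat where "m > 0" "a [^]\<^bsub>A\<^esub> m \<in> R"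
      using power_mem_finite_index[OF A.group_axioms fin(1) left(1)] .
    with left that[of m] q.inl_N[of "a [^]\<^bsub>A\<^esub> m"] show ?thesis by (simp add: inl.hom_nat_pow)
  next
    case (right b)
    obtain m :: nat where "m > 0" "b [^]\<^bsub>B\<^esub> m \<in> S"
      using power_mem_finite_index[OF B.group_axioms fin(2) right(1)] .
    with right that[of m] q.inr_N[of "b [^]\<^bsub>B\<^esub> m"] show ?thesis by (simp add: inr.hom_nat_pow)
  qed
  show ?thesis
    by (rule elliptic_separation[OF RS q.N q.inl_N q.inr_N c g(1) m sep[OF q]])
qed

lemma power_word:
  assumes "w \<in> W"
  shows "cls w [^]\<^bsub>P\<^esub> (k :: nat) = cls (concat (replicate k w))" "concat (replicate k w) \<in> W"
proof (induction k)
  case 0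
  show "cls w [^]\<^bsub>P\<^esub> (0 :: nat) = cls (concat (replicate 0 w))" "concat (replicate 0 w) \<in> W"
    by (simp_all add: one_P)
next
  case (Suc k)
  have "cls w [^]\<^bsub>P\<^esub> Suc k = cls w \<otimes>\<^bsub>P\<^esub> cls w [^]\<^bsub>P\<^esub> k"
    using P.nat_pow_Suc2[OF cls_closed[OF assms]] .
  then show "cls w [^]\<^bsub>P\<^esub> Suc k = cls (concat (replicate (Suc k) w))"
    using mult_class[OF assms Suc(2)] by (simp add: Suc(1))
  show "concat (replicate (Suc k) w) \<in> W" using assms Suc(2) by auto
qed

text \<open>
  Let \<open>L\<close> bound the lengths of words for \<open>g\<close> and for its inverse. Modulo \<open>N\<close>, the \<open>k\<close>-th power of the
  cyclically reduced word has length \<open>|k|\<close> times that of the word, hence is not congruent to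
  \<open>g\<close> if \<open>|k| > L\<close>. Each of the finitely many elements \<open>d k = g\<^sup>-\<^sup>1 c\<^sup>k\<close> with \<open>|k| \<le> L\<close> is
  nontrivial, and it is kept outside \<open>N\<close> by its reduced word \<open>v k\<close>: by its length if this is at least
  2, and by residual finiteness of the factor if it is a single letter.
\<close>

lemma hyperbolic_cyclic_separation:
  assumes w: "w \<in> W" "alternating w" "\<And>x. x \<in> set w \<Longrightarrow> proper x" "isl (last w) \<noteq> isl (hd w)" "w \<noteq> []"
    and g: "g \<in> carrier P" "g \<notin> generate P {cls w}"
  shows "separated_by_finite_action g (generate P {cls w})"
proof -
  let ?c = "cls w"
  have c: "?c \<in> carrier P" using w(1) by simp
  obtain u where u: "u \<in> W" "g = cls u" using word_of[OF g(1)] .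
  obtain u' where u': "u' \<in> W" "inv\<^bsub>P\<^esub> g = cls u'" using word_of[OF P.inv_closed[OF g(1)]] .
  define L where "L = int (max (length u) (length u'))"
  define d where "d k = inv\<^bsub>P\<^esub> g \<otimes>\<^bsub>P\<^esub> ?c [^]\<^bsub>P\<^esub> k" for k :: int
  have dP: "d k \<in> carrier P" for k using g(1) c by (simp add: d_def)
  have d1: "d k \<noteq> \<one>\<^bsub>P\<^esub>" for k
  proof
    assume "d k = \<one>\<^bsub>P\<^esub>"
    then have "g = ?c [^]\<^bsub>P\<^esub> k" using g(1) c by (simp add: d_def P.inv_solve_left')
    with g(2) show False using P.generate_pow[OF c] by blast
  qed
  have "\<forall>k. \<exists>v. v \<in> W \<and> cls v = d k \<and> (length v \<le> 1 \<or> alternating v \<and> (\<forall>x \<in> set v. proper x))"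
    using reduced_word[OF dP] by metis
  then obtain v where v: "\<And>k. v k \<in> W" "\<And>k. cls (v k) = d k"
    "\<And>k. length (v k) \<le> 1 \<or> alternating (v k) \<and> (\<forall>x \<in> set (v k). proper x)" by metis
  \<comment> \<open>Letters to be kept syllables, and single letters to be kept apart from the unit.\<close>
  define E where "E = set w \<union> (\<Union>k\<in>{-L..L}. if length (v k) \<ge> 2 then set (v k) else {})"
  define I where "I = {({\<one>\<^bsub>A\<^esub>}, a) | a. \<exists>k \<in> {-L..L}. v k = [Inl a]}"
  define J where "J = {({\<one>\<^bsub>B\<^esub>}, b) | b. \<exists>k \<in> {-L..L}. v k = [Inr b]}"
  have finE: "finite E" by (simp add: E_def)
  have properE: "proper x" if "x \<in> E" for x
  proof -
    from that consider "x \<in> set w" | k where "length (v k) \<ge> 2" "x \<in> set (v k)"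
      by (auto simp: E_def split: if_splits)
    then show ?thesis
    proof cases
      case (2 k)
      then show ?thesis using v(3)[of k] by auto
    qed (rule w(3))
  qed
  have finI: "finite I"
    by (rule finite_subset[of _ "(\<lambda>k. ({\<one>\<^bsub>A\<^esub>}, projl (hd (v k)))) ` {-L..L}"]) (force simp: I_def)+
  have finJ: "finite J"
    by (rule finite_subset[of _ "(\<lambda>k. ({\<one>\<^bsub>B\<^esub>}, projr (hd (v k)))) ` {-L..L}"]) (force simp: J_def)+
  have sepI: "finitely_separable A F \<and> a \<in> carrier A - F" if "(F, a) \<in> I" for F a
  proof -
    from that obtain k where k: "F = {\<one>\<^bsub>A\<^esub>}" "v k = [Inl a]" by (auto simp: I_def)
    then have "a \<in> carrier A" "inl a \<noteq> \<one>\<^bsub>P\<^esub>" using v(1)[of k] v(2)[of k] d1 by (auto simp: amalg_inl_def)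
    then show ?thesis using rf_A k(1) by (auto simp: residually_finite_def)
  qed
  have sepJ: "finitely_separable B F \<and> b \<in> carrier B - F" if "(F, b) \<in> J" for F b
  proof -
    from that obtain k where k: "F = {\<one>\<^bsub>B\<^esub>}" "v k = [Inr b]" by (auto simp: J_def)
    then have "b \<in> carrier B" "inr b \<noteq> \<one>\<^bsub>P\<^esub>" using v(1)[of k] v(2)[of k] d1 by (auto simp: amalg_inr_def)
    then show ?thesis using rf_B k(1) by (auto simp: residually_finite_def)
  qed
  from pair_exists[OF finE properE finI sepI finJ sepJ]
  obtain R S where RS: "(R, S) \<in> Omega A B H K \<phi>" and E: "\<And>x. x \<in> E \<Longrightarrow> syllable R S x"
    and I: "\<And>F a f. (F, a) \<in> I \<Longrightarrow> f \<in> F \<Longrightarrow> inv\<^bsub>A\<^esub> f \<otimes>\<^bsub>A\<^esub> a \<notin> R"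
    and J: "\<And>F b f. (F, b) \<in> J \<Longrightarrow> f \<in> F \<Longrightarrow> inv\<^bsub>B\<^esub> f \<otimes>\<^bsub>B\<^esub> b \<notin> S"
    by blast
  obtain N len where q: "length_quotient A B H \<phi> K R S N len" using length_quotient_exists[OF RS] by blast
  interpret q: length_quotient A B H \<phi> K R S N len by (rule q)
  have near: "d k \<notin> N" if k: "k \<in> {-L..L}" for k
  proof -
    have "v k \<noteq> []" using v(2)[of k] d1[of k] one_P by auto
    then consider "length (v k) \<ge> 2" | a where "v k = [Inl a]" | b where "v k = [Inr b]"
      by (cases "v k" rule: remdups_adj.cases) (auto, metis sum.exhaust)
    then show ?thesis
    proof cases
      case 1
      then have "set (v k) \<subseteq> (if length (v k) \<ge> 2 then set (v k) else {})" by simp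
      then have "set (v k) \<subseteq> E" using k unfolding E_def by blast
      then have "alternating (v k)" "\<forall>x \<in> set (v k). syllable R S x"
        using v(3)[of k] 1 E by auto
      then show ?thesis using q.reduced_notin_N[of "v k"] \<open>v k \<noteq> []\<close> v(2) by simp
    next
      case (2 a)
      then have a: "a \<in> carrier A" "d k = inl a" using v(1)[of k] v(2)[of k] by (auto simp: amalg_inl_def)
      have "({\<one>\<^bsub>A\<^esub>}, a) \<in> I" using 2 k by (auto simp: I_def)
      from I[OF this singletonI] show ?thesis using q.inl_N a by simp
    next
      case (3 b)
      then have b: "b \<in> carrier B" "d k = inr b" using v(1)[of k] v(2)[of k] by (auto simp: amalg_inr_def)
      have "({\<one>\<^bsub>B\<^esub>}, b) \<in> J" using 3 k by (auto simp: J_def)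
      from J[OF this singletonI] show ?thesis using q.inr_N b by simp
    qed
  qed
  have len_pow: "len (?c [^]\<^bsub>P\<^esub> k) = k * length w" for k :: nat
  proof -
    have "alternating (concat (replicate k w)) \<and> (k > 0 \<longrightarrow> hd (concat (replicate k w)) = hd w)"
      using w by (induction k) (auto simp: successively_append_iff)
    moreover have "\<forall>x \<in> set (concat (replicate k w)). syllable R S x"
      using E by (simp add: E_def)
    moreover have "length (concat (replicate k w)) = k * length w" by (induction k) auto
    ultimately show ?thesis using q.len_reduced power_word(1)[OF w(1)] by simp
  qed
  have inf_nat: "k = 0" if "?c [^]\<^bsub>P\<^esub> k \<in> N" for k :: nat
    using q.len_N[OF that] len_pow[of k] w(5) by simp
  have far: "inv\<^bsub>P\<^esub> (cls t) \<otimes>\<^bsub>P\<^esub> ?c [^]\<^bsub>P\<^esub> k \<notin> N" if t: "t \<in> W" "length t < k" for t and k :: nat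
  proof
    assume "inv\<^bsub>P\<^esub> (cls t) \<otimes>\<^bsub>P\<^esub> ?c [^]\<^bsub>P\<^esub> k \<in> N"
    then have "len (cls t) = k * length w"
      using q.len_cong[OF cls_closed[OF t(1)] P.nat_pow_closed[OF c]] len_pow by metis
    moreover have "k \<le> k * length w" using w(5) by (cases w) auto
    ultimately show False using q.len_le[OF t(1)] t(2) by simp
  qed
  have sep: "d k \<notin> N" for k
  proof (cases "k \<in> {-L..L}")
    case True
    then show ?thesis by (rule near)
  next
    case False
    then consider n where "k = int n" "length u < n" | n where "k = - int n" "length u' < n"
      by (cases k rule: int_cases2) (auto simp: L_def)
    then show ?thesis
    proof cases
      case (1 n)
      then show ?thesis using far[OF u(1)] u(2) by (simp add: d_def int_pow_int)
    next
      case (2 n)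
      show ?thesis
      proof
        assume "d k \<in> N"
        then have "inv\<^bsub>P\<^esub> (?c [^]\<^bsub>P\<^esub> n \<otimes>\<^bsub>P\<^esub> g) \<in> N"
          using 2(1) c g(1) by (simp add: d_def P.int_pow_neg_int P.inv_mult_group)
        then have "?c [^]\<^bsub>P\<^esub> n \<otimes>\<^bsub>P\<^esub> g \<in> N" using q.N.m_inv_closed c g(1) by fastforce
        then have "g \<otimes>\<^bsub>P\<^esub> ?c [^]\<^bsub>P\<^esub> n \<in> N" using q.N_conj c g(1) by blast
        then show False using far[OF u'(1) 2(2)] u'(2)[symmetric] g(1) by simp
      qed
    qed
  qed
  have inf: "k = 0" if k: "?c [^]\<^bsub>P\<^esub> k \<in> N" for k :: int
  proof (cases k rule: int_cases2)
    case (nonneg n)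
    then show ?thesis using k inf_nat by (simp add: int_pow_int)
  next
    case (nonpos n)
    then have "inv\<^bsub>P\<^esub> (?c [^]\<^bsub>P\<^esub> n) \<in> N" using k c by (simp add: P.int_pow_neg_int)
    then have "?c [^]\<^bsub>P\<^esub> n \<in> N" using q.N.m_inv_closed c by fastforce
    then show ?thesis using nonpos inf_nat by simp
  qed
  show ?thesis
    by (rule hyperbolic_separation[OF RS q.N q.inl_N q.inr_N c g(1) inf sep[unfolded d_def]])
qed

lemma conjugate_generate:
  assumes y: "y \<in> carrier P" and c: "c \<in> carrier P"
  shows "generate P {y \<otimes>\<^bsub>P\<^esub> c \<otimes>\<^bsub>P\<^esub> inv\<^bsub>P\<^esub> y} = (\<lambda>f. y \<otimes>\<^bsub>P\<^esub> f \<otimes>\<^bsub>P\<^esub> inv\<^bsub>P\<^esub> y) ` generate P {c}"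
proof -
  have cancel: "inv\<^bsub>P\<^esub> y \<otimes>\<^bsub>P\<^esub> (y \<otimes>\<^bsub>P\<^esub> f) = f" if "f \<in> carrier P" for f
    using y that by (simp flip: P.m_assoc)
  have "(\<lambda>f. y \<otimes>\<^bsub>P\<^esub> f \<otimes>\<^bsub>P\<^esub> inv\<^bsub>P\<^esub> y) \<in> hom P P"
    using y by (intro homI) (simp_all add: P.m_assoc cancel)
  then interpret cj: group_hom P P "\<lambda>f. y \<otimes>\<^bsub>P\<^esub> f \<otimes>\<^bsub>P\<^esub> inv\<^bsub>P\<^esub> y"
    by (intro group_hom.intro group_hom_axioms.intro group_P)
  show ?thesis using cj.generate_img[of "{c}"] c by simp
qed

text \<open>
  The point \<open>y\<^sup>-\<^sup>1 p\<close> does for \<open>c\<close> and \<open>g\<close> what \<open>p\<close> does for their conjugates by \<open>y\<close>.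
\<close>

lemma conjugate_separation:
  assumes y: "y \<in> carrier P" and c: "c \<in> carrier P" and g: "g \<in> carrier P"
    and X: "p \<in> X" "finite X" "acts_on P X \<psi>"
    and sep: "\<And>f. f \<in> generate P {y \<otimes>\<^bsub>P\<^esub> c \<otimes>\<^bsub>P\<^esub> inv\<^bsub>P\<^esub> y} \<Longrightarrow> \<psi> (y \<otimes>\<^bsub>P\<^esub> g \<otimes>\<^bsub>P\<^esub> inv\<^bsub>P\<^esub> y) p \<noteq> \<psi> f p"
  shows "\<exists>p \<in> X. finite X \<and> acts_on P X \<psi> \<and> (\<forall>f \<in> generate P {c}. \<psi> g p \<noteq> \<psi> f p)"
proof (intro bexI[of _ "\<psi> (inv\<^bsub>P\<^esub> y) p"] conjI ballI X)
  show iyp: "\<psi> (inv\<^bsub>P\<^esub> y) p \<in> X" using acts_on_closed[OF X(3) _ X(1)] y by simp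
  have shift: "\<psi> (y \<otimes>\<^bsub>P\<^esub> u \<otimes>\<^bsub>P\<^esub> inv\<^bsub>P\<^esub> y) p = \<psi> y (\<psi> u (\<psi> (inv\<^bsub>P\<^esub> y) p))" if "u \<in> carrier P" for u
    using that y X(1) iyp by (simp add: acts_on_mult[OF X(3)])
  fix f assume f: "f \<in> generate P {c}"
  then have "f \<in> carrier P" using P.generate_in_carrier[of "{c}" f] c by simp
  with sep[of "y \<otimes>\<^bsub>P\<^esub> f \<otimes>\<^bsub>P\<^esub> inv\<^bsub>P\<^esub> y"] f g
  show "\<psi> g (\<psi> (inv\<^bsub>P\<^esub> y) p) \<noteq> \<psi> f (\<psi> (inv\<^bsub>P\<^esub> y) p)"
    by (auto simp: conjugate_generate[OF y c] shift)
qed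

lemma conjugate_factor_cyclic:
  assumes y: "y \<in> carrier P" and c: "c \<in> carrier P" and c': "y \<otimes>\<^bsub>P\<^esub> c \<otimes>\<^bsub>P\<^esub> inv\<^bsub>P\<^esub> y = c'"
  shows "conjugate_subgroups P (generate P {c}) (generate P {c'})"
  unfolding conjugate_subgroups_def
proof (rule bexI[of _ "inv\<^bsub>P\<^esub> y"])
  have cP: "generate P {c} \<subseteq> carrier P" using P.generate_incl[of "{c}"] c by simp
  have "inv\<^bsub>P\<^esub> y \<otimes>\<^bsub>P\<^esub> (y \<otimes>\<^bsub>P\<^esub> f \<otimes>\<^bsub>P\<^esub> inv\<^bsub>P\<^esub> y) \<otimes>\<^bsub>P\<^esub> inv\<^bsub>P\<^esub> (inv\<^bsub>P\<^esub> y) = f" if "f \<in> carrier P" for f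
    using y that by (simp add: P.m_assoc) (simp flip: P.m_assoc)
  then show "generate P {c} = inv\<^bsub>P\<^esub> y <#\<^bsub>P\<^esub> generate P {c'} #>\<^bsub>P\<^esub> inv\<^bsub>P\<^esub> (inv\<^bsub>P\<^esub> y)"
    using cP by (auto simp: c'[symmetric] conjugate_generate[OF y c] l_coset_def r_coset_def subset_iff)
qed (use y in simp)

text \<open>
  If a conjugate of \<open>c\<close> lies in a factor, the cyclic group that it generates there is separable in
  that factor: otherwise the group generated by \<open>c\<close> would be conjugate to one of the excluded
  subgroups.
\<close>

theorem cyclic_separable:
  assumes c: "c \<in> carrier P"
    and exc: "\<not> (\<exists>D \<in> image inl ` nonseparable_cyclics A \<union> image inr ` nonseparable_cyclics B.
                 conjugate_subgroups P (generate P {c}) D)"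
  shows "finitely_separable P (generate P {c})"
proof (rule finitely_separable_by_actions[OF group_P])
  show "subgroup (generate P {c}) P" using c by (simp add: P.generate_is_subgroup)
next
  fix g assume g: "g \<in> carrier P - generate P {c}"
  obtain w y where w: "w \<in> W" and y: "y \<in> carrier P" "cls w = y \<otimes>\<^bsub>P\<^esub> c \<otimes>\<^bsub>P\<^esub> inv\<^bsub>P\<^esub> y"
    and red: "length w \<le> 1 \<or> alternating w \<and> (\<forall>x \<in> set w. proper x) \<and> isl (last w) \<noteq> isl (hd w)"
    using cyclically_reduced_word[OF c] .
  let ?g = "y \<otimes>\<^bsub>P\<^esub> g \<otimes>\<^bsub>P\<^esub> inv\<^bsub>P\<^esub> y"
  have g': "?g \<in> carrier P" using g y by simp
  have notin: "?g \<notin> generate P {cls w}"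
  proof
    assume "?g \<in> generate P {cls w}"
    then obtain f where f: "f \<in> generate P {c}" "?g = y \<otimes>\<^bsub>P\<^esub> f \<otimes>\<^bsub>P\<^esub> inv\<^bsub>P\<^esub> y"
      unfolding y(2) conjugate_generate[OF y(1) c] by blast
    then have "f \<in> carrier P" using P.generate_in_carrier[of "{c}" f] c by simp
    with f g y(1) show False by simp
  qed
  have "separated_by_finite_action ?g (generate P {cls w})"
  proof (cases "\<exists>x. x \<in> carrier A <+> carrier B \<and> cls [x] = cls w")
    case True
    then obtain x where x: "x \<in> carrier A <+> carrier B" "cls [x] = cls w" by blast
    note conj = conjugate_factor_cyclic[OF y(1) c y(2)[symmetric]]
    have "finitely_separable A (generate A {a})" if "x = Inl a" for a
    proof (rule ccontr)
      assume "\<not> ?thesis"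
      then have "generate A {a} \<in> nonseparable_cyclics A"
        using x(1) that by (auto simp: nonseparable_cyclics_def cyclic_subgroup_def)
      moreover have "inl ` generate A {a} = generate P {cls w}"
        using inl.generate_img[of "{a}"] x that by (auto simp: amalg_inl_def)
      ultimately show False using exc conj by (metis UnI1 imageI)
    qed
    moreover have "finitely_separable B (generate B {b})" if "x = Inr b" for b
    proof (rule ccontr)
      assume "\<not> ?thesis"
      then have "generate B {b} \<in> nonseparable_cyclics B"
        using x(1) that by (auto simp: nonseparable_cyclics_def cyclic_subgroup_def)
      moreover have "inr ` generate B {b} = generate P {cls w}"
        using inr.generate_img[of "{b}"] x that by (auto simp: amalg_inr_def)
      ultimately show False using exc conj by (metis UnI2 imageI)
    qed
    ultimately show ?thesis
      using elliptic_cyclic_separation[OF x(1) _ _ g'] notin unfolding x(2) by blast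
  next
    case False
    have "cls [Inl \<one>\<^bsub>A\<^esub>] = cls []" by (intro class_eq amalg_cong.one_left)
    moreover have "Inl \<one>\<^bsub>A\<^esub> \<in> carrier A <+> carrier B" by (intro InlI) simp
    ultimately have "w \<noteq> []" using False by metis
    moreover from this have "\<not> length w \<le> 1" using False w by (cases w) auto
    ultimately show ?thesis
      using hyperbolic_cyclic_separation[OF w _ _ _ _ g' notin] red by blast
  qed
  then obtain X :: "(('a + 'b) list set set \<times> ('a + 'b) list set set) set" and \<psi> p
    where X: "p \<in> X" "finite X" "acts_on P X \<psi>"
      and sep: "\<And>f. f \<in> generate P {cls w} \<Longrightarrow> \<psi> ?g p \<noteq> \<psi> f p" by blast
  have "\<exists>p \<in> X. finite X \<and> acts_on P X \<psi> \<and> (\<forall>f \<in> generate P {c}. \<psi> g p \<noteq> \<psi> f p)"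
    by (rule conjugate_separation[OF y(1) c _ X sep]) (use g y(2) in simp_all)
  then show "separated_by_finite_action g (generate P {c})" by blast
qed

end

theorem theorem1p3:
  fixes A :: "('a, 'm) monoid_scheme" and B :: "('b, 'n) monoid_scheme"
    and H :: "'a set" and K :: "'b set" and \<phi> :: "'a \<Rightarrow> 'b"
    and G :: "('a + 'b) list set monoid"
  assumes "group A" and "group B"
    and "subgroup H A" and "subgroup K B"
    and "\<phi> \<in> iso (A\<lparr>carrier := H\<rparr>) (B\<lparr>carrier := K\<rparr>)"
    and "G = amalg_product A B H \<phi>"
    and "residually_finite A" and "residually_finite B"
    and "finitely_separable A H" and "finitely_separable B K"
    and "\<And>M N. normal_finite_index M A \<Longrightarrow> normal_finite_index N B \<Longrightarrow>
           \<exists>(R, S) \<in> Omega A B H K \<phi>. R \<subseteq> M \<and> S \<subseteq> N"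
  shows "(\<forall>C. cyclic_subgroup C G \<and>
              \<not> (\<exists>D \<in> image (amalg_inl A B H \<phi>) ` nonseparable_cyclics A \<union>
                       image (amalg_inr A B H \<phi>) ` nonseparable_cyclics B.
                   conjugate_subgroups G C D)
            \<longrightarrow> finitely_separable G C) \<and>
         (pi_c_group A \<and> pi_c_group B \<longrightarrow> pi_c_group G)"
proof -
  have "\<phi> ` H = K" using assms(5) by (auto simp: iso_def bij_betw_def)
  then have "H \<subseteq> carrier A" "\<phi> ` H \<subseteq> carrier B"
    using subgroup.subset[OF assms(3)] subgroup.subset[OF assms(4)] by simp_all
  then interpret separating_amalgam A B H \<phi> K
    by (intro separating_amalgam.intro separating_amalgam_axioms.intro amalgamated_product.intro
        amalgamated_product_axioms.intro amalgamation.intro amalgamation_axioms.intro assms)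
  have main: "finitely_separable G C" if "cyclic_subgroup C G"
    "\<not> (\<exists>D \<in> image inl ` nonseparable_cyclics A \<union> image inr ` nonseparable_cyclics B.
      conjugate_subgroups G C D)" for C
    using that cyclic_separable by (auto simp: cyclic_subgroup_def assms(6))
  moreover have "pi_c_group G" if "pi_c_group A" "pi_c_group B"
  proof -
    have "nonseparable_cyclics A = {}" "nonseparable_cyclics B = {}"
      using that by (auto simp: nonseparable_cyclics_def pi_c_group_def)
    then show ?thesis using main group_P by (simp add: pi_c_group_def assms(6))
  qed
  ultimately show ?thesis by blast
qed

end
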